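(* Let $p:(\Sigma,\pi_\Sigma)\to(M,\pi_M)$ be a Poisson submersion with vertical bundle $V=\ker p_*\subset T\Sigma$, and suppose that each tangent space $T_xp^{-1}(p(x))\subset(T_x\Sigma,\pi_{\Sigma,x})$, $x\in\Sigma$, inherits a Poisson structure, that is, $\pi_\Sigma^\sharp(V^\circ)\cap V=0$. Then every fibre of $p$ is a coregular Poisson-Dirac submanifold of $(\Sigma,\pi_\Sigma)$. Moreover, for every coregular Poisson-Dirac submanifold $Y\subset M$ of $(M,\pi_M)$, with induced Poisson structure $\pi_Y$: (a) $X:=p^{-1}(Y)\subset\Sigma$ is a coregular Poisson-Dirac submanifold of $(\Sigma,\pi_\Sigma)$, with induced Poisson structure denoted $\pi_X$; (b) $p|_X:(X,\pi_X)\to(Y,\pi_Y)$ is a Poisson submersion with Poisson fibres.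
   Context: Everything is smooth; submanifolds are embedded. For a Poisson manifold $(M,\pi_M)$, $\pi_M^\sharp:T^*M\to TM$ is contraction with $\pi_M$, and $\mathrm{Gr}(\pi_M)=\{\pi_M^\sharp(\xi)+\xi : \xi\in T^*M\}\subset TM\oplus T^*M$. A Poisson submersion $p:(\Sigma,\pi_\Sigma)\to(M,\pi_M)$ is a submersion between Poisson manifolds which is a Poisson map. $V^\circ\subset T^*\Sigma$ is the annihilator of $V$, and $N^*X\subset T^*M|_X$ denotes the annihilator of $TX$. A submanifold $i:X\to M$ is a Poisson-Dirac submanifold of $(M,\pi_M)$ if $i^!\mathrm{Gr}(\pi_M):=\{u+i^*\xi : i_*u=\pi_M^\sharp(\xi)\}\subset TX\oplus T^*X$ equals $\mathrm{Gr}(\pi_X)$ for a (necessarily unique, and automatically Poisson) smooth bivector $\pi_X$ on $X$, called the induced Poisson structure. The submanifold $X$ is a coregular Poisson-Dirac submanifold if $\pi_M^\sharp(N^*X)\cap TX=0$ and $TX\oplus\pi_M^\sharp(N^*X)$ is a vector subbundle of $TM|_X$ (such $X$ is in particular Poisson-Dirac). A submersion $p:(\Sigma,\pi_\Sigma)\to M$ from a Poisson manifold has Poisson fibres if each of its fibres is a Poisson-Dirac submanifold of $(\Sigma,\pi_\Sigma)$. *)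

theory Defs
  imports "HOL-Analysis.Analysis"
begin

(* Manifolds of arbitrary dimension n <= DIM('e) are modelled on a copy of R^n inside a Euclidean
   space 'e, so that manifolds and their submanifolds of every dimension are objects of one type. *)

definition coord_vec :: "nat \<Rightarrow> 'e::euclidean_space"
  where "coord_vec i = from_nat_into Basis i"

definition coord_space :: "nat \<Rightarrow> 'e::euclidean_space set"
  where "coord_space n = span (coord_vec ` {..<n})"

(* Maps of class C^k on a relatively open subset S of a linear subspace E.  The derivatives f' x
   are determined, and used, only on E. *)
primrec Ck_on ::
  "nat \<Rightarrow> 'e set \<Rightarrow> 'e set \<Rightarrow> ('e::euclidean_space \<Rightarrow> 'f::real_normed_vector) \<Rightarrow> bool"
  where
    "Ck_on 0 E S f \<longleftrightarrow> continuous_on S f"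
  | "Ck_on (Suc k) E S f \<longleftrightarrow>
       (\<exists>f'. (\<forall>x\<in>S. (f has_derivative f' x) (at x within S)) \<and>
             (\<forall>v\<in>E. Ck_on k E S (\<lambda>x. f' x v)))"

definition smooth_on ::
  "'e set \<Rightarrow> 'e set \<Rightarrow> ('e::euclidean_space \<Rightarrow> 'f::real_normed_vector) \<Rightarrow> bool"
  where "smooth_on E S f \<longleftrightarrow> (\<forall>k. Ck_on k E S f)"


section \<open>Smooth manifolds\<close>

type_synonym ('a, 'e) chart = "'a set \<times> ('a \<Rightarrow> 'e)"

record ('a, 'e) mfd =
  mtop :: "'a topology"
  mdim :: nat
  atlas :: "('a, 'e) chart set"

abbreviation carrier :: "('a, 'e) mfd \<Rightarrow> 'a set"
  where "carrier M \<equiv> topspace (mtop M)"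

definition model :: "('a, 'e::euclidean_space) mfd \<Rightarrow> 'e set"
  where "model M = coord_space (mdim M)"

definition is_chart :: "('a, 'e::euclidean_space) mfd \<Rightarrow> ('a, 'e) chart \<Rightarrow> bool"
  where "is_chart M = (\<lambda>(U, \<phi>).
    openin (mtop M) U \<and> openin (top_of_set (model M)) (\<phi> ` U) \<and>
    homeomorphic_map (subtopology (mtop M) U) (top_of_set (\<phi> ` U)) \<phi>)"

definition smooth_transition ::
  "('a, 'e::euclidean_space) mfd \<Rightarrow> ('a, 'e) chart \<Rightarrow> ('a, 'e) chart \<Rightarrow> bool"
  where "smooth_transition M = (\<lambda>(U, \<phi>) (W, \<psi>).
    smooth_on (model M) (\<phi> ` (U \<inter> W)) (\<psi> \<circ> inv_into U \<phi>))"

definition smooth_manifold :: "('a, 'e::euclidean_space) mfd \<Rightarrow> bool"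
  where "smooth_manifold M \<longleftrightarrow>
    mdim M \<le> DIM('e) \<and> Hausdorff_space (mtop M) \<and> second_countable (mtop M) \<and>
    (\<forall>c\<in>atlas M. is_chart M c) \<and> carrier M = (\<Union>c\<in>atlas M. fst c) \<and>
    (\<forall>c\<in>atlas M. \<forall>d\<in>atlas M. smooth_transition M c d)"

definition max_atlas :: "('a, 'e::euclidean_space) mfd \<Rightarrow> ('a, 'e) chart set"
  where "max_atlas M =
    {c. is_chart M c \<and> (\<forall>d\<in>atlas M. smooth_transition M c d \<and> smooth_transition M d c)}"

(* Maps are total functions of which only the values on the carrier matter. *)
definition smooth_map ::
  "('a, 'e::euclidean_space) mfd \<Rightarrow> ('b, 'f::euclidean_space) mfd \<Rightarrow> ('a \<Rightarrow> 'b) \<Rightarrow> bool"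
  where "smooth_map M N p \<longleftrightarrow>
    continuous_map (mtop M) (mtop N) p \<and>
    (\<forall>(U, \<phi>)\<in>atlas M. \<forall>(W, \<psi>)\<in>atlas N.
       smooth_on (model M) (\<phi> ` (U \<inter> p -` W)) (\<psi> \<circ> p \<circ> inv_into U \<phi>))"

definition smooth_fun_on ::
  "('a, 'e::euclidean_space) mfd \<Rightarrow> 'a set \<Rightarrow> ('a \<Rightarrow> 'v::real_normed_vector) \<Rightarrow> bool"
  where "smooth_fun_on M W f \<longleftrightarrow>
    (\<forall>(U, \<phi>)\<in>atlas M. smooth_on (model M) (\<phi> ` (U \<inter> W)) (f \<circ> inv_into U \<phi>))"


section \<open>Tangent and cotangent spaces\<close>

(* The tangent space at x is identified with R^n through the chart chart_at M x, and the cotangent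
   space with R^n through the dual coordinates: the pairing of a covector \<xi> with a tangent
   vector v is the inner product \<xi> \<bullet> v. *)

definition chart_at :: "('a, 'e) mfd \<Rightarrow> 'a \<Rightarrow> ('a, 'e) chart"
  where "chart_at M x = (SOME c. c \<in> atlas M \<and> x \<in> fst c)"

definition tangent_space :: "('a, 'e::euclidean_space) mfd \<Rightarrow> 'a \<Rightarrow> 'e set"
  where "tangent_space M x = model M"

definition cotangent_space :: "('a, 'e::euclidean_space) mfd \<Rightarrow> 'a \<Rightarrow> 'e set"
  where "cotangent_space M x = model M"

(* Derivative at x, in the direction of the tangent vector v, of a vector-valued function defined
   near x. *)
definition deriv_at ::
  "('a, 'e::euclidean_space) mfd \<Rightarrow> ('a \<Rightarrow> 'v::real_normed_vector) \<Rightarrow> 'a \<Rightarrow> 'e \<Rightarrow> 'v"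
  where "deriv_at M f x v =
    (let (U, \<phi>) = chart_at M x
     in frechet_derivative (f \<circ> inv_into U \<phi>) (at (\<phi> x) within \<phi> ` U) v)"

definition tangent_map ::
  "('a, 'e::euclidean_space) mfd \<Rightarrow> ('b, 'f::euclidean_space) mfd \<Rightarrow> ('a \<Rightarrow> 'b) \<Rightarrow> 'a \<Rightarrow> 'e \<Rightarrow> 'f"
  where "tangent_map M N p x = deriv_at M (snd (chart_at N (p x)) \<circ> p) x"

definition cotangent_map ::
  "('a, 'e::euclidean_space) mfd \<Rightarrow> ('b, 'f::euclidean_space) mfd \<Rightarrow> ('a \<Rightarrow> 'b) \<Rightarrow> 'a \<Rightarrow> 'f \<Rightarrow> 'e"
  where "cotangent_map M N p x \<xi> =
    (\<Sum>i<mdim M. (\<xi> \<bullet> tangent_map M N p x (coord_vec i)) *\<^sub>R coord_vec i)"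

definition differential ::
  "('a, 'e::euclidean_space) mfd \<Rightarrow> ('a \<Rightarrow> real) \<Rightarrow> 'a \<Rightarrow> 'e"
  where "differential M f x = (\<Sum>i<mdim M. deriv_at M f x (coord_vec i) *\<^sub>R coord_vec i)"

definition annihilator :: "('a, 'e::euclidean_space) mfd \<Rightarrow> 'a \<Rightarrow> 'e set \<Rightarrow> 'e set"
  where "annihilator M x F = {\<xi>\<in>cotangent_space M x. \<forall>v\<in>F. \<xi> \<bullet> v = 0}"

definition submersion ::
  "('a, 'e::euclidean_space) mfd \<Rightarrow> ('b, 'f::euclidean_space) mfd \<Rightarrow> ('a \<Rightarrow> 'b) \<Rightarrow> bool"
  where "submersion M N p \<longleftrightarrow>
    smooth_map M N p \<and>
    (\<forall>x\<in>carrier M. tangent_map M N p x ` tangent_space M x = tangent_space N (p x))"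

definition vertical ::
  "('a, 'e::euclidean_space) mfd \<Rightarrow> ('b, 'f::euclidean_space) mfd \<Rightarrow> ('a \<Rightarrow> 'b) \<Rightarrow> 'a \<Rightarrow> 'e set"
  where "vertical M N p x = {v\<in>tangent_space M x. tangent_map M N p x v = 0}"

definition fibre :: "('a, 'e) mfd \<Rightarrow> ('a \<Rightarrow> 'b) \<Rightarrow> 'b \<Rightarrow> 'a set"
  where "fibre M p y = {x\<in>carrier M. p x = y}"


section \<open>Embedded submanifolds\<close>

definition slice_charts :: "('a, 'e::euclidean_space) mfd \<Rightarrow> 'a set \<Rightarrow> nat \<Rightarrow> ('a, 'e) chart set"
  where "slice_charts M X k =
    {(U, \<phi>). (U, \<phi>) \<in> max_atlas M \<and> \<phi> ` (U \<inter> X) = \<phi> ` U \<inter> coord_space k}"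

definition embedded_of_dim :: "('a, 'e::euclidean_space) mfd \<Rightarrow> 'a set \<Rightarrow> nat \<Rightarrow> bool"
  where "embedded_of_dim M X k \<longleftrightarrow>
    X \<subseteq> carrier M \<and> k \<le> mdim M \<and> (\<forall>x\<in>X. \<exists>c\<in>slice_charts M X k. x \<in> fst c)"

definition embedded_submanifold :: "('a, 'e::euclidean_space) mfd \<Rightarrow> 'a set \<Rightarrow> bool"
  where "embedded_submanifold M X \<longleftrightarrow> (\<exists>k. embedded_of_dim M X k)"

(* The dimension is unique unless X is empty. *)
definition submfd_dim :: "('a, 'e::euclidean_space) mfd \<Rightarrow> 'a set \<Rightarrow> nat"
  where "submfd_dim M X = (LEAST k. embedded_of_dim M X k)"

(* X as a manifold in its own right. *)
definition submfd :: "('a, 'e::euclidean_space) mfd \<Rightarrow> 'a set \<Rightarrow> ('a, 'e) mfd"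
  where "submfd M X =
    \<lparr>mtop = subtopology (mtop M) X,
     mdim = submfd_dim M X,
     atlas = (\<lambda>(U, \<phi>). (U \<inter> X, \<phi>)) ` slice_charts M X (submfd_dim M X)\<rparr>"

abbreviation incl_push :: "('a, 'e::euclidean_space) mfd \<Rightarrow> 'a set \<Rightarrow> 'a \<Rightarrow> 'e \<Rightarrow> 'e"
  where "incl_push M X \<equiv> tangent_map (submfd M X) M (\<lambda>x. x)"

abbreviation incl_pull :: "('a, 'e::euclidean_space) mfd \<Rightarrow> 'a set \<Rightarrow> 'a \<Rightarrow> 'e \<Rightarrow> 'e"
  where "incl_pull M X \<equiv> cotangent_map (submfd M X) M (\<lambda>x. x)"

(* The tangent space of X at x as a subspace of that of M. *)
definition sub_tangent :: "('a, 'e::euclidean_space) mfd \<Rightarrow> 'a set \<Rightarrow> 'a \<Rightarrow> 'e set"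
  where "sub_tangent M X x = incl_push M X x ` tangent_space (submfd M X) x"

definition conormal :: "('a, 'e::euclidean_space) mfd \<Rightarrow> 'a set \<Rightarrow> 'a \<Rightarrow> 'e set"
  where "conormal M X x = annihilator M x (sub_tangent M X x)"

(* F is a smooth vector subbundle of TM restricted to X: the fibres have a constant rank r and
   are locally spanned by r smooth sections of TM along X.  Smoothness of a section is tested on
   its coordinates in the charts of M. *)
definition vector_subbundle :: "('a, 'e::euclidean_space) mfd \<Rightarrow> 'a set \<Rightarrow> ('a \<Rightarrow> 'e set) \<Rightarrow> bool"
  where "vector_subbundle M X F \<longleftrightarrow>
    (\<forall>x\<in>X. F x \<subseteq> tangent_space M x) \<and>
    (\<exists>r. \<forall>x\<in>X. \<exists>W s. openin (mtop (submfd M X)) W \<and> x \<in> W \<and>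
       (\<forall>i<r. \<forall>(U, \<phi>)\<in>atlas M. smooth_fun_on (submfd M X) (W \<inter> U) (\<lambda>y. deriv_at M \<phi> y (s i y))) \<and>
       (\<forall>y\<in>W. F y = span ((\<lambda>i. s i y) ` {..<r}) \<and> dim (F y) = r))"


section \<open>Poisson manifolds\<close>

(* A bivector at x is an alternating bilinear form on the cotangent space at x; only its values
   on the cotangent space matter. *)
type_synonym ('a, 'e) bivector_field = "'a \<Rightarrow> 'e \<Rightarrow> 'e \<Rightarrow> real"

definition alternating_on :: "'e::euclidean_space set \<Rightarrow> ('e \<Rightarrow> 'e \<Rightarrow> real) \<Rightarrow> bool"
  where "alternating_on E \<beta> \<longleftrightarrow>
    (\<forall>\<xi>\<in>E. \<forall>\<eta>\<in>E. \<forall>\<zeta>\<in>E. \<forall>a b. \<beta> (a *\<^sub>R \<xi> + b *\<^sub>R \<eta>) \<zeta> = a * \<beta> \<xi> \<zeta> + b * \<beta> \<eta> \<zeta> \<and>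
                              \<beta> \<zeta> (a *\<^sub>R \<xi> + b *\<^sub>R \<eta>) = a * \<beta> \<zeta> \<xi> + b * \<beta> \<zeta> \<eta>) \<and>
    (\<forall>\<xi>\<in>E. \<beta> \<xi> \<xi> = 0)"

definition bracket ::
  "('a, 'e::euclidean_space) mfd \<Rightarrow> ('a, 'e) bivector_field \<Rightarrow> ('a \<Rightarrow> real) \<Rightarrow> ('a \<Rightarrow> real) \<Rightarrow> 'a \<Rightarrow> real"
  where "bracket M \<pi> f g = (\<lambda>x. \<pi> x (differential M f x) (differential M g x))"

(* The brackets of the coordinate functions are the components of \<pi> in the chart. *)
definition smooth_bivector ::
  "('a, 'e::euclidean_space) mfd \<Rightarrow> ('a, 'e) bivector_field \<Rightarrow> bool"
  where "smooth_bivector M \<pi> \<longleftrightarrow>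
    (\<forall>x\<in>carrier M. alternating_on (cotangent_space M x) (\<pi> x)) \<and>
    (\<forall>(U, \<phi>)\<in>atlas M. \<forall>i<mdim M. \<forall>j<mdim M.
       smooth_fun_on M U (bracket M \<pi> (\<lambda>y. \<phi> y \<bullet> coord_vec i) (\<lambda>y. \<phi> y \<bullet> coord_vec j)))"

definition poisson_manifold ::
  "('a, 'e::euclidean_space) mfd \<Rightarrow> ('a, 'e) bivector_field \<Rightarrow> bool"
  where "poisson_manifold M \<pi> \<longleftrightarrow>
    smooth_manifold M \<and> smooth_bivector M \<pi> \<and>
    (\<forall>f g h. smooth_fun_on M (carrier M) f \<and> smooth_fun_on M (carrier M) g \<and>
             smooth_fun_on M (carrier M) h \<longrightarrow>
       (\<forall>x\<in>carrier M.
          bracket M \<pi> f (bracket M \<pi> g h) x + bracket M \<pi> g (bracket M \<pi> h f) x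
          + bracket M \<pi> h (bracket M \<pi> f g) x = 0))"

(* Contraction: the tangent vector v with \<eta> \<bullet> v = \<pi> x \<xi> \<eta> for all covectors \<eta>. *)
definition sharp ::
  "('a, 'e::euclidean_space) mfd \<Rightarrow> ('a, 'e) bivector_field \<Rightarrow> 'a \<Rightarrow> 'e \<Rightarrow> 'e"
  where "sharp M \<pi> x \<xi> = (\<Sum>i<mdim M. \<pi> x \<xi> (coord_vec i) *\<^sub>R coord_vec i)"

definition bivector_graph ::
  "('a, 'e::euclidean_space) mfd \<Rightarrow> ('a, 'e) bivector_field \<Rightarrow> 'a \<Rightarrow> ('e \<times> 'e) set"
  where "bivector_graph M \<pi> x = {(sharp M \<pi> x \<xi>, \<xi>) | \<xi>. \<xi> \<in> cotangent_space M x}"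

definition poisson_map ::
  "('a, 'e::euclidean_space) mfd \<Rightarrow> ('a, 'e) bivector_field \<Rightarrow>
   ('b, 'f::euclidean_space) mfd \<Rightarrow> ('b, 'f) bivector_field \<Rightarrow> ('a \<Rightarrow> 'b) \<Rightarrow> bool"
  where "poisson_map M \<pi> N \<rho> p \<longleftrightarrow>
    smooth_map M N p \<and>
    (\<forall>x\<in>carrier M. \<forall>\<xi>\<in>cotangent_space N (p x). \<forall>\<eta>\<in>cotangent_space N (p x).
       \<pi> x (cotangent_map M N p x \<xi>) (cotangent_map M N p x \<eta>) = \<rho> (p x) \<xi> \<eta>)"

definition poisson_submersion ::
  "('a, 'e::euclidean_space) mfd \<Rightarrow> ('a, 'e) bivector_field \<Rightarrow>
   ('b, 'f::euclidean_space) mfd \<Rightarrow> ('b, 'f) bivector_field \<Rightarrow> ('a \<Rightarrow> 'b) \<Rightarrow> bool"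
  where "poisson_submersion M \<pi> N \<rho> p \<longleftrightarrow>
    poisson_manifold M \<pi> \<and> poisson_manifold N \<rho> \<and> submersion M N p \<and> poisson_map M \<pi> N \<rho> p"


section \<open>Poisson-Dirac submanifolds\<close>

definition pullback_graph ::
  "('a, 'e::euclidean_space) mfd \<Rightarrow> ('a, 'e) bivector_field \<Rightarrow> 'a set \<Rightarrow> 'a \<Rightarrow> ('e \<times> 'e) set"
  where "pullback_graph M \<pi> X x =
    {(u, incl_pull M X x \<xi>) | u \<xi>.
       u \<in> tangent_space (submfd M X) x \<and> \<xi> \<in> cotangent_space M x \<and>
       incl_push M X x u = sharp M \<pi> x \<xi>}"

definition induced_poisson ::
  "('a, 'e::euclidean_space) mfd \<Rightarrow> ('a, 'e) bivector_field \<Rightarrow> 'a set \<Rightarrow> ('a, 'e) bivector_field \<Rightarrow> bool"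
  where "induced_poisson M \<pi> X \<pi>X \<longleftrightarrow>
    smooth_bivector (submfd M X) \<pi>X \<and>
    (\<forall>x\<in>X. pullback_graph M \<pi> X x = bivector_graph (submfd M X) \<pi>X x)"

definition poisson_dirac ::
  "('a, 'e::euclidean_space) mfd \<Rightarrow> ('a, 'e) bivector_field \<Rightarrow> 'a set \<Rightarrow> bool"
  where "poisson_dirac M \<pi> X \<longleftrightarrow> embedded_submanifold M X \<and> (\<exists>\<pi>X. induced_poisson M \<pi> X \<pi>X)"

definition coregular_poisson_dirac ::
  "('a, 'e::euclidean_space) mfd \<Rightarrow> ('a, 'e) bivector_field \<Rightarrow> 'a set \<Rightarrow> bool"
  where "coregular_poisson_dirac M \<pi> X \<longleftrightarrow>
    embedded_submanifold M X \<and>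
    (\<forall>x\<in>X. sharp M \<pi> x ` conormal M X x \<inter> sub_tangent M X x = {0}) \<and>
    vector_subbundle M X
      (\<lambda>x. {u + v | u v. u \<in> sub_tangent M X x \<and> v \<in> sharp M \<pi> x ` conormal M X x})"

definition poisson_fibres ::
  "('a, 'e::euclidean_space) mfd \<Rightarrow> ('a, 'e) bivector_field \<Rightarrow>
   ('b, 'f::euclidean_space) mfd \<Rightarrow> ('a \<Rightarrow> 'b) \<Rightarrow> bool"
  where "poisson_fibres M \<pi> N p \<longleftrightarrow>
    poisson_manifold M \<pi> \<and> submersion M N p \<and> (\<forall>y\<in>carrier N. poisson_dirac M \<pi> (fibre M p y))"

end

theory Submission
  imports Defs
begin

text \<open>
  A submersion has local slice charts adapted to the preimage of a submanifold, by the inverse function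
  theorem, so everything reduces to linear algebra in the tangent spaces and a local constant rank
  argument.  For \<open>X = p\<^sup>-\<^sup>1(Y)\<close> the conormal space is the pullback of that of \<open>Y\<close>, and the hypothesis
  on the vertical bundle makes \<open>p\<^sub>*\<close> injective on \<open>\<pi>\<^sup>\<sharp>(V\<^sup>\<circ>)\<close>; since \<open>p\<close> is Poisson, it maps
  \<open>\<pi>\<^sup>\<sharp>(N\<^sup>*X)\<close> isomorphically onto \<open>\<pi>\<^sup>\<sharp>(N\<^sup>*Y)\<close>.  This gives transversality to \<open>TX\<close> and the
  constancy of the rank of \<open>TX + \<pi>\<^sup>\<sharp>(N\<^sup>*X)\<close>.  Conversely, constancy of this rank lets one extend every
  function on \<open>X\<close> locally to a function whose Hamiltonian vector field is tangent to \<open>X\<close>; brackets of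
  such extensions restrict to the brackets on \<open>X\<close>, whence smoothness of the induced bivector and the
  Jacobi identity.  The fibres of \<open>p\<close> are the case \<open>Y = {y}\<close>, and applied to \<open>p : X \<rightarrow> Y\<close> this
  case shows that the fibres of \<open>p\<close> inside \<open>X\<close> are Poisson-Dirac.
\<close>

section \<open>Calculus on relatively open subsets of a subspace\<close>

text \<open>By skewness, \<open>sharp\<close> \<xi> is tangent to X exactly when \<xi> vanishes on C
  = sharp(N*X). If TX and C meet only in 0, the values of \<xi> on TX can be prescribed freely while
  \<xi> is zero on C; constancy of the dimension of TX + C makes this choice smooth. Only the first
  argument of a bracket has to be extended in this way, so the inner brackets of the Jacobi identity
  may be arbitrary extensions. That identity is given for globally defined functions, hence local
  extensions are cut off by bump functions. For part (b) the condition on the vertical bundle has to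
  be established again for the restricted map from X to Y with the induced bivectors. Two features
  of the encoding shape the calculus. Derivatives live on relatively open subsets of a subspace and
  are determined only along it. Tangent vectors are coordinates in a chart selected pointwise,
  without any continuity, so smooth dependence on the point is expressed through a fixed
  chart.\<close>

lemma at_within_openin_eq:
  fixes E :: "'e::euclidean_space set"
  assumes "openin (top_of_set E) A" "openin (top_of_set E) B" "x \<in> A" "x \<in> B"
  shows "at x within A = at x within B"
proof -
  obtain U where U: "open U" "A = E \<inter> U" using assms(1) by (auto simp: openin_open)
  obtain V where V: "open V" "B = E \<inter> V" using assms(2) by (auto simp: openin_open)
  show ?thesis
    by (rule at_within_nhd[of x "U \<inter> V"]) (use U V assms in auto)
qed

text \<open>\<open>S\<close> can have empty interior in the ambient space, so a derivative within
  \<open>S\<close> is determined only in directions of \<open>E\<close>. Restriction to the line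
  through \<open>x\<close> in direction \<open>v\<close>, which stays in \<open>S\<close> for small
  parameters, reduces the claim to uniqueness in one real variable.\<close>

lemma has_derivative_unique_subspace:
  fixes E :: "'e::euclidean_space set" and f :: "'e \<Rightarrow> 'f::real_normed_vector"
  assumes E: "subspace E" and S: "openin (top_of_set E) S" and x: "x \<in> S"
    and f1: "(f has_derivative f1) (at x within S)" and f2: "(f has_derivative f2) (at x within S)"
    and v: "v \<in> E"
  shows "f1 v = f2 v"
proof -
  obtain U where U: "open U" "S = E \<inter> U" using S by (auto simp: openin_open)
  define J where "J = {t::real. x + t *\<^sub>R v \<in> U}"
  have "open J" unfolding J_def
    by (rule open_vimage[OF U(1), of "\<lambda>t. x + t *\<^sub>R v", unfolded vimage_def]) (intro continuous_intros)
  have "0 \<in> J" using x U by (simp add: J_def)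
  have JS: "(\<lambda>t. x + t *\<^sub>R v) ` J \<subseteq> S"
    using x U v E by (auto simp: J_def subspace_add subspace_scale)
  have line: "((\<lambda>t::real. x + t *\<^sub>R v) has_derivative (\<lambda>t. t *\<^sub>R v)) (at 0 within J)"
    by (auto intro!: derivative_eq_intros)
  have D: "((\<lambda>t. f (x + t *\<^sub>R v)) has_derivative (\<lambda>t. f' (t *\<^sub>R v))) (at 0)"
    if "(f has_derivative f') (at x within S)" for f'
  proof -
    have "(f has_derivative f') (at (x + 0 *\<^sub>R v) within (\<lambda>t. x + t *\<^sub>R v) ` J)"
      using has_derivative_subset[OF that JS] by simp
    from has_derivative_in_compose[OF line this]
    have "((\<lambda>t. f (x + t *\<^sub>R v)) has_derivative (\<lambda>t. f' (t *\<^sub>R v))) (at 0 within J)" .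
    then show ?thesis using at_within_open[OF \<open>0 \<in> J\<close> \<open>open J\<close>] by simp
  qed
  have "(\<lambda>t. f1 (t *\<^sub>R v)) = (\<lambda>t. f2 (t *\<^sub>R v))"
    by (rule has_derivative_unique[OF D[OF f1] D[OF f2]])
  from fun_cong[OF this, of 1] show ?thesis by simp
qed

text \<open>Pairing \<open>f\<close> with the component \<open>z\<close> of \<open>f' v\<close>
  orthogonal to \<open>F\<close> gives a function that is identically zero on \<open>S\<close>. Its
  derivative along \<open>v\<close> is the pairing of \<open>z\<close> with \<open>f' v\<close>, so
  uniqueness along \<open>E\<close> forces \<open>z\<close> to vanish.\<close>

lemma has_derivative_in_subspace:
  fixes E :: "'e::euclidean_space set" and f :: "'e \<Rightarrow> 'f::euclidean_space"
  assumes E: "subspace E" and S: "openin (top_of_set E) S" and x: "x \<in> S"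
    and f': "(f has_derivative f') (at x within S)"
    and v: "v \<in> E" and F: "subspace F" and fF: "f ` S \<subseteq> F"
  shows "f' v \<in> F"
proof -
  obtain y z where y: "y \<in> span F" and z: "\<And>w. w \<in> span F \<Longrightarrow> orthogonal z w" and yz: "f' v = y + z"
    using orthogonal_subspace_decomp_exists[of F "f' v"] by metis
  have sF: "span F = F" using F by (simp add: span_eq_iff)
  have "((\<lambda>x. z \<bullet> f x) has_derivative (\<lambda>h. z \<bullet> f' h)) (at x within S)"
    using f' by (auto intro!: derivative_eq_intros)
  moreover have "((\<lambda>x. z \<bullet> f x) has_derivative (\<lambda>h. 0)) (at x within S)"
  proof (rule has_derivative_transform[OF x, where f="\<lambda>_. 0"])
    show "z \<bullet> f w = 0" if "w \<in> S" for w
      using z[of "f w"] fF that sF by (auto simp: orthogonal_def)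
  qed simp
  ultimately have "z \<bullet> f' v = 0"
    using has_derivative_unique_subspace[OF E S x _ _ v] by blast
  moreover have "z \<bullet> y = 0" using z[OF y] by (simp add: orthogonal_def)
  ultimately have "z = 0" by (simp add: yz inner_add_right)
  then show ?thesis using yz y sF by simp
qed

section \<open>Restriction, locality and algebra of C^k maps\<close>

lemma Ck_on_subset:
  "Ck_on k E S f \<Longrightarrow> T \<subseteq> S \<Longrightarrow> F \<subseteq> E \<Longrightarrow> Ck_on k F T f"
proof (induction k arbitrary: f)
  case 0 then show ?case by (auto intro: continuous_on_subset)
next
  case (Suc k)
  then obtain f' where "\<forall>x\<in>S. (f has_derivative f' x) (at x within S)" "\<forall>v\<in>E. Ck_on k E S (\<lambda>x. f' x v)"
    by auto
  with Suc show ?case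
    by (auto intro!: exI[of _ f'] intro: has_derivative_subset)
qed

lemma Ck_on_cong:
  assumes "\<And>x. x \<in> S \<Longrightarrow> f x = g x" shows "Ck_on k E S f \<longleftrightarrow> Ck_on k E S g"
proof (cases k)
  case 0 then show ?thesis using assms by (auto cong: continuous_on_cong)
next
  case (Suc n)
  have "(f has_derivative d) (at x within S) \<longleftrightarrow> (g has_derivative d) (at x within S)" if "x \<in> S" for x d
    using assms that has_derivative_transform[OF that, of f g] has_derivative_transform[OF that, of g f]
    by auto
  then show ?thesis using Suc by auto
qed

lemma Ck_on_SucD: "Ck_on (Suc k) E S f \<Longrightarrow> Ck_on k E S f"
proof (induction k arbitrary: f)
  case 0
  then show ?case by (auto simp: continuous_on_eq_continuous_within intro: has_derivative_continuous)
next
  case (Suc k)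
  from Suc.prems obtain f' where "\<forall>x\<in>S. (f has_derivative f' x) (at x within S)"
    "\<forall>v\<in>E. Ck_on (Suc k) E S (\<lambda>x. f' x v)" by (auto simp del: Ck_on.simps(2) simp: Ck_on.simps(2)[of "Suc k"])
  then show ?case using Suc.IH unfolding Ck_on.simps by blast
qed

lemma Ck_on_continuous: "Ck_on k E S f \<Longrightarrow> continuous_on S f"
  by (induction k) (auto dest: Ck_on_SucD simp del: Ck_on.simps(2))

text \<open>The derivatives witnessed on the local pieces may disagree off \<open>E\<close>. A
  derivative chosen arbitrarily at each point serves, because along \<open>E\<close> it agrees with
  all of them.\<close>

lemma Ck_on_local:
  fixes E :: "'e::euclidean_space set" and f :: "'e \<Rightarrow> 'f::real_normed_vector"
  assumes E: "subspace E" and S: "openin (top_of_set E) S"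
    and loc: "\<And>x. x \<in> S \<Longrightarrow> \<exists>T. openin (top_of_set E) T \<and> x \<in> T \<and> T \<subseteq> S \<and> Ck_on k E T f"
  shows "Ck_on k E S f"
  using loc
proof (induction k arbitrary: f)
  case 0
  have "continuous (at x within S) f" if x: "x \<in> S" for x
  proof -
    obtain T where T: "openin (top_of_set E) T" "x \<in> T" "continuous_on T f" using 0[OF x] by auto
    then show ?thesis
      using at_within_openin_eq[OF T(1) S T(2) x] by (auto simp: continuous_on_eq_continuous_within)
  qed
  then show ?case by (auto simp: continuous_on_eq_continuous_within)
next
  case (Suc k)
  have ex: "\<exists>d. (f has_derivative d) (at x within S)" if x: "x \<in> S" for x
  proof -
    obtain T where T: "openin (top_of_set E) T" "x \<in> T" "Ck_on (Suc k) E T f" using Suc.prems[OF x] by blast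
    from T(3) obtain d where "(f has_derivative d) (at x within T)" using T(2) by auto
    then show ?thesis using at_within_openin_eq[OF T(1) S T(2) x] by (metis (no_types))
  qed
  define f' where "f' x = (SOME d. (f has_derivative d) (at x within S))" for x
  have f': "(f has_derivative f' x) (at x within S)" if "x \<in> S" for x
    unfolding f'_def using someI_ex[OF ex[OF that]] .
  have "Ck_on k E S (\<lambda>x. f' x v)" if v: "v \<in> E" for v
  proof (rule Suc.IH)
    fix x assume x: "x \<in> S"
    obtain T where T: "openin (top_of_set E) T" "x \<in> T" "T \<subseteq> S" "Ck_on (Suc k) E T f" using Suc.prems[OF x] by auto
    then obtain g where g: "\<And>y. y \<in> T \<Longrightarrow> (f has_derivative g y) (at y within T)"
      "Ck_on k E T (\<lambda>x. g x v)" using v by auto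
    have "g y v = f' y v" if "y \<in> T" for y
      by (rule has_derivative_unique_subspace[OF E T(1) that g(1)[OF that] _ v])
         (use f'[of y] T(3) that in \<open>auto intro: has_derivative_subset\<close>)
    then have "Ck_on k E T (\<lambda>x. f' x v)" using g(2) by (subst Ck_on_cong[of T _ "\<lambda>x. g x v"]) auto
    then show "\<exists>T. openin (top_of_set E) T \<and> x \<in> T \<and> T \<subseteq> S \<and> Ck_on k E T (\<lambda>x. f' x v)" using T by blast
  qed
  then show ?case using f' by auto
qed

lemma Ck_on_const: "Ck_on k E S (\<lambda>_. c)"
proof (induction k arbitrary: c)
  case (Suc k) then show ?case by (auto intro!: exI[of _ "\<lambda>_ _. 0"])
qed simp

lemma Ck_on_bounded_linear: 
  assumes h: "bounded_linear h" shows "Ck_on k E S f \<Longrightarrow> Ck_on k E S (\<lambda>x. h (f x))"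
proof (induction k arbitrary: f)
  case 0 then show ?case by (auto intro: bounded_linear.continuous_on[OF h])
next
  case (Suc k)
  then obtain f' where "\<forall>x\<in>S. (f has_derivative f' x) (at x within S)" "\<forall>v\<in>E. Ck_on k E S (\<lambda>x. f' x v)"
    by auto
  with Suc.IH show ?case
    by (auto intro!: exI[of _ "\<lambda>x v. h (f' x v)"] bounded_linear.has_derivative[OF h])
qed

lemma Ck_on_add: "Ck_on k E S f \<Longrightarrow> Ck_on k E S g \<Longrightarrow> Ck_on k E S (\<lambda>x. f x + g x)"
proof (induction k arbitrary: f g)
  case 0 then show ?case by (auto intro: continuous_on_add)
next
  case (Suc k)
  obtain f' where "\<forall>x\<in>S. (f has_derivative f' x) (at x within S)" "\<forall>v\<in>E. Ck_on k E S (\<lambda>x. f' x v)"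
    using Suc.prems(1) by auto
  moreover obtain g' where "\<forall>x\<in>S. (g has_derivative g' x) (at x within S)" "\<forall>v\<in>E. Ck_on k E S (\<lambda>x. g' x v)"
    using Suc.prems(2) by auto
  ultimately show ?case using Suc.IH
    by (auto intro!: exI[of _ "\<lambda>x v. f' x v + g' x v"] has_derivative_add)
qed

lemma Ck_on_sum: "(\<And>i. i \<in> I \<Longrightarrow> Ck_on k E S (f i)) \<Longrightarrow> Ck_on k E S (\<lambda>x. \<Sum>i\<in>I. f i x)"
  by (induction I rule: infinite_finite_induct) (auto intro: Ck_on_const Ck_on_add)

lemma Ck_on_bilinear:
  assumes b: "bounded_bilinear b"
  shows "Ck_on k E S f \<Longrightarrow> Ck_on k E S g \<Longrightarrow> Ck_on k E S (\<lambda>x. b (f x) (g x))"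
proof (induction k arbitrary: f g)
  case 0 then show ?case by (auto intro: bounded_bilinear.continuous_on[OF b])
next
  case (Suc k)
  obtain f' where f: "\<forall>x\<in>S. (f has_derivative f' x) (at x within S)" "\<forall>v\<in>E. Ck_on k E S (\<lambda>x. f' x v)"
    using Suc.prems(1) by auto
  moreover obtain g' where g: "\<forall>x\<in>S. (g has_derivative g' x) (at x within S)" "\<forall>v\<in>E. Ck_on k E S (\<lambda>x. g' x v)"
    using Suc.prems(2) by auto
  have "Ck_on k E S (\<lambda>x. b (f x) (g' x v) + b (f' x v) (g x))" if "v \<in> E" for v
    using Suc.IH f g that Suc.prems by (intro Ck_on_add) (auto dest: Ck_on_SucD simp del: Ck_on.simps(2))
  then show ?case using f g 
    by (auto intro!: exI[of _ "\<lambda>x v. b (f x) (g' x v) + b (f' x v) (g x)"] bounded_bilinear.FDERIV[OF b])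
qed

lemma subspace_orthonormal_expansion:
  fixes E :: "'e::euclidean_space set"
  assumes "subspace E"
  obtains B where "finite B" "B \<subseteq> E" "\<And>v. v \<in> E \<Longrightarrow> v = (\<Sum>b\<in>B. (v \<bullet> b) *\<^sub>R b)"
proof -
  obtain B where B: "B \<subseteq> E" "pairwise orthogonal B" "\<And>x. x \<in> B \<Longrightarrow> norm x = 1" 
    "independent B" "span B = E"
    using orthonormal_basis_subspace[OF assms] by metis
  have fin: "finite B" using B(4) by (rule independent_imp_finite)
  have "v = (\<Sum>b\<in>B. (v \<bullet> b) *\<^sub>R b)" if v: "v \<in> E" for v
  proof -
    obtain u where u: "v = (\<Sum>b\<in>B. u b *\<^sub>R b)" using v B(5) span_finite[OF fin] by auto
    have "v \<bullet> b = u b" if b: "b \<in> B" for b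
    proof -
      have "v \<bullet> b = (\<Sum>c\<in>B. u c * (c \<bullet> b))" by (simp add: u inner_sum_left)
      also have "\<dots> = (\<Sum>c\<in>B. if c = b then u b else 0)"
        using B(2) B(3)[OF b] b
        by (intro sum.cong) (auto simp: pairwise_def orthogonal_def dot_square_norm)
      finally show ?thesis using fin b by simp
    qed
    then show ?thesis using u by simp
  qed
  then show ?thesis using that fin B by blast
qed

text \<open>The chain rule evaluates the derivative of \<open>g\<close> in the direction
  \<open>f' x v\<close>, which moves with \<open>x\<close>, whereas \<open>Ck_on\<close> controls it
  only in fixed directions. Since that direction lies in \<open>F\<close>, its expansion in an
  orthonormal basis of \<open>F\<close> separates the two dependences on \<open>x\<close>.\<close>

lemma Ck_on_compose:
  fixes E :: "'e::euclidean_space set" and F :: "'f::euclidean_space set" and g :: "'f \<Rightarrow> 'g::real_normed_vector"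
  assumes E: "subspace E" and S: "openin (top_of_set E) S" and F: "subspace F" 
    and TF: "T \<subseteq> F" and fT: "f ` S \<subseteq> T"
  shows "Ck_on k E S f \<Longrightarrow> Ck_on k F T g \<Longrightarrow> Ck_on k E S (\<lambda>x. g (f x))"
proof (induction k arbitrary: g)
  case 0 then show ?case using fT continuous_on_compose2 by auto
next
  case (Suc k)
  obtain f' where f: "\<And>x. x\<in>S \<Longrightarrow> (f has_derivative f' x) (at x within S)" "\<And>v. v\<in>E \<Longrightarrow> Ck_on k E S (\<lambda>x. f' x v)"
    using Suc.prems(1) by auto
  obtain g' where g: "\<And>x. x\<in>T \<Longrightarrow> (g has_derivative g' x) (at x within T)" "\<And>v. v\<in>F \<Longrightarrow> Ck_on k F T (\<lambda>x. g' x v)"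
    using Suc.prems(2) by auto
  obtain B where B: "finite B" "B \<subseteq> F" "\<And>v. v \<in> F \<Longrightarrow> v = (\<Sum>b\<in>B. (v \<bullet> b) *\<^sub>R b)"
    using subspace_orthonormal_expansion[OF F] by metis
  have d: "((\<lambda>x. g (f x)) has_derivative (\<lambda>v. g' (f x) (f' x v))) (at x within S)" if "x \<in> S" for x
    by (rule has_derivative_in_compose[OF f(1)[OF that]])
       (rule has_derivative_subset[OF g(1)], use fT that in auto)
  have "Ck_on k E S (\<lambda>x. g' (f x) (f' x v))" if v: "v \<in> E" for v
  proof -
    have "g' (f x) (f' x v) = (\<Sum>b\<in>B. (f' x v \<bullet> b) *\<^sub>R g' (f x) b)" if x: "x \<in> S" for x
    proof -
      have "f' x v \<in> F"
        by (rule has_derivative_in_subspace[OF E S x f(1)[OF x] v F]) (use fT TF in auto)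
      then have e: "f' x v = (\<Sum>b\<in>B. (f' x v \<bullet> b) *\<^sub>R b)" by (rule B(3))
      have "linear (g' (f x))" using g(1)[of "f x"] fT x by (auto intro: has_derivative_linear)
      then have "g' (f x) (\<Sum>b\<in>B. (f' x v \<bullet> b) *\<^sub>R b) = (\<Sum>b\<in>B. (f' x v \<bullet> b) *\<^sub>R g' (f x) b)"
        by (simp add: linear_sum linear_scale)
      then show ?thesis using e by simp
    qed
    moreover have "Ck_on k E S (\<lambda>x. \<Sum>b\<in>B. (f' x v \<bullet> b) *\<^sub>R g' (f x) b)"
    proof (intro Ck_on_sum Ck_on_bilinear[OF bounded_bilinear_scaleR])
      fix b assume b: "b \<in> B"
      show "Ck_on k E S (\<lambda>x. f' x v \<bullet> b)"
        by (rule Ck_on_bounded_linear[OF bounded_linear_inner_left f(2)[OF v]])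
      show "Ck_on k E S (\<lambda>x. g' (f x) b)"
        by (rule Suc.IH[OF Ck_on_SucD[OF Suc.prems(1)] g(2)]) (use b B in auto)
    qed
    ultimately show ?thesis by (subst Ck_on_cong) auto
  qed
  then show ?case using d by (auto intro!: exI[of _ "\<lambda>x v. g' (f x) (f' x v)"])
qed

lemma Ck_on_inverse:
  fixes f :: "'e::euclidean_space \<Rightarrow> real"
  assumes nz: "\<And>x. x \<in> S \<Longrightarrow> f x \<noteq> 0"
  shows "Ck_on k E S f \<Longrightarrow> Ck_on k E S (\<lambda>x. inverse (f x))"
proof (induction k)
  case 0 then show ?case using nz by (auto intro: continuous_on_inverse)
next
  case (Suc k)
  obtain f' where f: "\<And>x. x\<in>S \<Longrightarrow> (f has_derivative f' x) (at x within S)" "\<And>v. v\<in>E \<Longrightarrow> Ck_on k E S (\<lambda>x. f' x v)"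
    using Suc.prems(1) by auto
  have i: "Ck_on k E S (\<lambda>x. inverse (f x))" using Suc Ck_on_SucD by blast
  have "((\<lambda>x. inverse (f x)) has_derivative (\<lambda>v. - (inverse (f x) * f' x v * inverse (f x)))) (at x within S)"
    if "x \<in> S" for x using Deriv.has_derivative_inverse[OF nz[OF that] f(1)[OF that]] .
  moreover have "Ck_on k E S (\<lambda>x. - (inverse (f x) * f' x v * inverse (f x)))" if "v \<in> E" for v
    by (intro Ck_on_bounded_linear[OF bounded_linear_minus[OF bounded_linear_ident]] Ck_on_bilinear[OF bounded_bilinear_mult] i f(2) that)
  ultimately show ?case by (auto intro!: exI[of _ "\<lambda>x v. - (inverse (f x) * f' x v * inverse (f x))"])
qed

lemma Ck_on_linear: 
  fixes h :: "'e::euclidean_space \<Rightarrow> 'f::real_normed_vector"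
  assumes "linear h" shows "Ck_on k E S h"
proof (cases k)
  case 0 then show ?thesis using assms by (simp add: linear_continuous_on linear_conv_bounded_linear)
next
  case (Suc n)
  have "\<forall>x\<in>S. (h has_derivative h) (at x within S)"
    using assms by (auto intro: bounded_linear_imp_has_derivative simp: linear_conv_bounded_linear)
  then show ?thesis using Suc by (auto intro!: exI[of _ "\<lambda>_. h"] Ck_on_const)
qed

section \<open>Dual frames and inverses of operators that depend on a parameter\<close>

lemma openin_nonzero:
  fixes h :: "'e::euclidean_space \<Rightarrow> real"
  assumes "openin (top_of_set E) T" "continuous_on T h"
  shows "openin (top_of_set E) {y\<in>T. h y \<noteq> 0}"
proof -
  have "openin (top_of_set T) (T \<inter> h -` (- {0}))"
    using assms(2) by (intro continuous_openin_preimage_gen) auto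
  moreover have "T \<inter> h -` (- {0}) = {y\<in>T. h y \<noteq> 0}" by auto
  ultimately show ?thesis using assms(1) openin_trans by metis
qed

text \<open>Gram-Schmidt style induction on the frame: only real division is needed, no matrix inverse.\<close>
lemma Ck_on_dual_frame:
  fixes E :: "'e::euclidean_space set" and t :: "'i \<Rightarrow> 'e \<Rightarrow> 'f::euclidean_space"
  assumes E: "subspace E" and S: "openin (top_of_set E) S" and x: "x \<in> S" and I: "finite I"
    and cont: "\<And>i. i \<in> I \<Longrightarrow> continuous_on S (t i)"
    and indep: "\<And>c. (\<Sum>i\<in>I. c i *\<^sub>R t i x) = 0 \<Longrightarrow> \<forall>i\<in>I. c i = 0"
  shows "\<exists>T \<theta>. openin (top_of_set E) T \<and> x \<in> T \<and> T \<subseteq> S \<and>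
    (\<forall>y\<in>T. \<forall>i\<in>I. \<forall>j\<in>I. \<theta> i y \<bullet> t j y = (if i = j then 1 else 0)) \<and>
    (\<forall>k. (\<forall>i\<in>I. Ck_on k E S (t i)) \<longrightarrow> (\<forall>i\<in>I. Ck_on k E T (\<theta> i)))"
  using I cont indep
proof (induction I rule: finite_induct)
  case empty
  show ?case using S x by (intro exI[of _ S]) auto
next
  case (insert r I)
  have ind: "\<forall>i\<in>I. c i = 0" if "(\<Sum>i\<in>I. c i *\<^sub>R t i x) = 0" for c
  proof -
    have "(\<Sum>i\<in>insert r I. (if i = r then 0 else c i) *\<^sub>R t i x) = (\<Sum>i\<in>I. c i *\<^sub>R t i x)"
      using insert.hyps by (auto intro!: sum.cong)
    then have "\<forall>i\<in>insert r I. (if i = r then 0 else c i) = 0" using that insert.prems(2)[of "\<lambda>i. if i = r then 0 else c i"] by simp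
    then show ?thesis using insert.hyps by (metis insertCI)
  qed
  have "\<exists>T \<theta>. openin (top_of_set E) T \<and> x \<in> T \<and> T \<subseteq> S \<and>
    (\<forall>y\<in>T. \<forall>i\<in>I. \<forall>j\<in>I. \<theta> i y \<bullet> t j y = (if i = j then 1 else 0)) \<and>
    (\<forall>k. (\<forall>i\<in>I. Ck_on k E S (t i)) \<longrightarrow> (\<forall>i\<in>I. Ck_on k E T (\<theta> i)))"
    by (rule insert.IH) (use insert.prems ind in auto)
  then obtain T \<theta> where T: "openin (top_of_set E) T" "x \<in> T" "T \<subseteq> S"
    and dual0: "\<forall>y\<in>T. \<forall>i\<in>I. \<forall>j\<in>I. \<theta> i y \<bullet> t j y = (if i = j then 1 else 0)"
    and smth0: "\<forall>k. (\<forall>i\<in>I. Ck_on k E S (t i)) \<longrightarrow> (\<forall>i\<in>I. Ck_on k E T (\<theta> i))"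
    by (elim exE conjE)
  note dual = dual0[rule_format] and smth = smth0[rule_format]
  \<comment> \<open>\<open>v\<close> is what remains of \<open>t r x\<close> after a combination of
    the earlier vectors is removed; independence makes it nonzero. It is then kept constant: the new
    dual vector at nearby points is a correction of this one vector.\<close>
  define v where "v = t r x - (\<Sum>i\<in>I. (\<theta> i x \<bullet> t r x) *\<^sub>R t i x)"
  have "v \<noteq> 0"
  proof
    assume "v = 0"
    define c where "c i = (if i = r then 1 else - (\<theta> i x \<bullet> t r x))" for i
    have "(\<Sum>i\<in>insert r I. c i *\<^sub>R t i x) = t r x + (\<Sum>i\<in>I. c i *\<^sub>R t i x)"
      using insert.hyps by (simp add: c_def)
    also have "(\<Sum>i\<in>I. c i *\<^sub>R t i x) = (\<Sum>i\<in>I. - (\<theta> i x \<bullet> t r x) *\<^sub>R t i x)"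
      using insert.hyps by (intro sum.cong) (auto simp: c_def)
    finally have "(\<Sum>i\<in>insert r I. c i *\<^sub>R t i x) = v" by (simp add: v_def sum_negf)
    then have "c r = 0" using insert.prems(2)[of c] \<open>v = 0\<close> by blast
    then show False by (simp add: c_def)
  qed
  \<comment> \<open>The correction makes \<open>R y\<close> orthogonal to every \<open>t i y\<close>
    with \<open>i\<close> in \<open>I\<close>. At \<open>x\<close> its pairing \<open>h\<close> with
    \<open>t r\<close> equals \<open>v \<bullet> v\<close>, so \<open>h\<close> is nonzero near
    \<open>x\<close> and can be divided by.\<close>
  define R where "R y = v - (\<Sum>j\<in>I. (v \<bullet> t j y) *\<^sub>R \<theta> j y)" for y
  define h where "h y = R y \<bullet> t r y" for y
  have Rt: "R y \<bullet> t i y = 0" if "y \<in> T" "i \<in> I" for y i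
  proof -
    have "R y \<bullet> t i y = v \<bullet> t i y - (\<Sum>j\<in>I. (v \<bullet> t j y) * (\<theta> j y \<bullet> t i y))"
      by (simp add: R_def inner_diff_left inner_sum_left)
    also have "(\<Sum>j\<in>I. (v \<bullet> t j y) * (\<theta> j y \<bullet> t i y)) = (\<Sum>j\<in>I. if j = i then v \<bullet> t i y else 0)"
      using dual that by (intro sum.cong) auto
    finally show ?thesis using that insert.hyps by simp
  qed
  have "h x = v \<bullet> v"
    by (simp add: h_def R_def v_def[symmetric] inner_diff_left inner_sum_left inner_diff_right inner_sum_right mult.commute)
       (simp add: v_def inner_diff_right inner_sum_right mult.commute)
  then have hx: "h x \<noteq> 0" using \<open>v \<noteq> 0\<close> by simp
  have Rk: "Ck_on k E T R" "Ck_on k E T h" if "\<forall>i\<in>insert r I. Ck_on k E S (t i)" for k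
  proof -
    have tk: "Ck_on k E T (t i)" if "i \<in> insert r I" for i
      using Ck_on_subset[OF _ T(3) order_refl] \<open>\<forall>i\<in>insert r I. Ck_on k E S (t i)\<close> that by blast
    have "Ck_on k E T (\<lambda>y. v + - (\<Sum>j\<in>I. (v \<bullet> t j y) *\<^sub>R \<theta> j y))"
      by (intro Ck_on_add Ck_on_const Ck_on_bounded_linear[OF bounded_linear_minus[OF bounded_linear_ident]] Ck_on_sum
        Ck_on_bilinear[OF bounded_bilinear_scaleR] Ck_on_bounded_linear[OF bounded_linear_inner_right] tk smth) (use that in auto)
    then show *: "Ck_on k E T R" by (simp add: R_def[abs_def])
    show "Ck_on k E T h" unfolding h_def[abs_def]
      by (intro Ck_on_bilinear[OF bounded_bilinear_inner] * tk) auto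
  qed
  have "continuous_on T h" using Rk(2)[of 0] insert.prems(1) by auto
  define T' where "T' = {y\<in>T. h y \<noteq> 0}"
  have T': "openin (top_of_set E) T'" "x \<in> T'" "T' \<subseteq> T"
    unfolding T'_def using openin_nonzero[OF T(1) \<open>continuous_on T h\<close>] T(2) hx by auto
  define \<rho> where "\<rho> y = inverse (h y) *\<^sub>R R y" for y
  \<comment> \<open>The earlier dual vectors are corrected so that they also annihilate
    \<open>t r\<close>. Neither the neighbourhood nor the vectors depend on the order of
    differentiability, so one choice serves all orders at once.\<close>
  define \<theta>' where "\<theta>' i y = (if i = r then \<rho> y else \<theta> i y - (\<theta> i y \<bullet> t r y) *\<^sub>R \<rho> y)" for i y
  have \<rho>: "\<rho> y \<bullet> t r y = 1" "i \<in> I \<Longrightarrow> \<rho> y \<bullet> t i y = 0" if "y \<in> T'" for y i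
    using that Rt[of y i] by (auto simp: \<rho>_def h_def T'_def)
  have d': "\<theta>' i y \<bullet> t j y = (if i = j then 1 else 0)" if "y \<in> T'" "i \<in> insert r I" "j \<in> insert r I" for y i j
    using that \<rho>[OF that(1)] dual[of y i j] T'(3) insert.hyps
    by (auto simp: \<theta>'_def inner_diff_left)
  have s': "Ck_on k E T' (\<theta>' i)" if *: "\<forall>i\<in>insert r I. Ck_on k E S (t i)" and i: "i \<in> insert r I" for k i
  proof -
    have R': "Ck_on k E T' R" "Ck_on k E T' h" using Rk[OF *] Ck_on_subset T'(3) by blast+
    have \<rho>k: "Ck_on k E T' \<rho>" unfolding \<rho>_def[abs_def]
      by (intro Ck_on_bilinear[OF bounded_bilinear_scaleR] Ck_on_inverse R') (auto simp: T'_def)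
    show ?thesis
    proof (cases "i = r")
      case True then show ?thesis using \<rho>k by (simp add: \<theta>'_def[abs_def])
    next
      case False
      have a: "Ck_on k E T' (\<theta> i)" using smth[of k i] * i False Ck_on_subset[OF _ T'(3) order_refl] by auto
      have b: "Ck_on k E T' (t r)" using * Ck_on_subset[OF _ _ order_refl, of k E S "t r" T'] T'(3) T(3) by auto
      have "Ck_on k E T' (\<lambda>y. \<theta> i y + - ((\<theta> i y \<bullet> t r y) *\<^sub>R \<rho> y))"
        by (intro Ck_on_add a b \<rho>k Ck_on_bounded_linear[OF bounded_linear_minus[OF bounded_linear_ident]]
          Ck_on_bilinear[OF bounded_bilinear_scaleR] Ck_on_bilinear[OF bounded_bilinear_inner])
      then show ?thesis using False by (simp add: \<theta>'_def[abs_def])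
    qed
  qed
  show ?case
    by (rule exI[of _ T'], rule exI[of _ \<theta>'], intro conjI ballI allI impI)
       (rule T' order_trans[OF T'(3) T(3)] d' s'; assumption)+
qed

text \<open>The coordinates of \<open>B y v\<close> are the pairings of \<open>v\<close> with the
  frame dual to the images \<open>A y b\<close> of the basis vectors. No order of differentiability
  is lost, which is what the bootstrap for the inverse function requires.\<close>

lemma Ck_on_inverse_operator:
  fixes E :: "'e::euclidean_space set" and A B :: "'e \<Rightarrow> 'f::euclidean_space \<Rightarrow> 'f"
  assumes E: "subspace E" and S: "openin (top_of_set E) S" 
    and lin: "\<And>y. y \<in> S \<Longrightarrow> linear (A y)" and linB: "\<And>y. y \<in> S \<Longrightarrow> linear (B y)"
    and BA: "\<And>y v. y \<in> S \<Longrightarrow> B y (A y v) = v" "\<And>y v. y \<in> S \<Longrightarrow> A y (B y v) = v"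
    and A: "\<And>v. Ck_on k E S (\<lambda>y. A y v)"
  shows "Ck_on k E S (\<lambda>y. B y v)"
proof (rule Ck_on_local[OF E S])
  fix x assume x: "x \<in> S"
  let ?t = "\<lambda>b y. A y b"
  have ind: "\<forall>i\<in>Basis. c i = 0" if "(\<Sum>i\<in>Basis. c i *\<^sub>R A x i) = 0" for c :: "'f \<Rightarrow> real"
  proof -
    have "(\<Sum>i\<in>Basis. c i *\<^sub>R A x i) = A x (\<Sum>i\<in>Basis. c i *\<^sub>R i)"
      by (simp add: linear_sum[OF lin[OF x]] linear_scale[OF lin[OF x]])
    then have "A x (\<Sum>i\<in>Basis. c i *\<^sub>R i) = 0" using that by simp
    then have "(\<Sum>i\<in>Basis. c i *\<^sub>R i) = 0" 
      using BA(1)[OF x, of "\<Sum>i\<in>Basis. c i *\<^sub>R i"] linear_0[OF linB[OF x]] by simp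
    then show ?thesis using inner_sum_left_Basis[of _ c] by (metis inner_zero_left)
  qed
  have "\<exists>T \<theta>. openin (top_of_set E) T \<and> x \<in> T \<and> T \<subseteq> S \<and>
    (\<forall>y\<in>T. \<forall>i\<in>Basis. \<forall>j\<in>Basis. \<theta> i y \<bullet> ?t j y = (if i = j then 1 else 0)) \<and>
    (\<forall>k. (\<forall>i\<in>Basis. Ck_on k E S (?t i)) \<longrightarrow> (\<forall>i\<in>Basis. Ck_on k E T (\<theta> i)))"
    by (rule Ck_on_dual_frame[OF E S x finite_Basis]) (use ind Ck_on_continuous[OF A] in auto)
  then obtain T \<theta> where T: "openin (top_of_set E) T" "x \<in> T" "T \<subseteq> S"
    and dual0: "\<forall>y\<in>T. \<forall>i\<in>Basis. \<forall>j\<in>Basis. \<theta> i y \<bullet> ?t j y = (if i = j then 1 else 0)"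
    and smth0: "\<forall>k. (\<forall>i\<in>Basis. Ck_on k E S (?t i)) \<longrightarrow> (\<forall>i\<in>Basis. Ck_on k E T (\<theta> i))"
    by (elim exE conjE)
  note dual = dual0[rule_format] and smth = smth0[rule_format]
  have "B y v = (\<Sum>i\<in>Basis. (\<theta> i y \<bullet> v) *\<^sub>R i)" if y: "y \<in> T" for y
  proof -
    have "\<theta> i y \<bullet> v = B y v \<bullet> i" if i: "i \<in> Basis" for i
    proof -
      have "v = A y (\<Sum>j\<in>Basis. (B y v \<bullet> j) *\<^sub>R j)" using BA(2) y T by (simp add: euclidean_representation subset_iff)
      also have "\<dots> = (\<Sum>j\<in>Basis. (B y v \<bullet> j) *\<^sub>R A y j)" 
        using lin[of y] y T by (simp add: linear_sum linear_scale subset_iff)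
      finally have "v = (\<Sum>j\<in>Basis. (B y v \<bullet> j) *\<^sub>R A y j)" .
      from arg_cong[OF this, of "\<lambda>w. \<theta> i y \<bullet> w"]
      have "\<theta> i y \<bullet> v = (\<Sum>j\<in>Basis. (B y v \<bullet> j) * (\<theta> i y \<bullet> A y j))"
        by (simp add: inner_sum_right)
      also have "\<dots> = (\<Sum>j\<in>Basis. if j = i then B y v \<bullet> i else 0)"
        using dual[OF y i] by (intro sum.cong) auto
      finally show ?thesis using i by simp
    qed
    then show ?thesis by (simp add: euclidean_representation)
  qed
  moreover have "Ck_on k E T (\<lambda>y. \<Sum>i\<in>Basis. (\<theta> i y \<bullet> v) *\<^sub>R i)"
    by (intro Ck_on_sum Ck_on_bilinear[OF bounded_bilinear_scaleR] Ck_on_const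
      Ck_on_bounded_linear[OF bounded_linear_inner_left] smth) (use A in auto)
  ultimately have "Ck_on k E T (\<lambda>y. B y v)" by (subst Ck_on_cong) auto
  then show "\<exists>T. openin (top_of_set E) T \<and> x \<in> T \<and> T \<subseteq> S \<and> Ck_on k E T (\<lambda>y. B y v)" using T by blast
qed

section \<open>Smooth maps between open subsets of subspaces\<close>

lemma smooth_on_subset: "smooth_on E S f \<Longrightarrow> T \<subseteq> S \<Longrightarrow> F \<subseteq> E \<Longrightarrow> smooth_on F T f"
  unfolding smooth_on_def using Ck_on_subset by blast

lemma smooth_on_cong: "(\<And>x. x \<in> S \<Longrightarrow> f x = g x) \<Longrightarrow> smooth_on E S f \<longleftrightarrow> smooth_on E S g"
  unfolding smooth_on_def using Ck_on_cong by blast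

lemma smooth_on_continuous: "smooth_on E S f \<Longrightarrow> continuous_on S f"
  unfolding smooth_on_def using Ck_on_continuous by blast

lemma smooth_on_local:
  fixes E :: "'e::euclidean_space set"
  assumes "subspace E" "openin (top_of_set E) S"
    "\<And>x. x \<in> S \<Longrightarrow> \<exists>T. openin (top_of_set E) T \<and> x \<in> T \<and> T \<subseteq> S \<and> smooth_on E T f"
  shows "smooth_on E S f"
  unfolding smooth_on_def
proof
  fix k show "Ck_on k E S f"
    by (rule Ck_on_local[OF assms(1,2)], frule assms(3)) (unfold smooth_on_def, blast)
qed

lemma smooth_on_compose:
  fixes E :: "'e::euclidean_space set" and F :: "'f::euclidean_space set"
  assumes "subspace E" "openin (top_of_set E) S" "subspace F" "T \<subseteq> F" "f ` S \<subseteq> T"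
    "smooth_on E S f" "smooth_on F T g"
  shows "smooth_on E S (\<lambda>x. g (f x))"
  unfolding smooth_on_def
proof
  fix k show "Ck_on k E S (\<lambda>x. g (f x))"
    by (rule Ck_on_compose[OF assms(1-5)]) (use assms(6,7) in \<open>simp_all add: smooth_on_def\<close>)
qed

lemma smooth_on_const: "smooth_on E S (\<lambda>_. c)" by (simp add: smooth_on_def Ck_on_const)

lemma smooth_on_linear: 
  fixes h :: "'e::euclidean_space \<Rightarrow> 'f::real_normed_vector"
  shows "linear h \<Longrightarrow> smooth_on E S h" by (simp add: smooth_on_def Ck_on_linear)

lemma smooth_on_bounded_linear: "bounded_linear h \<Longrightarrow> smooth_on E S f \<Longrightarrow> smooth_on E S (\<lambda>x. h (f x))"
  by (simp add: smooth_on_def Ck_on_bounded_linear)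

lemma smooth_on_add: "smooth_on E S f \<Longrightarrow> smooth_on E S g \<Longrightarrow> smooth_on E S (\<lambda>x. f x + g x)"
  by (simp add: smooth_on_def Ck_on_add)

lemma smooth_on_bilinear: 
  "bounded_bilinear b \<Longrightarrow> smooth_on E S f \<Longrightarrow> smooth_on E S g \<Longrightarrow> smooth_on E S (\<lambda>x. b (f x) (g x))"
  by (simp add: smooth_on_def Ck_on_bilinear)

lemma smooth_on_inverse:
  fixes f :: "'e::euclidean_space \<Rightarrow> real"
  shows "(\<And>x. x \<in> S \<Longrightarrow> f x \<noteq> 0) \<Longrightarrow> smooth_on E S f \<Longrightarrow> smooth_on E S (\<lambda>x. inverse (f x))"
  by (simp add: smooth_on_def Ck_on_inverse)

lemma smooth_on_has_derivative:
  "smooth_on E S f \<Longrightarrow> x \<in> S \<Longrightarrow> (f has_derivative frechet_derivative f (at x within S)) (at x within S)"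
proof -
  assume f: "smooth_on E S f" and x: "x \<in> S"
  have "Ck_on (Suc 0) E S f" using f unfolding smooth_on_def by blast
  then obtain f' where "(f has_derivative f') (at x within S)" using x by auto
  then show ?thesis using frechet_derivative_works unfolding differentiable_def by blast
qed

text \<open>The witnesses for different orders \<open>k\<close> are a priori unrelated to each other
  and to \<open>frechet_derivative\<close>. Uniqueness along \<open>E\<close> identifies all of
  them.\<close>

lemma smooth_on_frechet_derivative:
  fixes E :: "'e::euclidean_space set"
  assumes E: "subspace E" and S: "openin (top_of_set E) S" and f: "smooth_on E S f" and v: "v \<in> E"
  shows "smooth_on E S (\<lambda>x. frechet_derivative f (at x within S) v)"
  unfolding smooth_on_def
proof
  fix k
  obtain f' where f': "\<And>x. x \<in> S \<Longrightarrow> (f has_derivative f' x) (at x within S)" "Ck_on k E S (\<lambda>x. f' x v)"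
    using f v unfolding smooth_on_def by (metis Ck_on.simps(2))
  have "frechet_derivative f (at x within S) v = f' x v" if "x \<in> S" for x
    using has_derivative_unique_subspace[OF E S that smooth_on_has_derivative[OF f that] f'(1)[OF that] v] .
  then show "Ck_on k E S (\<lambda>x. frechet_derivative f (at x within S) v)" using f'(2) by (subst Ck_on_cong) auto
qed

section \<open>Coordinate subspaces\<close>

lemma bij_betw_coord_vec: "bij_betw (coord_vec :: nat \<Rightarrow> 'e::euclidean_space) {..<DIM('e)} Basis"
  unfolding coord_vec_def[abs_def] using bij_betw_from_nat_into_finite[OF finite_Basis] .

lemma coord_vec_in_Basis: "i < DIM('e) \<Longrightarrow> (coord_vec i :: 'e::euclidean_space) \<in> Basis"
  using bij_betw_coord_vec bij_betwE lessThan_iff by blast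

lemma inner_coord_vec:
  assumes "i < DIM('e)" "j < DIM('e)"
  shows "(coord_vec i :: 'e::euclidean_space) \<bullet> coord_vec j = (if i = j then 1 else 0)"
proof -
  have "(coord_vec i :: 'e) = coord_vec j \<longleftrightarrow> i = j"
    using assms inj_on_eq_iff[OF bij_betw_imp_inj_on[OF bij_betw_coord_vec[where 'e='e]], of i j] by simp
  then show ?thesis
    using inner_Basis[OF coord_vec_in_Basis[OF assms(1)] coord_vec_in_Basis[OF assms(2)]] by simp
qed

lemma subspace_coord_space [simp]: "subspace (coord_space n)"
  by (simp add: coord_space_def)

lemma coord_vec_in_coord_space: "i < n \<Longrightarrow> coord_vec i \<in> coord_space n"
  by (auto simp: coord_space_def intro: span_base)

lemma coord_space_mono: "k \<le> n \<Longrightarrow> coord_space k \<subseteq> coord_space n"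
  unfolding coord_space_def by (intro span_mono image_mono) auto

text \<open>For \<open>n\<close> up to the dimension this is the orthogonal projection onto
  \<open>coord_space n\<close>. Composition with it extends maps from relatively open parts of a
  coordinate subspace to open sets of a larger space.\<close>

definition coord_proj :: "nat \<Rightarrow> 'e::euclidean_space \<Rightarrow> 'e"
  where "coord_proj n v = (\<Sum>i<n. (v \<bullet> coord_vec i) *\<^sub>R coord_vec i)"

lemma linear_coord_proj: "linear (coord_proj n)"
  unfolding coord_proj_def by (rule linearI) (simp_all add: inner_add_left scaleR_add_left sum.distrib scaleR_sum_right)

lemma coord_proj_in_coord_space: "coord_proj n v \<in> coord_space n"
  unfolding coord_proj_def
  by (rule subspace_sum[OF subspace_coord_space], rule subspace_scale[OF subspace_coord_space])
     (simp add: coord_vec_in_coord_space)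

lemma coord_proj_inner:
  fixes v :: "'e::euclidean_space"
  assumes "n \<le> DIM('e)" "i < DIM('e)"
  shows "coord_proj n v \<bullet> coord_vec i = (if i < n then v \<bullet> coord_vec i else 0)"
proof -
  have "coord_proj n v \<bullet> coord_vec i = (\<Sum>j<n. if j = i then v \<bullet> coord_vec i else 0)"
    unfolding coord_proj_def inner_sum_left using assms by (intro sum.cong) (auto simp: inner_coord_vec)
  then show ?thesis by simp
qed

lemma coord_proj_ident:
  fixes v :: "'e::euclidean_space"
  assumes n: "n \<le> DIM('e)" and v: "v \<in> coord_space n"
  shows "coord_proj n v = v"
proof -
  have "v \<in> span (coord_vec ` {..<n})" using v by (simp add: coord_space_def)
  then show ?thesis
  proof (induction rule: span_induct)
    case base show ?case
      by (simp add: subspace_def linear_add[OF linear_coord_proj] linear_scale[OF linear_coord_proj] linear_0[OF linear_coord_proj])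
  next
    case (step x)
    then obtain i where i: "i < n" "x = coord_vec i" by auto
    have "coord_proj n x = (\<Sum>j<n. if j = i then x else 0)"
      unfolding coord_proj_def using i n by (intro sum.cong) (auto simp: inner_coord_vec)
    then show ?case using i by simp
  qed
qed

lemma coord_space_expansion:
  fixes v :: "'e::euclidean_space"
  assumes "n \<le> DIM('e)" "v \<in> coord_space n"
  shows "v = (\<Sum>i<n. (v \<bullet> coord_vec i) *\<^sub>R coord_vec i)"
  using coord_proj_ident[OF assms] unfolding coord_proj_def by (rule sym)

lemma coord_proj_orthogonal:
  fixes v w :: "'e::euclidean_space"
  assumes n: "n \<le> DIM('e)" and w: "w \<in> coord_space n"
  shows "coord_proj n v \<bullet> w = v \<bullet> w"
proof -
  have "coord_proj n v \<bullet> w = (\<Sum>i<n. (v \<bullet> coord_vec i) * (w \<bullet> coord_vec i))"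
    unfolding coord_proj_def inner_sum_left by (rule sum.cong) (simp_all add: inner_commute)
  also have "\<dots> = v \<bullet> (\<Sum>i<n. (w \<bullet> coord_vec i) *\<^sub>R coord_vec i)"
    unfolding inner_sum_right by (rule sum.cong) simp_all
  finally show ?thesis unfolding coord_space_expansion[OF assms, symmetric] .
qed

lemma coord_space_eqI:
  fixes v w :: "'e::euclidean_space"
  assumes n: "n \<le> DIM('e)" and "v \<in> coord_space n" "w \<in> coord_space n"
    and "\<And>i. i < n \<Longrightarrow> v \<bullet> coord_vec i = w \<bullet> coord_vec i"
  shows "v = w"
proof -
  have "coord_proj n v = coord_proj n w" unfolding coord_proj_def using assms(4) by simp
  then show ?thesis using coord_proj_ident[OF n] assms(2,3) by simp
qed

lemma coord_space_eqI':
  fixes v w :: "'e::euclidean_space"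
  assumes n: "n \<le> DIM('e)" and "v \<in> coord_space n" "w \<in> coord_space n"
    and "\<And>u. u \<in> coord_space n \<Longrightarrow> u \<bullet> v = u \<bullet> w"
  shows "v = w"
  by (rule coord_space_eqI[OF assms(1-3)]) (simp add: assms(4) coord_vec_in_coord_space inner_commute[of _ "coord_vec _"])

lemma coord_space_iff:
  fixes v :: "'e::euclidean_space"
  assumes n: "n \<le> DIM('e)" and k: "k \<le> n" and v: "v \<in> coord_space n"
  shows "v \<in> coord_space k \<longleftrightarrow> (\<forall>i. k \<le> i \<and> i < n \<longrightarrow> v \<bullet> coord_vec i = 0)"
proof
  assume "v \<in> coord_space k"
  then have "v = coord_proj k v" using coord_proj_ident[of k v] n k by simp
  then show "\<forall>i. k \<le> i \<and> i < n \<longrightarrow> v \<bullet> coord_vec i = 0"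
    using coord_proj_inner[of k _ v] n k by (metis dual_order.trans linorder_not_less order_less_le_trans)
next
  assume *: "\<forall>i. k \<le> i \<and> i < n \<longrightarrow> v \<bullet> coord_vec i = 0"
  have "coord_proj k v = v"
    by (rule coord_space_eqI[OF n])
       (use subsetD[OF coord_space_mono[OF k] coord_proj_in_coord_space[of k v]] v * n k in \<open>simp_all add: coord_proj_inner\<close>)
  then show "v \<in> coord_space k" using coord_proj_in_coord_space[of k v] by simp
qed

lemma dim_coord_space:
  assumes "n \<le> DIM('e)" shows "dim (coord_space n :: 'e::euclidean_space set) = n"
proof -
  have inj: "inj_on (coord_vec :: nat \<Rightarrow> 'e) {..<n}"
    using bij_betw_coord_vec[where 'e='e] assms by (auto simp: bij_betw_def intro: inj_on_subset)
  have "independent (coord_vec ` {..<n} :: 'e set)"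
    by (rule independent_mono[OF independent_Basis]) (use assms in \<open>auto intro!: coord_vec_in_Basis\<close>)
  then show ?thesis unfolding coord_space_def dim_span
    by (simp add: dim_eq_card_independent card_image[OF inj])
qed

section \<open>The inverse function theorem on a coordinate subspace\<close>

text \<open>The map is extended to an open set of the full space by adding the identity on the
  orthogonal complement, and the classical theorem is applied there. The extension agrees with
  \<open>g\<close> on \<open>coord_space n\<close> and sends no other point into
  \<open>coord_space n\<close>, so its local inverse restricts to one of \<open>g\<close>.\<close>

lemma smooth_inverse_function:
  fixes g :: "'e::euclidean_space \<Rightarrow> 'e"
  assumes n: "n \<le> DIM('e)" and S: "openin (top_of_set (coord_space n)) S"
    and g: "smooth_on (coord_space n) S g" and gS: "g ` S \<subseteq> coord_space n" and x: "x \<in> S"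
    and inj: "\<And>v. v \<in> coord_space n \<Longrightarrow> frechet_derivative g (at x within S) v = 0 \<Longrightarrow> v = 0"
  shows "\<exists>T h. openin (top_of_set (coord_space n)) T \<and> x \<in> T \<and> T \<subseteq> S \<and>
    openin (top_of_set (coord_space n)) (g ` T) \<and> (\<forall>z\<in>T. h (g z) = z) \<and> smooth_on (coord_space n) (g ` T) h"
proof -
  define E where "E = (coord_space n :: 'e set)"
  define P where "P = (coord_proj n :: 'e \<Rightarrow> 'e)"
  have E: "subspace E" by (simp add: E_def)
  have linP: "linear P" by (simp add: P_def linear_coord_proj)
  have PE: "P v \<in> E" for v by (simp add: P_def E_def coord_proj_in_coord_space)
  have Pid: "P v = v" if "v \<in> E" for v using that n by (simp add: P_def E_def coord_proj_ident)
  have Porth: "w \<in> E \<Longrightarrow> (v - P v) \<bullet> w = 0" for v w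
    using coord_proj_orthogonal[OF n] by (simp add: P_def E_def inner_diff_left)
  define g' where "g' y = frechet_derivative g (at y within S)" for y
  have g'd: "(g has_derivative g' y) (at y within S)" if "y \<in> S" for y
    unfolding g'_def using smooth_on_has_derivative[OF g that] .
  have g'E: "g' y v \<in> E" if "y \<in> S" "v \<in> E" for y v
    using has_derivative_in_subspace[OF E S[folded E_def] that(1) g'd[OF that(1)] that(2) E] gS by (simp add: E_def)
  have g's: "smooth_on E S (\<lambda>y. g' y v)" if "v \<in> E" for v
    unfolding g'_def using smooth_on_frechet_derivative[OF E S[folded E_def] g[folded E_def] that] .
  obtain U where U: "open U" "S = E \<inter> U" using S by (auto simp: openin_open E_def)
  define S1 where "S1 = P -` U"
  have contP: "continuous_on UNIV P" using linP by (simp add: linear_continuous_on linear_conv_bounded_linear)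
  have S1: "open S1" unfolding S1_def using U(1) contP by (metis open_vimage)
  have PS: "z \<in> S1 \<Longrightarrow> P z \<in> S" for z using PE U by (simp add: S1_def)
  have SS1: "z \<in> S \<Longrightarrow> z \<in> S1" for z using U Pid by (simp add: S1_def)
  define G where "G z = g (P z) + (z - P z)" for z
  define G' where "G' z v = g' (P z) (P v) + (v - P v)" for z v
  have PSim: "P ` S1 \<subseteq> S" using PS by auto
  have GD: "(G has_derivative G' z) (at z)" if z: "z \<in> S1" for z
  proof -
    have dP: "(P has_derivative P) (at z within S1)"
      using linP by (simp add: bounded_linear_imp_has_derivative linear_conv_bounded_linear)
    have "((\<lambda>z. g (P z)) has_derivative (\<lambda>v. g' (P z) (P v))) (at z within S1)"
      by (rule has_derivative_in_compose[OF dP has_derivative_subset[OF g'd[OF PS[OF z]] PSim]])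
    then have "(G has_derivative G' z) (at z within S1)"
      unfolding G_def[abs_def] G'_def[abs_def] using dP by (intro has_derivative_add has_derivative_diff has_derivative_ident)
    then show ?thesis using at_within_open[OF z S1] by simp
  qed
  have linG': "linear (G' z)" if "z \<in> S1" for z using GD[OF that] by (rule has_derivative_linear)
  define f' where "f' z = Blinfun (G' z)" for z
  have f'app: "blinfun_apply (f' z) = G' z" if "z \<in> S1" for z
    unfolding f'_def using linG'[OF that] by (simp add: bounded_linear_Blinfun_apply linear_conv_bounded_linear)
  have "continuous_on S1 f'"
  proof (rule continuous_on_blinfun_componentwise)
    fix i :: 'e
    have "continuous_on S1 (\<lambda>z. g' (P z) (P i))"
      by (rule continuous_on_compose2[OF smooth_on_continuous[OF g's[OF PE]] continuous_on_subset[OF contP]])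
         (use PS in auto)
    then have "continuous_on S1 (\<lambda>z. G' z i)" unfolding G'_def by (intro continuous_intros)
    then show "continuous_on S1 (\<lambda>z. blinfun_apply (f' z) i)" by (rule continuous_on_eq) (simp add: f'app)
  qed
  have xS1: "x \<in> S1" using SS1 x .
  \<comment> \<open>For a vector in the kernel, the component orthogonal to \<open>E\<close> equals
    minus a vector of \<open>E\<close>. Both are therefore zero, and injectivity of the derivative
    of \<open>g\<close> on \<open>E\<close> disposes of the rest.\<close>
  have "inj (G' x)"
    unfolding linear_injective_0[OF linG'[OF xS1]]
  proof (intro allI impI)
    fix v assume "G' x v = 0"
    moreover have xE: "x \<in> E" using x U by simp
    ultimately have *: "v - P v = - g' x (P v)" by (simp add: G'_def Pid add_eq_0_iff)
    then have "v - P v \<in> E" using g'E[OF x PE] E by (simp add: subspace_neg)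
    then have "v - P v = 0" using Porth[of "v - P v" v] by simp
    then show "v = 0" using * inj[of "P v"] PE[of v] by (simp add: g'_def E_def)
  qed
  then obtain H where H: "linear H" "H \<circ> G' x = id" using linear_injective_left_inverse[OF linG'[OF xS1]] by blast
  have invf: "Blinfun H o\<^sub>L f' x = id_blinfun"
    using H(1) H(2) by (intro blinfun_eqI) 
      (simp add: f'app[OF xS1] bounded_linear_Blinfun_apply linear_conv_bounded_linear fun_eq_iff)
  obtain U' V h h' where UV: "open U'" "U' \<subseteq> S1" "x \<in> U'" "open V" "G x \<in> V" "homeomorphism U' V G h"
    "\<And>y. y \<in> V \<Longrightarrow> (h has_derivative (h' y)) (at y)"
    "\<And>y. y \<in> V \<Longrightarrow> h' y = inv (blinfun_apply (f'(h y)))"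
    "\<And>y. y \<in> V \<Longrightarrow> bij (blinfun_apply (f'(h y)))"
    using inverse_function_theorem[OF S1 _ \<open>continuous_on S1 f'\<close> xS1 invf, of G] GD f'app by metis
  define T where "T = E \<inter> U'"
  have TS: "T \<subseteq> S" using UV(2) U Pid by (auto simp: T_def S1_def)
  have Gg: "G z = g z" if "z \<in> E" for z using Pid[OF that] by (simp add: G_def)
  \<comment> \<open>\<open>G\<close> does not change the component orthogonal to
    \<open>E\<close>.\<close>
  have GE: "z \<in> E" if "G z \<in> E" "z \<in> S1" for z
  proof -
    have "g (P z) \<in> E" using gS PS[OF that(2)] by (auto simp: E_def)
    then have "z - P z \<in> E" using that(1) subspace_diff[OF E, of "G z" "g (P z)"] by (simp add: G_def)
    then have "z - P z = 0" using Porth[of "z - P z" z] by simp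
    then show ?thesis using PE[of z] by simp
  qed
  have UVh: "\<And>z. z \<in> U' \<Longrightarrow> h (G z) = z" "\<And>y. y \<in> V \<Longrightarrow> G (h y) = y" "G ` U' = V" "h ` V = U'"
    using UV(6) by (auto simp: homeomorphism_def)
  have gT: "g ` T = E \<inter> V"
  proof
    show "g ` T \<subseteq> E \<inter> V"
    proof (clarify)
      fix z assume z: "z \<in> T"
      then have "G z \<in> V" using UVh(3) unfolding T_def by blast
      then show "g z \<in> E \<inter> V" using Gg[of z] z TS gS by (auto simp: T_def E_def)
    qed
    show "E \<inter> V \<subseteq> g ` T"
    proof
      fix y assume y: "y \<in> E \<inter> V"
      then have "h y \<in> U'" "G (h y) = y" using UVh by auto
      then have "h y \<in> T" using GE[of "h y"] y UV(2) by (auto simp: T_def)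
      then show "y \<in> g ` T" using \<open>G (h y) = y\<close> Gg[of "h y"] unfolding T_def by (metis IntD1 image_eqI)
    qed
  qed
  define V' where "V' = E \<inter> V"
  have V'o: "openin (top_of_set E) V'" using UV(4) by (simp add: V'_def openin_open_Int)
  have hV': "h ` V' \<subseteq> T"
  proof clarify
    fix y assume "y \<in> V'"
    then obtain z where z: "z \<in> T" "y = g z" using gT by (auto simp: V'_def)
    then have "h y = z" using UVh(1)[of z] Gg[of z] by (simp add: T_def)
    then show "h y \<in> T" using z by simp
  qed
  have To: "openin (top_of_set E) T" using UV(1) by (simp add: T_def openin_open_Int)
  have hd: "(h has_derivative h' y) (at y within V')" if "y \<in> V'" for y
    using UV(7)[of y] that by (simp add: V'_def has_derivative_at_withinI)
  \<comment> \<open>Bootstrap: the derivative of \<open>h\<close> at \<open>y\<close> is the inverse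
    of \<open>G'\<close> at \<open>h y\<close>. If \<open>h\<close> is of class \<open>k\<close>, so
    is the family of operators to be inverted, hence so are the inverses, and \<open>h\<close> is of
    class \<open>Suc k\<close>.\<close>
  have "Ck_on k E V' h" for k
  proof (induction k)
    case 0
    show ?case using hd by (auto simp: continuous_on_eq_continuous_within intro: has_derivative_continuous)
  next
    case (Suc k)
    have lA: "linear (G' (h y))" if "y \<in> V'" for y using linG'[of "h y"] that UV(2) UVh(4) by (auto simp: V'_def)
    have h'G: "h' y (G' (h y) v) = v" "G' (h y) (h' y v) = v" if "y \<in> V'" for y v
    proof -
      have yV: "y \<in> V" using that by (simp add: V'_def)
      have e: "blinfun_apply (f' (h y)) = G' (h y)" using f'app[of "h y"] yV UV(2) UVh(4) by auto
      show "h' y (G' (h y) v) = v" "G' (h y) (h' y v) = v"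
        using UV(8)[OF yV] UV(9)[OF yV] unfolding e by (simp_all add: bij_def surj_f_inv_f)
    qed
    have "Ck_on k E V' (\<lambda>y. h' y v)" for v
    proof (rule Ck_on_inverse_operator[OF E V'o lA _ h'G])
      show "linear (h' y)" if "y \<in> V'" for y using hd[OF that] by (rule has_derivative_linear)
      fix w
      have "Ck_on k E V' (\<lambda>y. g' (h y) (P w))"
      proof (rule Ck_on_compose[OF E V'o E _ hV' Suc])
        have "Ck_on k E S (\<lambda>y. g' y (P w))" using g's[OF PE] unfolding smooth_on_def by blast
        then show "Ck_on k E T (\<lambda>y. g' y (P w))" by (rule Ck_on_subset[OF _ TS order_refl])
      qed (simp add: T_def)
      then have "Ck_on k E V' (\<lambda>y. g' (h y) (P w) + (w - P w))" by (rule Ck_on_add[OF _ Ck_on_const])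
      moreover have "G' (h y) w = g' (h y) (P w) + (w - P w)" if "y \<in> V'" for y
      proof -
        have "h y \<in> E" using hV' that by (auto simp: T_def)
        then show ?thesis using Pid by (simp add: G'_def)
      qed
      ultimately show "Ck_on k E V' (\<lambda>y. G' (h y) w)" by (subst Ck_on_cong) auto
    qed 
    then show ?case using hd by (auto intro!: exI[of _ h'])
  qed
  then have "smooth_on E V' h" by (simp add: smooth_on_def)
  moreover have "\<forall>z\<in>T. h (g z) = z" 
  proof
    fix z assume "z \<in> T" then show "h (g z) = z" using UVh(1)[of z] Gg[of z] by (simp add: T_def)
  qed
  moreover have "x \<in> T" using x UV(3) U by (simp add: T_def)
  ultimately show ?thesis using To TS V'o gT unfolding E_def V'_def
    by (intro exI[of _ T] exI[of _ h]) simp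
qed
section \<open>Bump functions\<close>

text \<open>\<open>flat 0\<close> is the classical function exp(-1/t), continued by zero. The extra
  powers of 1/t close the family under differentiation up to linear combinations, so that smoothness
  is a single induction over the order, for all \<open>n\<close> together.\<close>

definition flat :: "nat \<Rightarrow> real \<Rightarrow> real"
  where "flat n t = (if t > 0 then inverse t ^ n * exp (- inverse t) else 0)"

lemma flat_tendsto_0: "(flat n \<longlongrightarrow> 0) (at 0)"
  unfolding filterlim_at_split
proof
  show "(flat n \<longlongrightarrow> 0) (at_left 0)"
    by (rule tendsto_eventually) (auto simp: flat_def eventually_at_filter)
  have "((\<lambda>t. inverse t ^ n / exp (inverse t)) \<longlongrightarrow> (0::real)) (at_right 0)"
    using filterlim_compose[OF tendsto_power_div_exp_0 filterlim_inverse_at_top_right] .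
  then show "(flat n \<longlongrightarrow> 0) (at_right 0)"
    by (rule Lim_transform_eventually) (auto simp: flat_def eventually_at_filter exp_minus divide_inverse)
qed

lemma flat_DERIV: "(flat n has_field_derivative (flat (n + 2) t - of_nat n * flat (n + 1) t)) (at t)"
proof -
  consider "t > 0" | "t = 0" | "t < 0" by linarith
  then show ?thesis
  proof cases
    case 1
    have "((\<lambda>t. inverse t ^ n * exp (- inverse t)) has_field_derivative 
      (flat (n + 2) t - of_nat n * flat (n + 1) t)) (at t)"
    proof -
      let ?u = "inverse t" and ?e = "exp (- inverse t)"
      have "((\<lambda>t. inverse t ^ n) has_field_derivative of_nat n * ?u ^ (n - 1) * - (?u * ?u)) (at t)"
        using 1 by (auto intro!: derivative_eq_intros)
      moreover have "((\<lambda>t. exp (- inverse t)) has_field_derivative ?e * (?u * ?u)) (at t)"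
        using 1 by (auto intro!: derivative_eq_intros)
      ultimately have "((\<lambda>t. inverse t ^ n * exp (- inverse t)) has_field_derivative
        of_nat n * ?u ^ (n - 1) * - (?u * ?u) * ?e + ?e * (?u * ?u) * ?u ^ n) (at t)"
        by (rule DERIV_mult)
      moreover have "of_nat n * ?u ^ (n - 1) * - (?u * ?u) * ?e + ?e * (?u * ?u) * ?u ^ n =
        flat (n + 2) t - of_nat n * flat (n + 1) t"
        using 1 by (cases n) (simp_all add: flat_def algebra_simps)
      ultimately show ?thesis by simp
    qed
    then show ?thesis
      by (rule has_field_derivative_transform_within_open[of _ _ _ "{0<..}"]) (use 1 in \<open>auto simp: flat_def\<close>)
  next
    case 2
    \<comment> \<open>Division by the argument raises the index by one: the difference quotient at 0
      is \<open>flat (n + 1)\<close>, which tends to 0.\<close>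
    have "((\<lambda>y. (flat n y - flat n 0) / (y - 0)) \<longlongrightarrow> 0) (at 0)"
      by (rule Lim_transform_eventually[OF flat_tendsto_0[of "n + 1"]])
         (auto simp: flat_def divide_inverse eventually_at_filter)
    then show ?thesis using 2 by (simp add: has_field_derivative_iff flat_def)
  next
    case 3
    have "((\<lambda>t. 0) has_field_derivative (flat (n + 2) t - of_nat n * flat (n + 1) t)) (at t)"
      using 3 by (simp add: flat_def)
    then show ?thesis
      by (rule has_field_derivative_transform_within_open[of _ _ _ "{..<0}"]) (use 3 in \<open>auto simp: flat_def\<close>)
  qed
qed

lemma Ck_on_flat: "Ck_on k UNIV UNIV (flat n)"
proof (induction k arbitrary: n)
  case 0
  show ?case using flat_DERIV by (auto intro!: continuous_at_imp_continuous_on DERIV_isCont)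
next
  case (Suc k)
  have "Ck_on k UNIV UNIV (\<lambda>t. (flat (n + 2) t + (- of_nat n) * flat (n + 1) t) * v)" for v
    by (intro Ck_on_bilinear[OF bounded_bilinear_mult] Ck_on_add Ck_on_const Suc)
  then show ?case using flat_DERIV[of n]
    by (auto simp: has_field_derivative_def intro!: exI[of _ "\<lambda>t v. (flat (n + 2) t + (- of_nat n) * flat (n + 1) t) * v"])
qed

lemma smooth_bump_exists:
  fixes z0 :: "'e::euclidean_space"
  assumes "\<epsilon> > 0"
  shows "\<exists>b::'e \<Rightarrow> real. smooth_on UNIV UNIV b \<and> (\<forall>z. dist z z0 \<le> \<epsilon> \<longrightarrow> b z = 1) \<and> (\<forall>z. 2 * \<epsilon> \<le> dist z z0 \<longrightarrow> b z = 0)"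
proof -
  define s where "s z = ((z - z0) \<bullet> (z - z0)) * inverse (\<epsilon>^2)" for z
  have sd: "s z = (dist z z0 / \<epsilon>)^2" for z
    by (simp add: s_def dist_norm dot_square_norm power_divide) (simp add: divide_inverse)
  \<comment> \<open>\<open>2 - s z\<close> and \<open>s z - 1\<close> cannot both be nonpositive, so
    the denominator never vanishes. The quotient is 1 where \<open>s z\<close> is at most 1 and 0
    where it is at least 2; at distance 2\<epsilon> the value of \<open>s\<close> is already 4. The
    squared distance keeps \<open>s\<close> smooth at the centre.\<close>
  define b where "b z = flat 0 (2 - s z) * inverse (flat 0 (2 - s z) + flat 0 (s z - 1))" for z
  have "smooth_on UNIV UNIV (\<lambda>z. z - z0)"
    using smooth_on_add[OF smooth_on_linear[OF linear_id] smooth_on_const[of _ _ "- z0"]] by simp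
  then have s: "smooth_on UNIV UNIV s"
    unfolding s_def
    by (intro smooth_on_bilinear[OF bounded_bilinear_mult] smooth_on_bilinear[OF bounded_bilinear_inner] smooth_on_const)
  have fl: "smooth_on UNIV UNIV (\<lambda>z. flat 0 (u z))" if "smooth_on UNIV UNIV u" for u :: "'e \<Rightarrow> real"
    by (rule smooth_on_compose[OF _ _ _ _ _ that, of UNIV UNIV]) (auto simp: smooth_on_def Ck_on_flat)
  have "smooth_on UNIV UNIV b"
    unfolding b_def
  proof (intro smooth_on_bilinear[OF bounded_bilinear_mult] smooth_on_inverse smooth_on_add fl)
    show "smooth_on UNIV UNIV (\<lambda>z. 2 - s z)" "smooth_on UNIV UNIV (\<lambda>z. s z - 1)"
      using smooth_on_add[OF smooth_on_const[of _ _ 2] smooth_on_bounded_linear[OF bounded_linear_minus[OF bounded_linear_ident] s]]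
        smooth_on_add[OF s smooth_on_const[of _ _ "-1"]] by simp_all
    then show "smooth_on UNIV UNIV (\<lambda>z. 2 - s z)" by simp
    show "flat 0 (2 - s z) + flat 0 (s z - 1) \<noteq> 0" for z
      by (auto simp: flat_def add_nonneg_eq_0_iff add_pos_pos)
  qed
  moreover have "b z = 1" if "dist z z0 \<le> \<epsilon>" for z
  proof -
    have "dist z z0 / \<epsilon> \<le> 1" using that assms by simp
    then have "s z \<le> 1" unfolding sd using assms by (intro power_le_one) auto
    then show ?thesis by (simp add: b_def flat_def)
  qed
  moreover have "b z = 0" if "2 * \<epsilon> \<le> dist z z0" for z
  proof -
    have "2 \<le> dist z z0 / \<epsilon>" using that assms by (simp add: le_divide_eq)
    then have "2^2 \<le> s z" unfolding sd by (intro power_mono) auto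
    then show ?thesis by (simp add: b_def flat_def)
  qed
  ultimately show ?thesis by blast
qed

section \<open>Charts and smooth functions\<close>

lemma subspace_model [simp]: "subspace (model M)" by (simp add: model_def)

lemma chartD:
  assumes "is_chart M (U, \<phi>)"
  shows "openin (mtop M) U" "U \<subseteq> carrier M" "inj_on \<phi> U" "openin (top_of_set (model M)) (\<phi> ` U)"
    "\<phi> ` U \<subseteq> model M"
    "homeomorphic_map (subtopology (mtop M) U) (top_of_set (\<phi> ` U)) \<phi>"
proof -
  show *: "openin (mtop M) U" "openin (top_of_set (model M)) (\<phi> ` U)"
    "homeomorphic_map (subtopology (mtop M) U) (top_of_set (\<phi> ` U)) \<phi>"
    using assms by (auto simp: is_chart_def)
  show U: "U \<subseteq> carrier M" using *(1) by (rule openin_subset)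
  show "inj_on \<phi> U" using homeomorphic_imp_injective_map[OF *(3)] U by (simp add: Int_absorb1)
  show "\<phi> ` U \<subseteq> model M" using openin_subset[OF *(2)] by simp
qed

lemma chart_image_open:
  assumes "is_chart M (U, \<phi>)" "openin (mtop M) W" "W \<subseteq> U"
  shows "openin (top_of_set (model M)) (\<phi> ` W)"
proof -
  have "openin (subtopology (mtop M) U) W" using assms by (simp add: openin_open_subtopology chartD(1))
  then have "openin (top_of_set (\<phi> ` U)) (\<phi> ` W)"
    using homeomorphic_imp_open_map[OF chartD(6)[OF assms(1)]] by (auto simp: open_map_def)
  then show ?thesis using chartD(4)[OF assms(1)] openin_trans by blast
qed

lemma chart_preimage_open:
  assumes "is_chart M (U, \<phi>)" "openin (top_of_set (model M)) T"
  shows "openin (mtop M) {x\<in>U. \<phi> x \<in> T}"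
proof -
  have U: "U \<subseteq> carrier M" "openin (mtop M) U" using chartD[OF assms(1)] by auto
  have "openin (top_of_set (\<phi> ` U)) (T \<inter> \<phi> ` U)"
    using assms(2) chartD(5)[OF assms(1)] by (auto simp: openin_open)
  from openin_continuous_map_preimage[OF homeomorphic_imp_continuous_map[OF chartD(6)[OF assms(1)]] this]
  have "openin (subtopology (mtop M) U) {x\<in>U. \<phi> x \<in> T}"
    using U(1) by (simp add: Int_absorb1 cong: conj_cong)
  then show ?thesis using U(2) by (simp add: openin_open_subtopology)
qed

lemma smooth_manifoldD:
  fixes M :: "('a, 'e::euclidean_space) mfd"
  assumes "smooth_manifold M"
  shows "mdim M \<le> DIM('e)" "Hausdorff_space (mtop M)" "second_countable (mtop M)"
    "c \<in> atlas M \<Longrightarrow> is_chart M c" "carrier M = (\<Union>c\<in>atlas M. fst c)"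
    "c \<in> atlas M \<Longrightarrow> d \<in> atlas M \<Longrightarrow> smooth_transition M c d"
    "c \<in> atlas M \<Longrightarrow> c \<in> max_atlas M"
  using assms by (auto simp: smooth_manifold_def max_atlas_def)

lemma max_atlas_chart: "c \<in> max_atlas M \<Longrightarrow> is_chart M c" by (simp add: max_atlas_def)

lemma atlas_cover:
  assumes "smooth_manifold M" "x \<in> carrier M"
  obtains U \<phi> where "(U, \<phi>) \<in> atlas M" "(U, \<phi>) \<in> max_atlas M" "x \<in> U"
  using smooth_manifoldD(5)[OF assms(1)] smooth_manifoldD(7)[OF assms(1)] assms(2) by fastforce

lemma smooth_on_chart_change:
  assumes c: "is_chart M (U, \<phi>)" and d: "is_chart M (V, \<psi>)"
    and W: "openin (mtop M) W" "W \<subseteq> U" "W \<subseteq> V"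
    and t: "smooth_on (model M) (\<phi> ` W) (\<psi> \<circ> inv_into U \<phi>)"
    and f: "smooth_on (model M) (\<psi> ` W) (f \<circ> inv_into V \<psi>)"
  shows "smooth_on (model M) (\<phi> ` W) (f \<circ> inv_into U \<phi>)"
proof -
  have inv: "inv_into U \<phi> (\<phi> x) = x" "inv_into V \<psi> (\<psi> x) = x" if "x \<in> W" for x
    using that W chartD(3)[OF c] chartD(3)[OF d] by auto
  have "smooth_on (model M) (\<phi> ` W) (\<lambda>z. (f \<circ> inv_into V \<psi>) ((\<psi> \<circ> inv_into U \<phi>) z))"
    by (rule smooth_on_compose[OF subspace_model chart_image_open[OF c W(1,2)] subspace_model _ _ t f])
       (use chartD(5)[OF d] W inv in auto)
  then show ?thesis using inv by (subst smooth_on_cong) auto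
qed

text \<open>Each of the two charts is known to be compatible with members of the atlas only, so near
  each point the transition is factored through an atlas chart around it.\<close>

lemma max_atlas_transition:
  assumes sm: "smooth_manifold M" and c: "(U, \<phi>) \<in> max_atlas M" and d: "(V, \<psi>) \<in> max_atlas M"
  shows "smooth_on (model M) (\<phi> ` (U \<inter> V)) (\<psi> \<circ> inv_into U \<phi>)"
proof (rule smooth_on_local[OF subspace_model])
  note ch = max_atlas_chart[OF c] max_atlas_chart[OF d]
  have UV: "openin (mtop M) (U \<inter> V)" using chartD(1)[OF ch(1)] chartD(1)[OF ch(2)] by blast
  show "openin (top_of_set (model M)) (\<phi> ` (U \<inter> V))"
    by (rule chart_image_open[OF ch(1) UV]) auto
  fix z assume "z \<in> \<phi> ` (U \<inter> V)"
  then obtain x where x: "x \<in> U" "x \<in> V" "z = \<phi> x" by auto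
  then obtain A \<kappa> where A: "(A, \<kappa>) \<in> atlas M" "x \<in> A"
    using atlas_cover[OF sm] chartD(2)[OF ch(1)] by blast
  note chA = smooth_manifoldD(4)[OF sm A(1)]
  let ?W = "U \<inter> V \<inter> A"
  have W: "openin (mtop M) ?W" using UV chartD(1)[OF chA] by blast
  have "smooth_on (model M) (\<phi> ` (U \<inter> A)) (\<kappa> \<circ> inv_into U \<phi>)"
    using c A(1) by (auto simp: max_atlas_def smooth_transition_def)
  then have 1: "smooth_on (model M) (\<phi> ` ?W) (\<kappa> \<circ> inv_into U \<phi>)" by (rule smooth_on_subset) auto
  have "smooth_on (model M) (\<kappa> ` (A \<inter> V)) (\<psi> \<circ> inv_into A \<kappa>)"
    using d A(1) by (auto simp: max_atlas_def smooth_transition_def)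
  then have 2: "smooth_on (model M) (\<kappa> ` ?W) (\<psi> \<circ> inv_into A \<kappa>)" by (rule smooth_on_subset) auto
  have "smooth_on (model M) (\<phi> ` ?W) (\<psi> \<circ> inv_into U \<phi>)"
    by (rule smooth_on_chart_change[OF ch(1) chA W _ _ 1 2]) auto
  moreover have "openin (top_of_set (model M)) (\<phi> ` ?W)" by (rule chart_image_open[OF ch(1) W]) auto
  ultimately show "\<exists>T. openin (top_of_set (model M)) T \<and> z \<in> T \<and> T \<subseteq> \<phi> ` (U \<inter> V) \<and>
    smooth_on (model M) T (\<psi> \<circ> inv_into U \<phi>)"
    using x A(2) by (intro exI[of _ "\<phi> ` ?W"]) auto
qed

text \<open>Transitions are smooth, so near each point a single compatible chart decides. Charts
  built for a particular purpose thereby become usable as tests.\<close>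

lemma smooth_fun_onI:
  assumes sm: "smooth_manifold M" and W: "openin (mtop M) W"
    and loc: "\<And>x. x \<in> W \<Longrightarrow> \<exists>U \<phi> G. (U, \<phi>) \<in> max_atlas M \<and> openin (mtop M) G \<and> x \<in> G \<and> G \<subseteq> U \<and>
      smooth_on (model M) (\<phi> ` G) (f \<circ> inv_into U \<phi>)"
  shows "smooth_fun_on M W f"
  unfolding smooth_fun_on_def
proof clarify
  fix V \<psi> assume V: "(V, \<psi>) \<in> atlas M"
  note chV = smooth_manifoldD(4)[OF sm V]
  show "smooth_on (model M) (\<psi> ` (V \<inter> W)) (f \<circ> inv_into V \<psi>)"
  proof (rule smooth_on_local[OF subspace_model])
    show "openin (top_of_set (model M)) (\<psi> ` (V \<inter> W))"
      by (rule chart_image_open[OF chV]) (use W chartD(1)[OF chV] in auto)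
    fix z assume "z \<in> \<psi> ` (V \<inter> W)"
    then obtain x where x: "x \<in> V" "x \<in> W" "z = \<psi> x" by auto
    obtain U \<phi> O' where U: "(U, \<phi>) \<in> max_atlas M" and O: "openin (mtop M) O'" "x \<in> O'" "O' \<subseteq> U"
      and s: "smooth_on (model M) (\<phi> ` O') (f \<circ> inv_into U \<phi>)" using loc[OF x(2)] by blast
    let ?O = "O' \<inter> V \<inter> W"
    have oO: "openin (mtop M) ?O" using O(1) W chartD(1)[OF chV] by blast
    have "smooth_on (model M) (\<psi> ` ?O) (\<phi> \<circ> inv_into V \<psi>)"
      using max_atlas_transition[OF sm smooth_manifoldD(7)[OF sm V] U] by (rule smooth_on_subset) (use O in auto)
    moreover have "smooth_on (model M) (\<phi> ` ?O) (f \<circ> inv_into U \<phi>)" using s by (rule smooth_on_subset) auto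
    ultimately have "smooth_on (model M) (\<psi> ` ?O) (f \<circ> inv_into V \<psi>)"
      by (rule smooth_on_chart_change[OF chV max_atlas_chart[OF U] oO, rotated 2]) (use O in auto)
    moreover have "openin (top_of_set (model M)) (\<psi> ` ?O)" by (rule chart_image_open[OF chV oO]) auto
    ultimately show "\<exists>T. openin (top_of_set (model M)) T \<and> z \<in> T \<and> T \<subseteq> \<psi> ` (V \<inter> W) \<and>
      smooth_on (model M) T (f \<circ> inv_into V \<psi>)"
      using x O by (intro exI[of _ "\<psi> ` ?O"]) auto
  qed
qed

lemma smooth_fun_onD:
  assumes sm: "smooth_manifold M" and W: "openin (mtop M) W" and f: "smooth_fun_on M W f"
    and c: "(U, \<phi>) \<in> max_atlas M"
  shows "smooth_on (model M) (\<phi> ` (U \<inter> W)) (f \<circ> inv_into U \<phi>)"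
proof (rule smooth_on_local[OF subspace_model])
  note chU = max_atlas_chart[OF c]
  show "openin (top_of_set (model M)) (\<phi> ` (U \<inter> W))"
    by (rule chart_image_open[OF chU]) (use W chartD(1)[OF chU] in auto)
  fix z assume "z \<in> \<phi> ` (U \<inter> W)"
  then obtain x where x: "x \<in> U" "x \<in> W" "z = \<phi> x" by auto
  obtain V \<psi> where V: "(V, \<psi>) \<in> atlas M" "(V, \<psi>) \<in> max_atlas M" "x \<in> V"
    using atlas_cover[OF sm] chartD(2)[OF chU] x(1) by blast
  note chV = max_atlas_chart[OF V(2)]
  let ?O = "U \<inter> V \<inter> W"
  have oO: "openin (mtop M) ?O" using chartD(1)[OF chU] W chartD(1)[OF chV] by blast
  have "smooth_on (model M) (\<phi> ` ?O) (\<psi> \<circ> inv_into U \<phi>)"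
    using max_atlas_transition[OF sm c V(2)] by (rule smooth_on_subset) auto
  moreover have "smooth_on (model M) (\<psi> ` (V \<inter> W)) (f \<circ> inv_into V \<psi>)"
    using f V(1) by (auto simp: smooth_fun_on_def)
  then have "smooth_on (model M) (\<psi> ` ?O) (f \<circ> inv_into V \<psi>)" by (rule smooth_on_subset) auto
  ultimately have "smooth_on (model M) (\<phi> ` ?O) (f \<circ> inv_into U \<phi>)"
    by (rule smooth_on_chart_change[OF chU chV oO, rotated 2]) auto
  moreover have "openin (top_of_set (model M)) (\<phi> ` ?O)" by (rule chart_image_open[OF chU oO]) auto
  ultimately show "\<exists>T. openin (top_of_set (model M)) T \<and> z \<in> T \<and> T \<subseteq> \<phi> ` (U \<inter> W) \<and>
    smooth_on (model M) T (f \<circ> inv_into U \<phi>)"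
    using x V(3) by (intro exI[of _ "\<phi> ` ?O"]) auto
qed

lemma smooth_fun_on_subset: "smooth_fun_on M W f \<Longrightarrow> T \<subseteq> W \<Longrightarrow> smooth_fun_on M T f"
  unfolding smooth_fun_on_def by (auto intro: smooth_on_subset)

lemma smooth_fun_on_cong: 
  assumes sm: "smooth_manifold M" and eq: "\<And>x. x \<in> W \<Longrightarrow> f x = g x" and f: "smooth_fun_on M W f"
  shows "smooth_fun_on M W g"
  unfolding smooth_fun_on_def
proof clarify
  fix U \<phi> assume U: "(U, \<phi>) \<in> atlas M"
  have "inj_on \<phi> U" using chartD(3)[OF smooth_manifoldD(4)[OF sm U]] .
  moreover have "smooth_on (model M) (\<phi> ` (U \<inter> W)) (f \<circ> inv_into U \<phi>)" using f U by (auto simp: smooth_fun_on_def)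
  ultimately show "smooth_on (model M) (\<phi> ` (U \<inter> W)) (g \<circ> inv_into U \<phi>)"
    using eq by (subst smooth_on_cong[of _ _ "f \<circ> inv_into U \<phi>"]) auto
qed

lemma smooth_fun_on_local:
  assumes sm: "smooth_manifold M" and W: "openin (mtop M) W"
    and loc: "\<And>x. x \<in> W \<Longrightarrow> \<exists>G. openin (mtop M) G \<and> x \<in> G \<and> smooth_fun_on M G f"
  shows "smooth_fun_on M W f"
proof (rule smooth_fun_onI[OF sm W])
  fix x assume x: "x \<in> W"
  then obtain O' where O: "openin (mtop M) O'" "x \<in> O'" "smooth_fun_on M O' f" using loc by blast
  obtain U \<phi> where U: "(U, \<phi>) \<in> atlas M" "(U, \<phi>) \<in> max_atlas M" "x \<in> U"
    using atlas_cover[OF sm] openin_subset[OF W] x by blast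
  have "smooth_on (model M) (\<phi> ` (U \<inter> O')) (f \<circ> inv_into U \<phi>)" by (rule smooth_fun_onD[OF sm O(1,3) U(2)])
  moreover have "openin (mtop M) (U \<inter> O')" using chartD(1)[OF max_atlas_chart[OF U(2)]] O(1) by blast
  ultimately show "\<exists>U \<phi> G. (U, \<phi>) \<in> max_atlas M \<and> openin (mtop M) G \<and> x \<in> G \<and> G \<subseteq> U \<and>
      smooth_on (model M) (\<phi> ` G) (f \<circ> inv_into U \<phi>)"
    using U(2,3) O(2) by (intro exI[of _ U] exI[of _ \<phi>] exI[of _ "U \<inter> O'"]) auto
qed

lemma smooth_fun_on_const: "smooth_fun_on M W (\<lambda>_. c)"
  by (auto simp: smooth_fun_on_def comp_def smooth_on_const)

lemma smooth_fun_on_add: "smooth_fun_on M W f \<Longrightarrow> smooth_fun_on M W g \<Longrightarrow> smooth_fun_on M W (\<lambda>x. f x + g x)"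
  by (fastforce simp: smooth_fun_on_def comp_def intro: smooth_on_add)

lemma smooth_fun_on_sum: "(\<And>i. i \<in> I \<Longrightarrow> smooth_fun_on M W (f i)) \<Longrightarrow> smooth_fun_on M W (\<lambda>x. \<Sum>i\<in>I. f i x)"
  by (induction I rule: infinite_finite_induct) (auto intro: smooth_fun_on_const smooth_fun_on_add)

lemma smooth_fun_on_bilinear: 
  assumes "bounded_bilinear b"
  shows "smooth_fun_on M W f \<Longrightarrow> smooth_fun_on M W g \<Longrightarrow> smooth_fun_on M W (\<lambda>x. b (f x) (g x))"
  by (fastforce simp: smooth_fun_on_def comp_def intro: smooth_on_bilinear[OF assms])

lemma smooth_fun_on_bounded_linear: 
  assumes "bounded_linear h"
  shows "smooth_fun_on M W f \<Longrightarrow> smooth_fun_on M W (\<lambda>x. h (f x))"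
  by (fastforce simp: smooth_fun_on_def comp_def intro: smooth_on_bounded_linear[OF assms])

lemma smooth_fun_on_chart:
  assumes sm: "smooth_manifold M" and c: "(U, \<phi>) \<in> max_atlas M" and W: "openin (mtop M) W" "W \<subseteq> U"
    and F: "smooth_on (model M) (\<phi> ` W) F"
  shows "smooth_fun_on M W (\<lambda>x. F (\<phi> x))"
proof (rule smooth_fun_onI[OF sm W(1)])
  fix x assume x: "x \<in> W"
  have "inj_on \<phi> U" using chartD(3)[OF max_atlas_chart[OF c]] .
  then have "smooth_on (model M) (\<phi> ` W) ((\<lambda>x. F (\<phi> x)) \<circ> inv_into U \<phi>)"
    using F W(2) by (subst smooth_on_cong[of _ _ F]) auto
  then show "\<exists>U' \<phi>' G. (U', \<phi>') \<in> max_atlas M \<and> openin (mtop M) G \<and> x \<in> G \<and> G \<subseteq> U' \<and>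
      smooth_on (model M) (\<phi>' ` G) ((\<lambda>x. F (\<phi> x)) \<circ> inv_into U' \<phi>')" using c W x by blast
qed

lemma smooth_fun_on_chart_self:
  assumes sm: "smooth_manifold M" and c: "(U, \<phi>) \<in> max_atlas M"
  shows "smooth_fun_on M U \<phi>"
  using smooth_fun_on_chart[OF sm c chartD(1)[OF max_atlas_chart[OF c]] order_refl smooth_on_linear[OF linear_id]] by simp

section \<open>Smooth maps between manifolds and pullback of functions\<close>

lemma smooth_map_iff:
  "smooth_map M N p \<longleftrightarrow> continuous_map (mtop M) (mtop N) p \<and>
    (\<forall>(W, \<psi>)\<in>atlas N. smooth_fun_on M (p -` W) (\<psi> \<circ> p))"
  unfolding smooth_map_def smooth_fun_on_def by fast

lemma smooth_map_preimage_open: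
  assumes "smooth_map M N p" "openin (mtop N) W"
  shows "openin (mtop M) {x\<in>carrier M. p x \<in> W}"
  using assms openin_continuous_map_preimage unfolding smooth_map_def by blast

lemma smooth_map_carrier: "smooth_map M N p \<Longrightarrow> x \<in> carrier M \<Longrightarrow> p x \<in> carrier N"
  unfolding smooth_map_def using continuous_map_image_subset_topspace by blast

lemma smooth_fun_on_pullback:
  assumes M: "smooth_manifold M" and N: "smooth_manifold N" and p: "smooth_map M N p"
    and W: "openin (mtop N) W" and f: "smooth_fun_on N W f"
  shows "smooth_fun_on M {x\<in>carrier M. p x \<in> W} (f \<circ> p)"
proof (rule smooth_fun_onI[OF M smooth_map_preimage_open[OF p W]])
  fix x assume "x \<in> {x\<in>carrier M. p x \<in> W}"
  then have x: "x \<in> carrier M" "p x \<in> W" by auto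
  obtain V \<psi> where V: "(V, \<psi>) \<in> atlas N" "p x \<in> V"
    using atlas_cover[OF N smooth_map_carrier[OF p x(1)]] by metis
  obtain U \<phi> where U: "(U, \<phi>) \<in> atlas M" "(U, \<phi>) \<in> max_atlas M" "x \<in> U"
    using atlas_cover[OF M x(1)] by metis
  note chU = max_atlas_chart[OF U(2)] and chV = smooth_manifoldD(4)[OF N V(1)]
  let ?O = "U \<inter> {x\<in>carrier M. p x \<in> W \<inter> V}"
  have oO: "openin (mtop M) ?O"
    using smooth_map_preimage_open[OF p, of "W \<inter> V"] W chartD(1)[OF chU] chartD(1)[OF chV] by blast
  have inv: "inv_into U \<phi> (\<phi> y) = y" "inv_into V \<psi> (\<psi> (p y)) = p y" if "y \<in> ?O" for y
    using that chartD(3)[OF chU] chartD(3)[OF chV] by auto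
  have "smooth_on (model M) (\<phi> ` (U \<inter> p -` V)) (\<psi> \<circ> p \<circ> inv_into U \<phi>)"
    using p U(1) V(1) unfolding smooth_map_def by blast
  then have 1: "smooth_on (model M) (\<phi> ` ?O) (\<psi> \<circ> p \<circ> inv_into U \<phi>)" by (rule smooth_on_subset) auto
  have 2: "smooth_on (model N) (\<psi> ` (V \<inter> W)) (f \<circ> inv_into V \<psi>)"
    using f V(1) by (auto simp: smooth_fun_on_def)
  have "smooth_on (model M) (\<phi> ` ?O) (\<lambda>z. (f \<circ> inv_into V \<psi>) ((\<psi> \<circ> p \<circ> inv_into U \<phi>) z))"
    by (rule smooth_on_compose[OF subspace_model chart_image_open[OF chU oO] subspace_model _ _ 1 2])
       (use chartD(5)[OF chV] inv in auto)
  then have "smooth_on (model M) (\<phi> ` ?O) ((f \<circ> p) \<circ> inv_into U \<phi>)"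
    by (rule iffD1[OF smooth_on_cong, rotated]) (use inv in auto)
  then show "\<exists>U \<phi> G. (U, \<phi>) \<in> max_atlas M \<and> openin (mtop M) G \<and> x \<in> G \<and> G \<subseteq> U \<and>
      smooth_on (model M) (\<phi> ` G) ((f \<circ> p) \<circ> inv_into U \<phi>)"
    using U x V(2) oO by (intro exI[of _ U] exI[of _ \<phi>] exI[of _ ?O]) auto
qed

lemma smooth_fun_on_carrier_Int:
  assumes M: "smooth_manifold M"
  shows "smooth_fun_on M (carrier M \<inter> W) f \<longleftrightarrow> smooth_fun_on M W f"
proof -
  have "U \<inter> (carrier M \<inter> W) = U \<inter> W" if "(U, \<phi>) \<in> atlas M" for U \<phi>
    using chartD(2)[OF smooth_manifoldD(4)[OF M that]] by auto
  then show ?thesis unfolding smooth_fun_on_def by (metis (no_types, lifting) case_prodD case_prodI2)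
qed

lemma smooth_mapI:
  assumes M: "smooth_manifold M" and "continuous_map (mtop M) (mtop N) p"
    and "\<And>W \<psi>. (W, \<psi>) \<in> atlas N \<Longrightarrow> smooth_fun_on M {x\<in>carrier M. p x \<in> W} (\<psi> \<circ> p)"
  shows "smooth_map M N p"
  unfolding smooth_map_iff
proof (intro conjI ballI, fact assms(2), clarify)
  fix W \<psi> assume "(W, \<psi>) \<in> atlas N"
  then have "smooth_fun_on M (carrier M \<inter> p -` W) (\<psi> \<circ> p)"
    using assms(3)[of W \<psi>] by (simp add: vimage_def Int_def)
  then show "smooth_fun_on M (p -` W) (\<psi> \<circ> p)" by (simp add: smooth_fun_on_carrier_Int[OF M])
qed

lemma smooth_map_ident:
  assumes M: "smooth_manifold M" shows "smooth_map M M (\<lambda>x. x)"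
proof (rule smooth_mapI[OF M])
  fix W \<psi> assume W: "(W, \<psi>) \<in> atlas M"
  have "{x\<in>carrier M. x \<in> W} = W" using chartD(2)[OF smooth_manifoldD(4)[OF M W]] by auto
  then show "smooth_fun_on M {x\<in>carrier M. x \<in> W} (\<psi> \<circ> (\<lambda>x. x))"
    using smooth_fun_on_chart_self[OF M smooth_manifoldD(7)[OF M W]] by (simp add: comp_def)
qed simp

lemma smooth_map_compose:
  assumes M: "smooth_manifold M" and N: "smooth_manifold N" and Q: "smooth_manifold Q"
    and p: "smooth_map M N p" and q: "smooth_map N Q q"
  shows "smooth_map M Q (q \<circ> p)"
proof (rule smooth_mapI[OF M])
  show "continuous_map (mtop M) (mtop Q) (q \<circ> p)"
    using p q continuous_map_compose unfolding smooth_map_def by blast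
  fix W \<psi> assume W: "(W, \<psi>) \<in> atlas Q"
  have o: "openin (mtop Q) W" using chartD(1)[OF smooth_manifoldD(4)[OF Q W]] .
  have "smooth_fun_on N {x\<in>carrier N. q x \<in> W} (\<psi> \<circ> q)"
    by (rule smooth_fun_on_pullback[OF N Q q o smooth_fun_on_chart_self[OF Q smooth_manifoldD(7)[OF Q W]]])
  from smooth_fun_on_pullback[OF M N p smooth_map_preimage_open[OF q o] this]
  show "smooth_fun_on M {x\<in>carrier M. (q \<circ> p) x \<in> W} (\<psi> \<circ> (q \<circ> p))"
    using smooth_map_carrier[OF p] by (simp add: comp_assoc cong: conj_cong)
qed

section \<open>Tangent maps\<close>

text \<open>\<open>deriv_at\<close> uses the chart selected at the point, and this selection may
  jump from one point to the next. The derivative in a fixed chart is the quantity that depends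
  smoothly on the point; \<open>deriv_at_in_chart\<close> relates the two.\<close>

definition chart_deriv :: "('a, 'e::euclidean_space) chart \<Rightarrow> ('a \<Rightarrow> 'v::real_normed_vector) \<Rightarrow> 'a \<Rightarrow> 'e \<Rightarrow> 'v"
  where "chart_deriv c f x =
    frechet_derivative (f \<circ> inv_into (fst c) (snd c)) (at (snd c x) within snd c ` fst c)"

lemma deriv_at_eq_chart_deriv: "deriv_at M f x = chart_deriv (chart_at M x) f x"
  by (simp add: deriv_at_def chart_deriv_def fun_eq_iff split_beta Let_def)

lemma chart_at_atlas:
  assumes M: "smooth_manifold M" and x: "x \<in> carrier M"
  shows "chart_at M x \<in> atlas M" "x \<in> fst (chart_at M x)"
proof -
  have "\<exists>c. c \<in> atlas M \<and> x \<in> fst c" using smooth_manifoldD(5)[OF M] x by auto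
  from someI_ex[OF this] show "chart_at M x \<in> atlas M" "x \<in> fst (chart_at M x)"
    by (auto simp: chart_at_def)
qed

lemma chart_at_max:
  assumes M: "smooth_manifold M" and x: "x \<in> carrier M"
  shows "(fst (chart_at M x), snd (chart_at M x)) \<in> max_atlas M"
  using smooth_manifoldD(7)[OF M chart_at_atlas(1)[OF M x]] by simp

lemma at_within_chart:
  assumes c: "is_chart M (U, \<phi>)" and W: "openin (mtop M) W" "W \<subseteq> U" and x: "x \<in> W"
  shows "at (\<phi> x) within \<phi> ` U = at (\<phi> x) within \<phi> ` W"
  by (rule at_within_openin_eq[OF chartD(4)[OF c] chart_image_open[OF c W]]) (use x W in auto)

lemma chart_has_derivative:
  assumes M: "smooth_manifold M" and c: "(U, \<phi>) \<in> max_atlas M" and W: "openin (mtop M) W"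
    and f: "smooth_fun_on M W f" and x: "x \<in> U" "x \<in> W"
  shows "(f \<circ> inv_into U \<phi> has_derivative chart_deriv (U, \<phi>) f x) (at (\<phi> x) within \<phi> ` U)"
proof -
  note ch = max_atlas_chart[OF c]
  have UW: "openin (mtop M) (U \<inter> W)" using chartD(1)[OF ch] W by blast
  have "(f \<circ> inv_into U \<phi> has_derivative chart_deriv (U, \<phi>) f x) (at (\<phi> x) within \<phi> ` (U \<inter> W))"
    using smooth_on_has_derivative[OF smooth_fun_onD[OF M W f c], of "\<phi> x"] at_within_chart[OF ch UW Int_lower1, of x] x
    unfolding chart_deriv_def by simp
  then show ?thesis using at_within_chart[OF ch UW] x by simp
qed

lemma chart_deriv_linear:
  assumes M: "smooth_manifold M" and c: "(U, \<phi>) \<in> max_atlas M" and W: "openin (mtop M) W"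
    and f: "smooth_fun_on M W f" and x: "x \<in> U" "x \<in> W"
  shows "linear (chart_deriv (U, \<phi>) f x)"
  using chart_has_derivative[OF assms] by (rule has_derivative_linear)

lemma chart_deriv_eqI:
  assumes M: "smooth_manifold M" and c: "(U, \<phi>) \<in> max_atlas M" and W: "openin (mtop M) W"
    and x: "x \<in> U" "x \<in> W"
    and D: "(f \<circ> inv_into U \<phi> has_derivative D) (at (\<phi> x) within \<phi> ` (U \<inter> W))" and v: "v \<in> model M"
  shows "chart_deriv (U, \<phi>) f x v = D v"
proof -
  note ch = max_atlas_chart[OF c]
  have UW: "openin (mtop M) (U \<inter> W)" using chartD(1)[OF ch] W by blast
  have D': "(f \<circ> inv_into U \<phi> has_derivative D) (at (\<phi> x) within \<phi> ` U)"
    using D at_within_chart[OF ch UW] x by simp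
  then have "(f \<circ> inv_into U \<phi> has_derivative chart_deriv (U, \<phi>) f x) (at (\<phi> x) within \<phi> ` U)"
    unfolding chart_deriv_def fst_conv snd_conv using frechet_derivative_works differentiable_def by blast
  then show ?thesis
    using has_derivative_unique_subspace[OF subspace_model chartD(4)[OF ch] _ _ D' v] x by blast
qed

lemma chart_deriv_cong:
  assumes c: "is_chart M (U, \<phi>)" and W: "openin (mtop M) W" and x: "x \<in> U" "x \<in> W"
    and eq: "\<And>y. y \<in> W \<Longrightarrow> f y = g y"
  shows "chart_deriv (U, \<phi>) f x = chart_deriv (U, \<phi>) g x"
proof -
  have UW: "openin (mtop M) (U \<inter> W)" using chartD(1)[OF c] W by blast
  have e: "at (\<phi> x) within \<phi> ` U = at (\<phi> x) within \<phi> ` (U \<inter> W)"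
    using at_within_chart[OF c UW] x by simp
  have eq': "(f \<circ> inv_into U \<phi>) z = (g \<circ> inv_into U \<phi>) z" if "z \<in> \<phi> ` (U \<inter> W)" for z
    using that eq chartD(3)[OF c] by auto
  have z: "\<phi> x \<in> \<phi> ` (U \<inter> W)" using x by blast
  have "(f \<circ> inv_into U \<phi> has_derivative D) (at (\<phi> x) within \<phi> ` U) \<longleftrightarrow>
        (g \<circ> inv_into U \<phi> has_derivative D) (at (\<phi> x) within \<phi> ` U)" for D
    unfolding e using has_derivative_transform[OF z, of "f \<circ> inv_into U \<phi>" "g \<circ> inv_into U \<phi>" D]
      has_derivative_transform[OF z, of "g \<circ> inv_into U \<phi>" "f \<circ> inv_into U \<phi>" D] eq' by metis
  then show ?thesis by (simp add: chart_deriv_def frechet_derivative_def)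
qed

lemma chart_deriv_chain:
  assumes M: "smooth_manifold M" and N: "smooth_manifold N" and p: "smooth_map M N p"
    and c: "(U, \<phi>) \<in> max_atlas M" and x: "x \<in> U" and d: "(V, \<psi>) \<in> max_atlas N" and px: "p x \<in> V" "p x \<in> W"
    and W: "openin (mtop N) W" and f: "smooth_fun_on N W f" and v: "v \<in> model M"
  shows "chart_deriv (U, \<phi>) (f \<circ> p) x v = chart_deriv (V, \<psi>) f (p x) (chart_deriv (U, \<phi>) (\<psi> \<circ> p) x v)"
    and "chart_deriv (U, \<phi>) (\<psi> \<circ> p) x v \<in> model N"
    and "linear (chart_deriv (U, \<phi>) (\<psi> \<circ> p) x)"
proof -
  note chU = max_atlas_chart[OF c] and chV = max_atlas_chart[OF d]
  have xc: "x \<in> carrier M" using chartD(2)[OF chU] x by blast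
  let ?V = "{x\<in>carrier M. p x \<in> V}"
  let ?G = "{x\<in>carrier M. p x \<in> V \<inter> W}"
  have V: "openin (mtop M) ?V" using smooth_map_preimage_open[OF p chartD(1)[OF chV]] .
  have G: "openin (mtop M) ?G" 
    using smooth_map_preimage_open[OF p, of "V \<inter> W"] W chartD(1)[OF chV] by blast
  have sV: "smooth_fun_on M ?V (\<psi> \<circ> p)"
    by (rule smooth_fun_on_pullback[OF M N p chartD(1)[OF chV] smooth_fun_on_chart_self[OF N d]])
  show lin: "linear (chart_deriv (U, \<phi>) (\<psi> \<circ> p) x)"
    by (rule chart_deriv_linear[OF M c V sV x]) (use xc px in auto)
  let ?A = "chart_deriv (U, \<phi>) (\<psi> \<circ> p) x"
  have A: "((\<psi> \<circ> p) \<circ> inv_into U \<phi> has_derivative ?A) (at (\<phi> x) within \<phi> ` U)"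
    by (rule chart_has_derivative[OF M c V sV x]) (use xc px in auto)
  have UV: "openin (mtop M) (U \<inter> ?V)" using V chartD(1)[OF chU] by blast
  have A': "((\<psi> \<circ> p) \<circ> inv_into U \<phi> has_derivative ?A) (at (\<phi> x) within \<phi> ` (U \<inter> ?V))"
    using A by (rule has_derivative_subset) auto
  have inv: "inv_into U \<phi> (\<phi> y) = y" if "y \<in> U" for y using that chartD(3)[OF chU] by (rule inv_into_f_f[rotated])
  have inv': "inv_into V \<psi> (\<psi> y) = y" if "y \<in> V" for y using that chartD(3)[OF chV] by (rule inv_into_f_f[rotated])
  show "?A v \<in> model N"
  proof (rule has_derivative_in_subspace[OF subspace_model chart_image_open[OF chU UV] _ A' v subspace_model])
    show "\<phi> x \<in> \<phi> ` (U \<inter> ?V)" using x xc px by blast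
    show "(\<psi> \<circ> p \<circ> inv_into U \<phi>) ` \<phi> ` (U \<inter> ?V) \<subseteq> model N"
    proof clarify
      fix y assume "y \<in> U" "p y \<in> V"
      then show "(\<psi> \<circ> p \<circ> inv_into U \<phi>) (\<phi> y) \<in> model N" using inv[of y] chartD(5)[OF chV] by auto
    qed
  qed simp
  have F: "(f \<circ> inv_into V \<psi> has_derivative chart_deriv (V, \<psi>) f (p x)) (at (\<psi> (p x)) within \<psi> ` V)"
    by (rule chart_has_derivative[OF N d W f px])
  have A2: "((\<psi> \<circ> p) \<circ> inv_into U \<phi> has_derivative ?A) (at (\<phi> x) within \<phi> ` (U \<inter> ?G))"
    using A by (rule has_derivative_subset) auto
  have "(f \<circ> inv_into V \<psi> has_derivative chart_deriv (V, \<psi>) f (p x))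
    (at (((\<psi> \<circ> p) \<circ> inv_into U \<phi>) (\<phi> x)) within (((\<psi> \<circ> p) \<circ> inv_into U \<phi>) ` \<phi> ` (U \<inter> ?G)))"
  proof (rule has_derivative_subset)
    show "(f \<circ> inv_into V \<psi> has_derivative chart_deriv (V, \<psi>) f (p x))
      (at ((\<psi> \<circ> p \<circ> inv_into U \<phi>) (\<phi> x)) within \<psi> ` V)" using F inv[OF x] by simp
    show "(\<psi> \<circ> p \<circ> inv_into U \<phi>) ` \<phi> ` (U \<inter> ?G) \<subseteq> \<psi> ` V"
    proof clarify
      fix y assume "y \<in> U" "p y \<in> V"
      then show "(\<psi> \<circ> p \<circ> inv_into U \<phi>) (\<phi> y) \<in> \<psi> ` V" using inv[of y] by auto
    qed
  qed
  from has_derivative_in_compose[OF A2 this]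
  have "((\<lambda>z. (f \<circ> inv_into V \<psi>) (((\<psi> \<circ> p) \<circ> inv_into U \<phi>) z)) has_derivative
    (\<lambda>v. chart_deriv (V, \<psi>) f (p x) (?A v))) (at (\<phi> x) within \<phi> ` (U \<inter> ?G))" .
  then have "((f \<circ> p) \<circ> inv_into U \<phi> has_derivative
    (\<lambda>v. chart_deriv (V, \<psi>) f (p x) (?A v))) (at (\<phi> x) within \<phi> ` (U \<inter> ?G))"
  proof (rule has_derivative_transform[rotated 2])
    show "\<phi> x \<in> \<phi> ` (U \<inter> ?G)" using x xc px by blast
    fix z assume "z \<in> \<phi> ` (U \<inter> ?G)"
    then obtain y where "y \<in> U" "p y \<in> V" "z = \<phi> y" by blast
    then show "(f \<circ> p \<circ> inv_into U \<phi>) z = (f \<circ> inv_into V \<psi>) ((\<psi> \<circ> p \<circ> inv_into U \<phi>) z)"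
      using inv[of y] inv'[of "p y"] by simp
  qed
  from chart_deriv_eqI[OF M c G x _ this v] show "chart_deriv (U, \<phi>) (f \<circ> p) x v = chart_deriv (V, \<psi>) f (p x) (?A v)"
    using xc px by auto
qed

lemma chart_deriv_self:
  assumes M: "smooth_manifold M" and c: "(U, \<phi>) \<in> max_atlas M" and x: "x \<in> U" and v: "v \<in> model M"
  shows "chart_deriv (U, \<phi>) \<phi> x v = v"
proof -
  note ch = max_atlas_chart[OF c]
  have "(\<phi> \<circ> inv_into U \<phi> has_derivative (\<lambda>v. v)) (at (\<phi> x) within \<phi> ` (U \<inter> U))"
    by (rule has_derivative_transform[where f="\<lambda>v. v"]) (use x chartD(3)[OF ch] in \<open>auto simp: f_inv_into_f\<close>)
  from chart_deriv_eqI[OF M c chartD(1)[OF ch] x x this v] show ?thesis .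
qed

lemma chart_deriv_change:
  assumes M: "smooth_manifold M" and c: "(U, \<phi>) \<in> max_atlas M" and d: "(V, \<psi>) \<in> max_atlas M"
    and x: "x \<in> U" "x \<in> V" "x \<in> W" and W: "openin (mtop M) W" and f: "smooth_fun_on M W f" and v: "v \<in> model M"
  shows "chart_deriv (U, \<phi>) f x v = chart_deriv (V, \<psi>) f x (chart_deriv (U, \<phi>) \<psi> x v)"
    and "chart_deriv (U, \<phi>) \<psi> x v \<in> model M"
  using chart_deriv_chain[OF M M smooth_map_ident[OF M] c x(1) d x(2,3) W f v] by (simp_all add: comp_def)

lemma smooth_fun_on_chart_deriv:
  assumes M: "smooth_manifold M" and c: "(U, \<phi>) \<in> max_atlas M" and W: "openin (mtop M) W"
    and f: "smooth_fun_on M W f" and v: "v \<in> model M"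
  shows "smooth_fun_on M (U \<inter> W) (\<lambda>y. chart_deriv (U, \<phi>) f y v)"
proof -
  note ch = max_atlas_chart[OF c]
  have UW: "openin (mtop M) (U \<inter> W)" using chartD(1)[OF ch] W by blast
  have "smooth_fun_on M (U \<inter> W) (\<lambda>y. frechet_derivative (f \<circ> inv_into U \<phi>) (at (\<phi> y) within \<phi> ` (U \<inter> W)) v)"
    by (rule smooth_fun_on_chart[OF M c UW Int_lower1 smooth_on_frechet_derivative[OF subspace_model
      chart_image_open[OF ch UW Int_lower1] smooth_fun_onD[OF M W f c] v]])
  then show ?thesis
    by (rule smooth_fun_on_cong[OF M, rotated])
       (use at_within_chart[OF ch UW Int_lower1] in \<open>simp add: chart_deriv_def\<close>)
qed

section \<open>From fixed charts to the chart selected at each point\<close>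

lemma deriv_at_linear:
  assumes "smooth_manifold M" "openin (mtop M) W" "smooth_fun_on M W f" "x \<in> W"
  shows "linear (deriv_at M f x)"
  using chart_deriv_linear[OF assms(1) chart_at_max[OF assms(1)] assms(2,3)]
    chart_at_atlas(2)[OF assms(1)] openin_subset[OF assms(2)] assms(4)
  by (auto simp: deriv_at_eq_chart_deriv)

lemma deriv_at_cong:
  assumes M: "smooth_manifold M" and W: "openin (mtop M) W" and x: "x \<in> W" and eq: "\<And>y. y \<in> W \<Longrightarrow> f y = g y"
  shows "deriv_at M f x = deriv_at M g x"
proof -
  have xc: "x \<in> carrier M" using openin_subset[OF W] x by blast
  show ?thesis
    using chart_deriv_cong[OF max_atlas_chart[OF chart_at_max[OF M xc]] W chart_at_atlas(2)[OF M xc] x eq]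
    by (simp add: deriv_at_eq_chart_deriv)
qed

lemma tangent_map_linear:
  assumes M: "smooth_manifold M" and N: "smooth_manifold N" and p: "smooth_map M N p" and x: "x \<in> carrier M"
  shows "linear (tangent_map M N p x)"
proof -
  have px: "p x \<in> carrier N" using smooth_map_carrier[OF p x] .
  note cN = chart_at_max[OF N px] chart_at_atlas(2)[OF N px]
  show ?thesis
    using chart_deriv_chain(3)[OF M N p chart_at_max[OF M x] chart_at_atlas(2)[OF M x] cN(1) cN(2) cN(2)
      chartD(1)[OF max_atlas_chart[OF cN(1)]] smooth_fun_on_chart_self[OF N cN(1)] subspace_0[OF subspace_model]]
    by (simp add: tangent_map_def deriv_at_eq_chart_deriv)
qed

lemma tangent_map_in_model:
  assumes M: "smooth_manifold M" and N: "smooth_manifold N" and p: "smooth_map M N p" and x: "x \<in> carrier M"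
    and v: "v \<in> model M"
  shows "tangent_map M N p x v \<in> model N"
proof -
  have px: "p x \<in> carrier N" using smooth_map_carrier[OF p x] .
  note cN = chart_at_max[OF N px] chart_at_atlas(2)[OF N px]
  show ?thesis
    using chart_deriv_chain(2)[OF M N p chart_at_max[OF M x] chart_at_atlas(2)[OF M x] cN(1) cN(2) cN(2)
      chartD(1)[OF max_atlas_chart[OF cN(1)]] smooth_fun_on_chart_self[OF N cN(1)] v]
    by (simp add: tangent_map_def deriv_at_eq_chart_deriv)
qed

lemma deriv_at_chain:
  assumes M: "smooth_manifold M" and N: "smooth_manifold N" and p: "smooth_map M N p" and x: "x \<in> carrier M"
    and W: "openin (mtop N) W" "p x \<in> W" and f: "smooth_fun_on N W f" and v: "v \<in> model M"
  shows "deriv_at M (f \<circ> p) x v = deriv_at N f (p x) (tangent_map M N p x v)"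
proof -
  have px: "p x \<in> carrier N" using smooth_map_carrier[OF p x] .
  show ?thesis
    using chart_deriv_chain(1)[OF M N p chart_at_max[OF M x] chart_at_atlas(2)[OF M x] chart_at_max[OF N px]
        chart_at_atlas(2)[OF N px] W(2,1) f v]
    by (simp add: tangent_map_def deriv_at_eq_chart_deriv)
qed

lemma deriv_at_in_chart:
  assumes M: "smooth_manifold M" and c: "(U, \<phi>) \<in> max_atlas M" and x: "x \<in> U" "x \<in> W"
    and W: "openin (mtop M) W" and f: "smooth_fun_on M W f" and v: "v \<in> model M"
  shows "deriv_at M f x v = chart_deriv (U, \<phi>) f x (deriv_at M \<phi> x v)"
    and "deriv_at M \<phi> x v \<in> model M"
proof -
  have xc: "x \<in> carrier M" using chartD(2)[OF max_atlas_chart[OF c]] x by blast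
  show "deriv_at M f x v = chart_deriv (U, \<phi>) f x (deriv_at M \<phi> x v)" "deriv_at M \<phi> x v \<in> model M"
    using chart_deriv_change[OF M chart_at_max[OF M xc] c chart_at_atlas(2)[OF M xc] x W f v]
    by (simp_all add: deriv_at_eq_chart_deriv)
qed

lemma deriv_at_chart_linear:
  assumes M: "smooth_manifold M" and c: "(U, \<phi>) \<in> max_atlas M" and x: "x \<in> U"
  shows "linear (deriv_at M \<phi> x)"
  by (rule deriv_at_linear[OF M chartD(1)[OF max_atlas_chart[OF c]] smooth_fun_on_chart_self[OF M c] x])

text \<open>The inverse of \<open>deriv_at M \<phi> x\<close> for a chart map \<open>\<phi>\<close>:
  a coordinate vector in the chart \<open>c\<close> is turned into a tangent vector, that is, into
  coordinates of the selected chart.\<close>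

definition chart_vec :: "('a, 'e::euclidean_space) mfd \<Rightarrow> ('a, 'e) chart \<Rightarrow> 'a \<Rightarrow> 'e \<Rightarrow> 'e"
  where "chart_vec M c x = chart_deriv c (snd (chart_at M x)) x"

lemma chart_vec:
  assumes M: "smooth_manifold M" and c: "(U, \<phi>) \<in> max_atlas M" and x: "x \<in> U" and v: "v \<in> model M"
  shows "chart_vec M (U, \<phi>) x v \<in> model M"
    and "deriv_at M \<phi> x (chart_vec M (U, \<phi>) x v) = v"
    and "chart_vec M (U, \<phi>) x (deriv_at M \<phi> x v) = v"
    and "linear (chart_vec M (U, \<phi>) x)"
proof -
  have xc: "x \<in> carrier M" using chartD(2)[OF max_atlas_chart[OF c]] x by blast
  obtain A \<alpha> where A: "chart_at M x = (A, \<alpha>)" by fastforce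
  note ca = chart_at_max[OF M xc, unfolded A fst_conv snd_conv] and xa = chart_at_atlas(2)[OF M xc, unfolded A fst_conv]
  note oA = chartD(1)[OF max_atlas_chart[OF ca]] and oU = chartD(1)[OF max_atlas_chart[OF c]]
  note sA = smooth_fun_on_chart_self[OF M ca] and sU = smooth_fun_on_chart_self[OF M c]
  show "chart_vec M (U, \<phi>) x v \<in> model M"
    using chart_deriv_change(2)[OF M c ca x xa x oU sU v] by (simp add: chart_vec_def A)
  show "deriv_at M \<phi> x (chart_vec M (U, \<phi>) x v) = v"
    using chart_deriv_change(1)[OF M c ca x xa x oU sU v] chart_deriv_self[OF M c x v]
    by (simp add: chart_vec_def A deriv_at_eq_chart_deriv)
  show "chart_vec M (U, \<phi>) x (deriv_at M \<phi> x v) = v"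
    using chart_deriv_change(1)[OF M ca c xa x xa oA sA v] chart_deriv_self[OF M ca xa v]
    by (simp add: chart_vec_def A deriv_at_eq_chart_deriv)
  show "linear (chart_vec M (U, \<phi>) x)"
    using chart_deriv_linear[OF M c oA sA x xa] by (simp add: chart_vec_def A)
qed

section \<open>Differentials and brackets\<close>

lemma mdim_le: "smooth_manifold (M :: ('a, 'e::euclidean_space) mfd) \<Longrightarrow> mdim M \<le> DIM('e)"
  by (rule smooth_manifoldD(1))

lemma sum_coord_vec_in_model: "(\<Sum>i<mdim M. c i *\<^sub>R coord_vec i) \<in> model M"
  unfolding model_def
  by (rule subspace_sum[OF subspace_coord_space], rule subspace_scale[OF subspace_coord_space])
     (simp add: coord_vec_in_coord_space)

lemma coord_vec_in_model: "i < mdim M \<Longrightarrow> coord_vec i \<in> model M"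
  by (simp add: model_def coord_vec_in_coord_space)

lemma model_expansion:
  assumes "smooth_manifold M" "v \<in> model M"
  shows "v = (\<Sum>i<mdim M. (v \<bullet> coord_vec i) *\<^sub>R coord_vec i)"
  using coord_space_expansion[OF mdim_le[OF assms(1)]] assms(2) by (simp add: model_def)

text \<open>The sum is the vector of the model that represents the functional \<open>h\<close> under
  the inner product. Differentials and pulled back covectors both have this form.\<close>

lemma sum_coord_vec_inner:
  assumes M: "smooth_manifold M" and v: "v \<in> model M" and h: "linear h"
  shows "(\<Sum>i<mdim M. h (coord_vec i) *\<^sub>R coord_vec i) \<bullet> v = h v"
proof -
  have "(\<Sum>i<mdim M. h (coord_vec i) *\<^sub>R coord_vec i) \<bullet> v = (\<Sum>i<mdim M. (v \<bullet> coord_vec i) * h (coord_vec i))"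
    unfolding inner_sum_left by (rule sum.cong) (simp_all add: inner_commute)
  also have "\<dots> = h (\<Sum>i<mdim M. (v \<bullet> coord_vec i) *\<^sub>R coord_vec i)"
    by (simp add: linear_sum[OF h] linear_scale[OF h])
  also have "\<dots> = h v" using model_expansion[OF M v] by (rule arg_cong[OF sym])
  finally show ?thesis .
qed

lemma differential_in_model: "differential M f x \<in> model M"
  unfolding differential_def by (rule sum_coord_vec_in_model)

lemma differential_inner:
  assumes M: "smooth_manifold M" and W: "openin (mtop M) W" and f: "smooth_fun_on M W f" and x: "x \<in> W"
    and v: "v \<in> model M"
  shows "differential M f x \<bullet> v = deriv_at M f x v"
  unfolding differential_def by (rule sum_coord_vec_inner[OF M v deriv_at_linear[OF M W f x]])

lemma model_eqI:
  assumes "smooth_manifold M" "v \<in> model M" "w \<in> model M" "\<And>u. u \<in> model M \<Longrightarrow> u \<bullet> v = u \<bullet> w"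
  shows "v = w"
  using coord_space_eqI'[OF mdim_le[OF assms(1)]] assms(2-4) unfolding model_def by blast

lemma cotangent_map_in_model: "cotangent_map M N p x \<xi> \<in> model M"
  unfolding cotangent_map_def by (rule sum_coord_vec_in_model)

lemma cotangent_map_inner:
  assumes M: "smooth_manifold M" and N: "smooth_manifold N" and p: "smooth_map M N p" and x: "x \<in> carrier M"
    and v: "v \<in> model M"
  shows "cotangent_map M N p x \<xi> \<bullet> v = \<xi> \<bullet> tangent_map M N p x v"
proof -
  have "linear (\<lambda>v. \<xi> \<bullet> tangent_map M N p x v)"
    using linear_compose[OF tangent_map_linear[OF M N p x] bounded_linear.linear[OF bounded_linear_inner_right[of \<xi>]]]
    by (simp add: comp_def)
  from sum_coord_vec_inner[OF M v this] show ?thesis by (simp add: cotangent_map_def)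
qed

section \<open>Alternating forms and contraction with a bivector\<close>

lemma sharp_in_model: "sharp M \<pi> x \<xi> \<in> model M"
  unfolding sharp_def by (rule sum_coord_vec_in_model)

lemma alternating_onD:
  assumes "alternating_on E \<beta>" "\<xi> \<in> E" "\<eta> \<in> E" "subspace E"
  shows "\<zeta> \<in> E \<Longrightarrow> \<beta> (a *\<^sub>R \<xi> + b *\<^sub>R \<eta>) \<zeta> = a * \<beta> \<xi> \<zeta> + b * \<beta> \<eta> \<zeta>"
    "\<zeta> \<in> E \<Longrightarrow> \<beta> \<zeta> (a *\<^sub>R \<xi> + b *\<^sub>R \<eta>) = a * \<beta> \<zeta> \<xi> + b * \<beta> \<zeta> \<eta>"
    "\<beta> \<xi> \<eta> = - \<beta> \<eta> \<xi>"
proof -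
  show *: "\<beta> (a *\<^sub>R \<xi> + b *\<^sub>R \<eta>) \<zeta> = a * \<beta> \<xi> \<zeta> + b * \<beta> \<eta> \<zeta>"
    "\<beta> \<zeta> (a *\<^sub>R \<xi> + b *\<^sub>R \<eta>) = a * \<beta> \<zeta> \<xi> + b * \<beta> \<zeta> \<eta>" if "\<zeta> \<in> E" for \<zeta> a b
    using assms that unfolding alternating_on_def by blast+
  have "\<beta> (\<xi> + \<eta>) (\<xi> + \<eta>) = \<beta> \<xi> \<xi> + \<beta> \<xi> \<eta> + (\<beta> \<eta> \<xi> + \<beta> \<eta> \<eta>)"
    using *(1)[of "\<xi> + \<eta>" 1 1] *(2)[of \<xi> 1 1] *(2)[of \<eta> 1 1] assms(2,3) subspace_add[OF assms(4,2,3)] by simp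
  then show "\<beta> \<xi> \<eta> = - \<beta> \<eta> \<xi>"
    using assms(1) subspace_add[OF assms(4,2,3)] assms(2,3) unfolding alternating_on_def by simp
qed

lemma alternating_on_sum:
  assumes a: "alternating_on E \<beta>" and E: "subspace E" and I: "finite I" and e: "\<And>i. i \<in> I \<Longrightarrow> e i \<in> E" and z: "\<zeta> \<in> E"
  shows "\<beta> (\<Sum>i\<in>I. c i *\<^sub>R e i) \<zeta> = (\<Sum>i\<in>I. c i * \<beta> (e i) \<zeta>)"
    and "\<beta> \<zeta> (\<Sum>i\<in>I. c i *\<^sub>R e i) = (\<Sum>i\<in>I. c i * \<beta> \<zeta> (e i))"
proof -
  have "\<beta> (\<Sum>i\<in>I. c i *\<^sub>R e i) \<zeta> = (\<Sum>i\<in>I. c i * \<beta> (e i) \<zeta>) \<and>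
    \<beta> \<zeta> (\<Sum>i\<in>I. c i *\<^sub>R e i) = (\<Sum>i\<in>I. c i * \<beta> \<zeta> (e i))"
    using I e
  proof (induction I rule: finite_induct)
    case empty
    show ?case using alternating_onD(1,2)[OF a subspace_0[OF E] subspace_0[OF E] E z, of 0 0] by simp
  next
    case (insert i I)
    have s: "(\<Sum>i\<in>I. c i *\<^sub>R e i) \<in> E"
      by (rule subspace_sum[OF E], rule subspace_scale[OF E]) (use insert.prems in auto)
    have "e i \<in> E" using insert.prems by auto
    from alternating_onD(1,2)[OF a this s E z, of "c i" 1] show ?case using insert by simp
  qed
  then show "\<beta> (\<Sum>i\<in>I. c i *\<^sub>R e i) \<zeta> = (\<Sum>i\<in>I. c i * \<beta> (e i) \<zeta>)"
    "\<beta> \<zeta> (\<Sum>i\<in>I. c i *\<^sub>R e i) = (\<Sum>i\<in>I. c i * \<beta> \<zeta> (e i))" by auto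
qed

lemma sharp_inner:
  assumes M: "smooth_manifold M" and a: "alternating_on (model M) (\<pi> x)" and "\<xi> \<in> model M" "\<eta> \<in> model M"
  shows "\<eta> \<bullet> sharp M \<pi> x \<xi> = \<pi> x \<xi> \<eta>"
proof -
  have "\<eta> \<bullet> sharp M \<pi> x \<xi> = (\<Sum>i<mdim M. (\<eta> \<bullet> coord_vec i) * \<pi> x \<xi> (coord_vec i))"
    unfolding sharp_def inner_sum_right by (rule sum.cong) simp_all
  also have "\<dots> = \<pi> x \<xi> (\<Sum>i<mdim M. (\<eta> \<bullet> coord_vec i) *\<^sub>R coord_vec i)"
    using alternating_on_sum(2)[OF a subspace_model, of "{..<mdim M}" coord_vec \<xi> "\<lambda>i. \<eta> \<bullet> coord_vec i"]
      coord_vec_in_model[of _ M] assms(3) by simp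
  finally show ?thesis unfolding model_expansion[OF M assms(4), symmetric] .
qed

lemma differential_coord_inner:
  assumes M: "smooth_manifold M" and c: "(U, \<phi>) \<in> max_atlas M" and x: "x \<in> U" and v: "v \<in> model M"
  shows "differential M (\<lambda>y. \<phi> y \<bullet> coord_vec i) x \<bullet> v = deriv_at M \<phi> x v \<bullet> coord_vec i"
proof -
  note oU = chartD(1)[OF max_atlas_chart[OF c]] and sU = smooth_fun_on_chart_self[OF M c]
  have s: "smooth_fun_on M U (\<lambda>y. \<phi> y \<bullet> coord_vec i)"
    by (rule smooth_fun_on_bounded_linear[OF bounded_linear_inner_left sU])
  have w: "deriv_at M \<phi> x v \<in> model M" using deriv_at_in_chart(2)[OF M c x x oU sU v] .
  have "((\<lambda>y. \<phi> y \<bullet> coord_vec i) \<circ> inv_into U \<phi> has_derivative (\<lambda>h. h \<bullet> coord_vec i)) (at (\<phi> x) within \<phi> ` (U \<inter> U))"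
    by (rule has_derivative_transform[where f="\<lambda>z. z \<bullet> coord_vec i"])
       (use x in \<open>auto simp: f_inv_into_f chartD(3)[OF max_atlas_chart[OF c]] intro!: derivative_eq_intros\<close>)
  from chart_deriv_eqI[OF M c oU x x this w]
  show ?thesis using differential_inner[OF M oU s x v] deriv_at_in_chart(1)[OF M c x x oU s v] by simp
qed

text \<open>The differentials of the chart coordinates form a coframe, in which the coefficients of
  a differential are the partial derivatives in the fixed chart. This expansion brings the
  coordinate brackets into play.\<close>

lemma differential_in_chart:
  assumes M: "smooth_manifold M" and c: "(U, \<phi>) \<in> max_atlas M" and x: "x \<in> U" "x \<in> W"
    and W: "openin (mtop M) W" and f: "smooth_fun_on M W f"
  shows "differential M f x =
    (\<Sum>i<mdim M. chart_deriv (U, \<phi>) f x (coord_vec i) *\<^sub>R differential M (\<lambda>y. \<phi> y \<bullet> coord_vec i) x)"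
proof (rule model_eqI[OF M differential_in_model])
  show "(\<Sum>i<mdim M. chart_deriv (U, \<phi>) f x (coord_vec i) *\<^sub>R differential M (\<lambda>y. \<phi> y \<bullet> coord_vec i) x) \<in> model M"
    by (rule subspace_sum[OF subspace_model], rule subspace_scale[OF subspace_model]) (rule differential_in_model)
  fix v assume v: "v \<in> model M"
  let ?w = "deriv_at M \<phi> x v"
  have w: "?w \<in> model M" using deriv_at_in_chart(2)[OF M c x W f v] .
  have lin: "linear (chart_deriv (U, \<phi>) f x)" using chart_deriv_linear[OF M c W f x] .
  note e = differential_coord_inner[OF M c x(1) v]
  have "differential M f x \<bullet> v = chart_deriv (U, \<phi>) f x ?w"
    using differential_inner[OF M W f x(2) v] deriv_at_in_chart(1)[OF M c x W f v] by simp
  also have "\<dots> = chart_deriv (U, \<phi>) f x (\<Sum>i<mdim M. (?w \<bullet> coord_vec i) *\<^sub>R coord_vec i)"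
    using model_expansion[OF M w] by (rule arg_cong)
  also have "\<dots> = (\<Sum>i<mdim M. (?w \<bullet> coord_vec i) * chart_deriv (U, \<phi>) f x (coord_vec i))"
    by (simp add: linear_sum[OF lin] linear_scale[OF lin])
  also have "\<dots> = (\<Sum>i<mdim M. chart_deriv (U, \<phi>) f x (coord_vec i) *\<^sub>R differential M (\<lambda>y. \<phi> y \<bullet> coord_vec i) x) \<bullet> v"
    unfolding inner_sum_left by (rule sum.cong) (simp_all add: e)
  finally show "v \<bullet> differential M f x = v \<bullet> (\<Sum>i<mdim M. chart_deriv (U, \<phi>) f x (coord_vec i) *\<^sub>R differential M (\<lambda>y. \<phi> y \<bullet> coord_vec i) x)"
    by (simp add: inner_commute)
qed

lemma smooth_bivector_alternating:
  "smooth_bivector M \<pi> \<Longrightarrow> x \<in> carrier M \<Longrightarrow> alternating_on (model M) (\<pi> x)"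
  by (simp add: smooth_bivector_def cotangent_space_def)

text \<open>Smoothness of a bivector is given for brackets of coordinate functions. Expanding both
  differentials in coordinate differentials writes any bracket as a sum of products of partial
  derivatives and coordinate brackets.\<close>

lemma smooth_fun_on_bracket:
  assumes M: "smooth_manifold M" and b: "smooth_bivector M \<pi>" and W: "openin (mtop M) W"
    and f: "smooth_fun_on M W f" and g: "smooth_fun_on M W g"
  shows "smooth_fun_on M W (bracket M \<pi> f g)"
proof (rule smooth_fun_on_local[OF M W])
  fix x assume x: "x \<in> W"
  obtain U \<phi> where U: "(U, \<phi>) \<in> atlas M" "(U, \<phi>) \<in> max_atlas M" "x \<in> U"
    using atlas_cover[OF M] openin_subset[OF W] x by blast
  note oU = chartD(1)[OF max_atlas_chart[OF U(2)]] and UM = chartD(2)[OF max_atlas_chart[OF U(2)]]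
  have oUW: "openin (mtop M) (U \<inter> W)" using oU W by blast
  let ?d = "\<lambda>i. differential M (\<lambda>y. \<phi> y \<bullet> coord_vec i)"
  let ?b = "\<lambda>i j. bracket M \<pi> (\<lambda>y. \<phi> y \<bullet> coord_vec i) (\<lambda>y. \<phi> y \<bullet> coord_vec j)"
  have eq: "(\<Sum>i<mdim M. \<Sum>j<mdim M. chart_deriv (U, \<phi>) f y (coord_vec i) * (chart_deriv (U, \<phi>) g y (coord_vec j) * ?b i j y))
      = bracket M \<pi> f g y" if y: "y \<in> U \<inter> W" for y
  proof -
    have a: "alternating_on (model M) (\<pi> y)" using smooth_bivector_alternating[OF b] UM y by blast
    have df: "differential M f y = (\<Sum>i<mdim M. chart_deriv (U, \<phi>) f y (coord_vec i) *\<^sub>R ?d i y)"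
      using differential_in_chart[OF M U(2) _ _ W f] y by simp
    have dg: "differential M g y = (\<Sum>j<mdim M. chart_deriv (U, \<phi>) g y (coord_vec j) *\<^sub>R ?d j y)"
      using differential_in_chart[OF M U(2) _ _ W g] y by simp
    have "bracket M \<pi> f g y = (\<Sum>i<mdim M. chart_deriv (U, \<phi>) f y (coord_vec i) * \<pi> y (?d i y) (differential M g y))"
      unfolding bracket_def df
      by (rule alternating_on_sum(1)[OF a subspace_model]) (auto simp: differential_in_model)
    also have "\<dots> = (\<Sum>i<mdim M. chart_deriv (U, \<phi>) f y (coord_vec i) *
        (\<Sum>j<mdim M. chart_deriv (U, \<phi>) g y (coord_vec j) * \<pi> y (?d i y) (?d j y)))"
      unfolding dg
      by (subst alternating_on_sum(2)[OF a subspace_model]) (auto simp: differential_in_model)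
    finally show ?thesis by (simp add: sum_distrib_left bracket_def)
  qed
  have bs: "smooth_fun_on M (U \<inter> W) (?b i j)" if "i < mdim M" "j < mdim M" for i j
    using b U(1) that unfolding smooth_bivector_def by (blast intro: smooth_fun_on_subset)
  have "smooth_fun_on M (U \<inter> W) (\<lambda>y. \<Sum>i<mdim M. \<Sum>j<mdim M. chart_deriv (U, \<phi>) f y (coord_vec i) * 
      (chart_deriv (U, \<phi>) g y (coord_vec j) * ?b i j y))"
    by (intro smooth_fun_on_sum smooth_fun_on_bilinear[OF bounded_bilinear_mult] smooth_fun_on_chart_deriv[OF M U(2) W] f g
      coord_vec_in_model bs) auto
  then have "smooth_fun_on M (U \<inter> W) (bracket M \<pi> f g)"
    by (rule smooth_fun_on_cong[OF M, rotated]) (rule eq)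
  then show "\<exists>G. openin (mtop M) G \<and> x \<in> G \<and> smooth_fun_on M G (bracket M \<pi> f g)"
    using oUW x U(3) by blast
qed

section \<open>New charts and extension by bump functions\<close>

text \<open>The source of adapted charts: a smooth change of coordinates with injective derivative
  at one point becomes, near that point, part of a chart of the maximal atlas. Compatibility uses
  \<open>g\<close> in one direction and its local inverse \<open>h\<close> in the other.\<close>

lemma max_atlas_compose_local_diffeo:
  assumes M: "smooth_manifold M" and c: "(U, \<phi>) \<in> max_atlas M" and W: "openin (mtop M) W" "W \<subseteq> U" and x: "x \<in> W"
    and g: "smooth_on (model M) (\<phi> ` W) g" and gm: "g ` \<phi> ` W \<subseteq> model M"
    and inj: "\<And>v. v \<in> model M \<Longrightarrow> frechet_derivative g (at (\<phi> x) within \<phi> ` W) v = 0 \<Longrightarrow> v = 0"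
  shows "\<exists>G. openin (mtop M) G \<and> x \<in> G \<and> G \<subseteq> W \<and> (G, g \<circ> \<phi>) \<in> max_atlas M"
proof -
  note ch = max_atlas_chart[OF c]
  note oW = chart_image_open[OF ch W]
  obtain T h where T: "openin (top_of_set (model M)) T" "\<phi> x \<in> T" "T \<subseteq> \<phi> ` W"
    "openin (top_of_set (model M)) (g ` T)" and hg: "\<forall>z\<in>T. h (g z) = z" and h: "smooth_on (model M) (g ` T) h"
    using smooth_inverse_function[OF mdim_le[OF M] oW[unfolded model_def] g[unfolded model_def] gm[unfolded model_def]
        imageI[OF x] inj[unfolded model_def]] unfolding model_def by auto
  define G where "G = {y\<in>U. \<phi> y \<in> T}"
  have oG: "openin (mtop M) G" unfolding G_def by (rule chart_preimage_open[OF ch T(1)])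
  have GW: "G \<subseteq> W"
  proof
    fix y assume y: "y \<in> G"
    then obtain w where w: "w \<in> W" "\<phi> y = \<phi> w" using T(3) by (auto simp: G_def)
    then have "y = w" using inj_onD[OF chartD(3)[OF ch], of y w] y W(2) by (auto simp: G_def)
    then show "y \<in> W" using w by simp
  qed
  have GU: "G \<subseteq> U" by (auto simp: G_def)
  have phG: "\<phi> ` G = T" using T(3) W(2) by (force simp: G_def)
  have TM: "T \<subseteq> model M" using openin_subset[OF T(1)] by simp
  have im: "(g \<circ> \<phi>) ` V = g ` \<phi> ` V" for V by (simp add: image_comp)
  have "homeomorphic_map (subtopology (subtopology (mtop M) U) G) (subtopology (top_of_set (\<phi> ` U)) T) \<phi>"
    by (rule homeomorphic_map_subtopologies[OF chartD(6)[OF ch]])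
       (use phG GU chartD(2)[OF ch] in \<open>auto simp: G_def\<close>)
  moreover have "\<phi> ` U \<inter> T = T" using phG GU by auto
  ultimately have h1: "homeomorphic_map (subtopology (mtop M) G) (top_of_set T) \<phi>"
    using GU by (simp add: subtopology_subtopology Int_absorb1)
  have "continuous_on T g"
    by (rule continuous_on_subset[OF smooth_on_continuous[OF g]]) (use T(3) in auto)
  then have h2: "homeomorphic_map (top_of_set T) (top_of_set (g ` T)) g"
    unfolding homeomorphic_map_maps homeomorphic_maps_def using hg smooth_on_continuous[OF h]
    by (intro exI[of _ h]) (auto simp: continuous_map_in_subtopology image_subset_iff)
  have chG: "is_chart M (G, g \<circ> \<phi>)"
    using homeomorphic_map_compose[OF h1 h2] oG T(4) unfolding is_chart_def case_prod_conv im phG by blast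
  have invG: "inv_into G (g \<circ> \<phi>) (g (\<phi> y)) = y" if "y \<in> G" for y
    using inv_into_f_f[OF chartD(3)[OF chG] that] by simp
  have invU: "inv_into U \<phi> (\<phi> y) = y" if "y \<in> U" for y
    using inv_into_f_f[OF chartD(3)[OF ch] that] .
  have tr: "smooth_transition M (G, g \<circ> \<phi>) d" "smooth_transition M d (G, g \<circ> \<phi>)" if d: "d \<in> atlas M" for d
  proof -
    obtain V \<psi> where V: "d = (V, \<psi>)" by fastforce
    note chV = smooth_manifoldD(4)[OF M d[unfolded V]] and mV = smooth_manifoldD(7)[OF M d[unfolded V]]
    have oGV: "openin (mtop M) (G \<inter> V)" using oG chartD(1)[OF chV] by blast
    have invV: "inv_into V \<psi> (\<psi> y) = y" if "y \<in> V" for y using inv_into_f_f[OF chartD(3)[OF chV] that] .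
    have hy: "h (g (\<phi> y)) = \<phi> y" if "y \<in> G" for y using hg that by (simp add: G_def)
    have "smooth_on (model M) ((g \<circ> \<phi>) ` (G \<inter> V)) (\<lambda>z. (\<psi> \<circ> inv_into U \<phi>) (h z))"
    proof (rule smooth_on_compose[OF subspace_model chart_image_open[OF chG oGV] subspace_model,
        where f=h and g="\<psi> \<circ> inv_into U \<phi>" and T="\<phi> ` (U \<inter> V)"])
      show "smooth_on (model M) ((g \<circ> \<phi>) ` (G \<inter> V)) h" by (rule smooth_on_subset[OF h]) (use phG in auto)
      show "smooth_on (model M) (\<phi> ` (U \<inter> V)) (\<psi> \<circ> inv_into U \<phi>)" by (rule max_atlas_transition[OF M c mV])
      show "\<phi> ` (U \<inter> V) \<subseteq> model M" using chartD(5)[OF ch] by auto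
      show "h ` (g \<circ> \<phi>) ` (G \<inter> V) \<subseteq> \<phi> ` (U \<inter> V)" using hy GU by auto
    qed auto
    then have "smooth_on (model M) ((g \<circ> \<phi>) ` (G \<inter> V)) (\<psi> \<circ> inv_into G (g \<circ> \<phi>))"
      by (rule iffD1[OF smooth_on_cong, rotated]) (use hy invG invU GU in auto)
    then show "smooth_transition M (G, g \<circ> \<phi>) d" by (simp add: smooth_transition_def V)
    have "smooth_on (model M) (\<psi> ` (V \<inter> G)) (\<lambda>z. g ((\<phi> \<circ> inv_into V \<psi>) z))"
    proof (rule smooth_on_compose[OF subspace_model _ subspace_model, where f="\<phi> \<circ> inv_into V \<psi>" and g=g and T=T])
      show "openin (top_of_set (model M)) (\<psi> ` (V \<inter> G))"
        by (rule chart_image_open[OF chV]) (use oGV in \<open>simp_all add: Int_commute\<close>)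
      show "smooth_on (model M) (\<psi> ` (V \<inter> G)) (\<phi> \<circ> inv_into V \<psi>)"
        by (rule smooth_on_subset[OF max_atlas_transition[OF M mV c]]) (use GU in auto)
      show "smooth_on (model M) T g" by (rule smooth_on_subset[OF g T(3) order_refl])
      show "(\<phi> \<circ> inv_into V \<psi>) ` \<psi> ` (V \<inter> G) \<subseteq> T" using invV by (auto simp: G_def)
    qed (fact TM)
    then show "smooth_transition M d (G, g \<circ> \<phi>)" by (simp add: smooth_transition_def V comp_def)
  qed
  have "(G, g \<circ> \<phi>) \<in> max_atlas M" unfolding max_atlas_def using chG tr by auto
  moreover have "x \<in> G" using T(2) x W(2) by (auto simp: G_def)
  ultimately show ?thesis using oG GW by blast
qed

text \<open>The Jacobi identity speaks of functions smooth on the whole carrier, so a local function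
  is replaced by a global one that agrees with it near \<open>x\<close>. The product with a bump
  function is continued by zero; this is smooth because the compact set \<open>C\<close> is closed,
  which comes from the Hausdorff property.\<close>

lemma smooth_fun_extend_global:
  fixes M :: "('a, 'e::euclidean_space) mfd" and F :: "'a \<Rightarrow> real"
  assumes M: "smooth_manifold M" and W: "openin (mtop M) W" and F: "smooth_fun_on M W F" and x: "x \<in> W"
  shows "\<exists>F' G. openin (mtop M) G \<and> x \<in> G \<and> G \<subseteq> W \<and> smooth_fun_on M (carrier M) F' \<and> (\<forall>y\<in>G. F' y = F y)"
proof -
  obtain U \<phi> where c: "(U, \<phi>) \<in> atlas M" "(U, \<phi>) \<in> max_atlas M" "x \<in> U"
    using atlas_cover[OF M] openin_subset[OF W] x by blast
  note ch = max_atlas_chart[OF c(2)]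
  have oUW: "openin (mtop M) (U \<inter> W)" using chartD(1)[OF ch] W by blast
  have oim: "openin (top_of_set (model M)) (\<phi> ` (U \<inter> W))" by (rule chart_image_open[OF ch oUW]) auto
  obtain A where A: "open A" "\<phi> ` (U \<inter> W) = model M \<inter> A" using oim by (auto simp: openin_open)
  have "\<phi> x \<in> A" using A c x by blast
  then obtain e where e: "e > 0" "cball (\<phi> x) e \<subseteq> A" using A(1) open_contains_cball by blast
  define K where "K = model M \<inter> cball (\<phi> x) e"
  have K: "compact K" unfolding K_def
    using closed_Int_compact[OF closed_subspace[OF subspace_model] compact_cball] .
  have KU: "K \<subseteq> \<phi> ` (U \<inter> W)" using A e by (auto simp: K_def)
  define C where "C = {y\<in>U. \<phi> y \<in> K}"
  have phC: "\<phi> ` C = K" using KU by (auto simp: C_def)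
  have "compactin (top_of_set (\<phi> ` U)) (\<phi> ` C)" unfolding phC using K KU by (auto simp: compactin_subtopology)
  then have "compactin (subtopology (mtop M) U) C"
    using homeomorphic_map_compactness[OF chartD(6)[OF ch], of C] chartD(2)[OF ch] by (auto simp: C_def)
  then have clC: "closedin (mtop M) C"
    using compactin_imp_closedin[OF smooth_manifoldD(2)[OF M]] by (simp add: compactin_subtopology)
  have CUW: "C \<subseteq> U \<inter> W"
  proof
    fix y assume y: "y \<in> C"
    then obtain w where w: "w \<in> U \<inter> W" "\<phi> y = \<phi> w" using KU by (auto simp: C_def)
    then have "y = w" using inj_onD[OF chartD(3)[OF ch], of y w] y by (auto simp: C_def)
    then show "y \<in> U \<inter> W" using w by simp
  qed
  \<comment> \<open>With parameter \<open>e/2\<close> the bump is 1 up to distance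
    \<open>e/2\<close> and 0 from distance \<open>e\<close> on, hence 0 at all points of the model
    outside \<open>K\<close>.\<close>
  obtain b :: "'e \<Rightarrow> real" where b: "smooth_on UNIV UNIV b" "\<And>z. dist z (\<phi> x) \<le> e/2 \<Longrightarrow> b z = 1" 
    "\<And>z. 2 * (e/2) \<le> dist z (\<phi> x) \<Longrightarrow> b z = 0"
    using smooth_bump_exists[of "e/2" "\<phi> x"] e(1) by auto
  define F' where "F' y = (if y \<in> U \<inter> W then b (\<phi> y) * F y else 0)" for y
  have "smooth_fun_on M (carrier M) F'"
  proof (rule smooth_fun_on_local[OF M openin_topspace])
    fix y assume y: "y \<in> carrier M"
    show "\<exists>G. openin (mtop M) G \<and> y \<in> G \<and> smooth_fun_on M G F'"
    proof (cases "y \<in> U \<inter> W")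
      case True
      have "smooth_fun_on M (U \<inter> W) (\<lambda>y. b (\<phi> y) * F y)"
        by (intro smooth_fun_on_bilinear[OF bounded_bilinear_mult] smooth_fun_on_chart[OF M c(2) oUW]
            smooth_fun_on_subset[OF F] smooth_on_subset[OF b(1)]) auto
      then have "smooth_fun_on M (U \<inter> W) F'" by (rule smooth_fun_on_cong[OF M, rotated]) (simp add: F'_def)
      then show ?thesis using True oUW by blast
    next
      case False
      have "smooth_fun_on M (carrier M - C) F'"
      proof (rule smooth_fun_on_cong[OF M _ smooth_fun_on_const[of _ _ 0]])
        fix z assume z: "z \<in> carrier M - C"
        show "0 = F' z"
        proof (cases "z \<in> U \<inter> W")
          case True
          then have "\<phi> z \<notin> K" using z by (auto simp: C_def)
          moreover have "\<phi> z \<in> model M" using True chartD(5)[OF ch] by auto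
          ultimately have "b (\<phi> z) = 0" by (intro b(3)) (auto simp: K_def dist_commute)
          then show ?thesis by (simp add: F'_def)
        next
          case False then show ?thesis unfolding F'_def by (simp only: if_False)
        qed
      qed
      moreover have "openin (mtop M) (carrier M - C)" using clC by (simp add: openin_diff)
      ultimately show ?thesis using False CUW y by blast
    qed
  qed
  moreover define G where "G = {y\<in>U. \<phi> y \<in> model M \<inter> ball (\<phi> x) (e/2)}"
  have "openin (mtop M) G" unfolding G_def by (rule chart_preimage_open[OF ch]) (simp add: openin_open_Int)
  moreover have GC: "G \<subseteq> C" using e(1) by (auto simp: G_def C_def K_def)
  moreover have "x \<in> G" using c(3) chartD(5)[OF ch] e(1) by (auto simp: G_def)
  moreover have "F' y = F y" if "y \<in> G" for y
    using b(2)[of "\<phi> y"] that GC CUW by (auto simp: F'_def G_def dist_commute)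
  ultimately show ?thesis using CUW by (intro exI[of _ F'] exI[of _ G]) auto
qed

section \<open>Embedded submanifolds as manifolds\<close>

lemma embedded_submfd_dim: "embedded_submanifold M X \<Longrightarrow> embedded_of_dim M X (submfd_dim M X)"
  unfolding embedded_submanifold_def submfd_dim_def by (rule LeastI_ex)

lemma embedded_subset: "embedded_submanifold M X \<Longrightarrow> X \<subseteq> carrier M"
  unfolding embedded_submanifold_def embedded_of_dim_def by blast

lemma submfd_dim_le: "embedded_submanifold M X \<Longrightarrow> submfd_dim M X \<le> mdim M"
  using embedded_submfd_dim unfolding embedded_of_dim_def by blast

lemma submfd_simps [simp]:
  "mtop (submfd M X) = subtopology (mtop M) X" "mdim (submfd M X) = submfd_dim M X"
  "model (submfd M X) = coord_space (submfd_dim M X)"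
  by (simp_all add: submfd_def model_def)

lemma carrier_submfd: "embedded_submanifold M X \<Longrightarrow> carrier (submfd M X) = X"
  using embedded_subset[of M X] by (simp add: Int_absorb1)

lemma slice_chart_cover:
  assumes "embedded_submanifold M X" "x \<in> X"
  obtains U \<phi> where "(U, \<phi>) \<in> slice_charts M X (submfd_dim M X)" "x \<in> U"
  using embedded_submfd_dim[OF assms(1)] assms(2) unfolding embedded_of_dim_def by fastforce

lemma slice_chartD:
  assumes "(U, \<phi>) \<in> slice_charts M X k"
  shows "(U, \<phi>) \<in> max_atlas M" "\<phi> ` (U \<inter> X) = \<phi> ` U \<inter> coord_space k" "is_chart M (U, \<phi>)"
    "y \<in> U \<Longrightarrow> \<phi> y \<in> coord_space k \<longleftrightarrow> y \<in> X"
proof -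
  show 1: "(U, \<phi>) \<in> max_atlas M" "\<phi> ` (U \<inter> X) = \<phi> ` U \<inter> coord_space k"
    using assms by (auto simp: slice_charts_def)
  then show 2: "is_chart M (U, \<phi>)" by (simp add: max_atlas_chart)
  show "\<phi> y \<in> coord_space k \<longleftrightarrow> y \<in> X" if "y \<in> U"
  proof
    assume "\<phi> y \<in> coord_space k"
    then have "\<phi> y \<in> \<phi> ` (U \<inter> X)" using that 1(2) by blast
    then obtain w where "w \<in> U \<inter> X" "\<phi> y = \<phi> w" by blast
    then show "y \<in> X" using inj_onD[OF chartD(3)[OF 2], of y w] that by auto
  next
    assume "y \<in> X" then show "\<phi> y \<in> coord_space k" using 1(2) that by blast
  qed
qed

lemma submfd_atlasI:
  "(U, \<phi>) \<in> slice_charts M X (submfd_dim M X) \<Longrightarrow> (U \<inter> X, \<phi>) \<in> atlas (submfd M X)"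
  unfolding submfd_def by force

lemma submfd_atlasE:
  assumes "(A, \<phi>) \<in> atlas (submfd M X)"
  obtains U where "A = U \<inter> X" "(U, \<phi>) \<in> slice_charts M X (submfd_dim M X)"
  using assms unfolding submfd_def by auto

lemma slice_inv_into:
  assumes "is_chart M (U, \<phi>)" "z \<in> \<phi> ` (U \<inter> X)"
  shows "inv_into (U \<inter> X) \<phi> z = inv_into U \<phi> z"
proof -
  obtain y where y: "y \<in> U \<inter> X" "z = \<phi> y" using assms(2) by blast
  have "inj_on \<phi> (U \<inter> X)" using chartD(3)[OF assms(1)] by (rule inj_on_subset) auto
  then show ?thesis using y inv_into_f_f[OF chartD(3)[OF assms(1)], of y] by simp
qed

lemma slice_transition:
  assumes M: "smooth_manifold M" and X: "embedded_submanifold M X"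
    and c: "(U, \<phi>) \<in> slice_charts M X (submfd_dim M X)" and d: "(V, \<psi>) \<in> max_atlas M"
  shows "smooth_on (coord_space (submfd_dim M X)) (\<phi> ` (U \<inter> X \<inter> V)) (\<psi> \<circ> inv_into (U \<inter> X) \<phi>)"
proof -
  have "smooth_on (coord_space (submfd_dim M X)) (\<phi> ` (U \<inter> X \<inter> V)) (\<psi> \<circ> inv_into U \<phi>)"
    by (rule smooth_on_subset[OF max_atlas_transition[OF M slice_chartD(1)[OF c] d]])
       (use coord_space_mono[OF submfd_dim_le[OF X]] in \<open>auto simp: model_def\<close>)
  then show ?thesis
    by (rule iffD1[OF smooth_on_cong, rotated]) (auto simp: slice_inv_into[OF slice_chartD(3)[OF c]])
qed

lemma smooth_manifold_submfd:
  assumes M: "smooth_manifold M" and X: "embedded_submanifold M X"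
  shows "smooth_manifold (submfd M X)"
  unfolding smooth_manifold_def
proof (intro conjI ballI)
  let ?k = "submfd_dim M X"
  show "mdim (submfd M X) \<le> DIM('b)" using submfd_dim_le[OF X] mdim_le[OF M] by simp
  show "Hausdorff_space (mtop (submfd M X))" using smooth_manifoldD(2)[OF M] by (simp add: Hausdorff_space_subtopology)
  show "second_countable (mtop (submfd M X))" using smooth_manifoldD(3)[OF M] by (simp add: second_countable_subtopology)
  show "is_chart (submfd M X) c" if c': "c \<in> atlas (submfd M X)" for c
  proof -
    obtain A \<phi> where A: "c = (A, \<phi>)" by fastforce
    obtain U where "A = U \<inter> X" "(U, \<phi>) \<in> slice_charts M X ?k" using c'[unfolded A] by (rule submfd_atlasE)
    then have c: "c = (U \<inter> X, \<phi>)" "(U, \<phi>) \<in> slice_charts M X ?k" using A by auto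
    note ch = slice_chartD(3)[OF c(2)]
    have oU: "openin (subtopology (mtop M) X) (U \<inter> X)" using chartD(1)[OF ch] by (auto simp: openin_subtopology)
    have "homeomorphic_map (subtopology (subtopology (mtop M) U) (U \<inter> X)) (subtopology (top_of_set (\<phi> ` U)) (\<phi> ` (U \<inter> X))) \<phi>"
      by (rule homeomorphic_map_subtopologies[OF chartD(6)[OF ch]]) (use chartD(2)[OF ch] in auto)
    moreover have "subtopology (subtopology (mtop M) U) (U \<inter> X) = subtopology (subtopology (mtop M) X) (U \<inter> X)"
      by (simp add: subtopology_subtopology Int_ac)
    moreover have "subtopology (top_of_set (\<phi> ` U)) (\<phi> ` (U \<inter> X)) = top_of_set (\<phi> ` (U \<inter> X))"
      by (simp add: subtopology_subtopology) (metis image_mono inf.absorb2 inf_le1)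
    ultimately have hom: "homeomorphic_map (subtopology (subtopology (mtop M) X) (U \<inter> X)) (top_of_set (\<phi> ` (U \<inter> X))) \<phi>" by simp
    obtain A where A: "open A" "\<phi> ` U = model M \<inter> A" using chartD(4)[OF ch] by (auto simp: openin_open)
    have "\<phi> ` (U \<inter> X) = coord_space ?k \<inter> A"
      using slice_chartD(2)[OF c(2)] A(2) coord_space_mono[OF submfd_dim_le[OF X]] by (auto simp: model_def)
    then have "openin (top_of_set (coord_space ?k)) (\<phi> ` (U \<inter> X))" using A(1) by (simp add: openin_open_Int)
    then show ?thesis using oU hom by (simp add: is_chart_def c(1))
  qed
  show "carrier (submfd M X) = (\<Union>c\<in>atlas (submfd M X). fst c)"
  proof
    show "carrier (submfd M X) \<subseteq> (\<Union>c\<in>atlas (submfd M X). fst c)"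
    proof
      fix x assume "x \<in> carrier (submfd M X)"
      then have x: "x \<in> X" by simp
      obtain U \<phi> where U: "(U, \<phi>) \<in> slice_charts M X ?k" "x \<in> U" using slice_chart_cover[OF X x] by metis
      then have "(U \<inter> X, \<phi>) \<in> atlas (submfd M X)" by (intro submfd_atlasI)
      then show "x \<in> (\<Union>c\<in>atlas (submfd M X). fst c)" using U(2) x by force
    qed
    show "(\<Union>c\<in>atlas (submfd M X). fst c) \<subseteq> carrier (submfd M X)"
      using embedded_subset[OF X] by (auto elim!: submfd_atlasE)
  qed
  show "smooth_transition (submfd M X) c d" if cd: "c \<in> atlas (submfd M X)" "d \<in> atlas (submfd M X)" for c d
  proof -
    obtain A \<phi> where A: "c = (A, \<phi>)" by fastforce
    obtain U where "A = U \<inter> X" "(U, \<phi>) \<in> slice_charts M X ?k" using cd(1)[unfolded A] by (rule submfd_atlasE)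
    then have c: "c = (U \<inter> X, \<phi>)" "(U, \<phi>) \<in> slice_charts M X ?k" using A by auto
    obtain B \<psi> where B: "d = (B, \<psi>)" by fastforce
    obtain V where "B = V \<inter> X" "(V, \<psi>) \<in> slice_charts M X ?k" using cd(2)[unfolded B] by (rule submfd_atlasE)
    then have d: "d = (V \<inter> X, \<psi>)" "(V, \<psi>) \<in> slice_charts M X ?k" using B by auto
    have "smooth_on (coord_space ?k) (\<phi> ` (U \<inter> X \<inter> (V \<inter> X))) (\<psi> \<circ> inv_into (U \<inter> X) \<phi>)"
      by (rule smooth_on_subset[OF slice_transition[OF M X c(2) slice_chartD(1)[OF d(2)]]]) auto
    then show ?thesis by (simp add: smooth_transition_def c(1) d(1))
  qed
qed

lemma slice_chart_submfd_atlas: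
  assumes M: "smooth_manifold M" and X: "embedded_submanifold M X"
    and c: "(U, \<phi>) \<in> slice_charts M X (submfd_dim M X)"
  shows "(U \<inter> X, \<phi>) \<in> atlas (submfd M X)" "(U \<inter> X, \<phi>) \<in> max_atlas (submfd M X)"
  using submfd_atlasI[OF c] smooth_manifoldD(7)[OF smooth_manifold_submfd[OF M X] submfd_atlasI[OF c]] by auto

lemma smooth_map_incl:
  assumes M: "smooth_manifold M" and X: "embedded_submanifold M X"
  shows "smooth_map (submfd M X) M (\<lambda>x. x)"
proof (rule smooth_mapI[OF smooth_manifold_submfd[OF M X]])
  show "continuous_map (mtop (submfd M X)) (mtop M) (\<lambda>x. x)" by (simp add: continuous_map_from_subtopology)
  fix W \<psi> assume W: "(W, \<psi>) \<in> atlas M"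
  show "smooth_fun_on (submfd M X) {x\<in>carrier (submfd M X). x \<in> W} (\<psi> \<circ> (\<lambda>x. x))"
    unfolding smooth_fun_on_def
  proof (clarify)
    fix A \<phi> assume "(A, \<phi>) \<in> atlas (submfd M X)"
    then obtain U where U: "A = U \<inter> X" "(U, \<phi>) \<in> slice_charts M X (submfd_dim M X)" by (rule submfd_atlasE)
    have "smooth_on (coord_space (submfd_dim M X)) (\<phi> ` (A \<inter> {x\<in>carrier (submfd M X). x \<in> W})) (\<psi> \<circ> inv_into (U \<inter> X) \<phi>)"
      by (rule smooth_on_subset[OF slice_transition[OF M X U(2) smooth_manifoldD(7)[OF M W]]]) (use U in auto)
    then show "smooth_on (model (submfd M X)) (\<phi> ` (A \<inter> {x\<in>carrier (submfd M X). x \<in> W})) (\<psi> \<circ> (\<lambda>x. x) \<circ> inv_into A \<phi>)"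
      using U(1) by (simp add: comp_def)
  qed
qed

lemma smooth_fun_on_restrict:
  assumes M: "smooth_manifold M" and X: "embedded_submanifold M X"
    and W: "openin (mtop M) W" and f: "smooth_fun_on M W f"
  shows "smooth_fun_on (submfd M X) (W \<inter> X) f"
proof -
  have "{x\<in>carrier (submfd M X). x \<in> W} = W \<inter> X" using embedded_subset[OF X] by auto
  then show ?thesis
    using smooth_fun_on_pullback[OF smooth_manifold_submfd[OF M X] M smooth_map_incl[OF M X] W f] by (simp add: comp_def)
qed

lemma openin_submfd: "openin (mtop M) W \<Longrightarrow> openin (mtop (submfd M X)) (W \<inter> X)"
  by (auto simp: openin_subtopology)

text \<open>Charts of a submanifold are restricted slice charts of \<open>M\<close> with the same
  coordinate map, so the coordinate expression of \<open>q\<close> does not change.\<close>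

lemma smooth_map_corestrict:
  assumes A: "smooth_manifold A" and M: "smooth_manifold M" and X: "embedded_submanifold M X"
    and q: "smooth_map A M q" and qX: "\<And>a. a \<in> carrier A \<Longrightarrow> q a \<in> X"
  shows "smooth_map A (submfd M X) q"
proof (rule smooth_mapI[OF A])
  show "continuous_map (mtop A) (mtop (submfd M X)) q"
    using q qX by (simp add: continuous_map_in_subtopology smooth_map_def Pi_iff)
  fix W \<psi> assume "(W, \<psi>) \<in> atlas (submfd M X)"
  then obtain U where U: "W = U \<inter> X" "(U, \<psi>) \<in> slice_charts M X (submfd_dim M X)" by (rule submfd_atlasE)
  have "smooth_fun_on A {x\<in>carrier A. q x \<in> U} (\<psi> \<circ> q)"
    by (rule smooth_fun_on_pullback[OF A M q chartD(1)[OF slice_chartD(3)[OF U(2)]] smooth_fun_on_chart_self[OF M slice_chartD(1)[OF U(2)]]])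
  moreover have "{x\<in>carrier A. q x \<in> W} = {x\<in>carrier A. q x \<in> U}" using qX U(1) by auto
  ultimately show "smooth_fun_on A {x\<in>carrier A. q x \<in> W} (\<psi> \<circ> q)" by simp
qed

section \<open>Invariance of the dimension of a submanifold\<close>

lemma dim_image_inj_subspace:
  fixes f :: "'e::euclidean_space \<Rightarrow> 'f::euclidean_space"
  assumes f: "linear f" and S: "subspace S" and inj: "\<And>v. v \<in> S \<Longrightarrow> f v = 0 \<Longrightarrow> v = 0"
  shows "dim (f ` S) = dim S"
proof (rule dim_image_eq[OF f])
  have "span S = S" using S by (simp add: span_eq_iff)
  then show "inj_on f (span S)"
    unfolding \<open>span S = S\<close> using linear_inj_on_iff_eq_0[OF f S] inj by simp
qed

text \<open>Both slices are pictures of \<open>X\<close>, so the transition takes the slice of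
  dimension \<open>k\<close> into that of dimension \<open>l\<close>. Its derivative then embeds one
  coordinate subspace into the other.\<close>

lemma slice_chart_dim_le:
  fixes M :: "('a, 'e::euclidean_space) mfd"
  assumes M: "smooth_manifold M" and c: "(U, \<phi>) \<in> slice_charts M X k" and d: "(V, \<psi>) \<in> slice_charts M X l"
    and kl: "k \<le> mdim M" "l \<le> mdim M" and x: "x \<in> U" "x \<in> V" "x \<in> X"
  shows "k \<le> l"
proof -
  note cU = slice_chartD[OF c] and cV = slice_chartD[OF d]
  let ?D = "chart_deriv (U, \<phi>) \<psi> x"
  note oV = chartD(1)[OF cV(3)] and sV = smooth_fun_on_chart_self[OF M cV(1)]
  have D: "(\<psi> \<circ> inv_into U \<phi> has_derivative ?D) (at (\<phi> x) within \<phi> ` U)"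
    by (rule chart_has_derivative[OF M cU(1) oV sV x(1,2)])
  have lin: "linear ?D" using D by (rule has_derivative_linear)
  have UV: "openin (mtop M) (U \<inter> V)" using oV chartD(1)[OF cU(3)] by blast
  obtain A where A: "open A" "\<phi> ` (U \<inter> V) = model M \<inter> A"
    using chart_image_open[OF cU(3) UV] by (auto simp: openin_open)
  have km: "coord_space k \<subseteq> model M" using coord_space_mono[OF kl(1)] by (simp add: model_def)
  let ?S = "coord_space k \<inter> A"
  have SX: "\<exists>y. y \<in> U \<inter> V \<inter> X \<and> z = \<phi> y" if "z \<in> ?S" for z
  proof -
    have "z \<in> \<phi> ` (U \<inter> V)" using that km A by auto
    then obtain y where "y \<in> U \<inter> V" "z = \<phi> y" by blast
    then show ?thesis using cU(4)[of y] that by auto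
  qed
  have S: "openin (top_of_set (coord_space k)) ?S" using A(1) by (simp add: openin_open_Int)
  have "\<phi> x \<in> ?S" using cU(4)[of x] x A(2) by blast
  have D': "(\<psi> \<circ> inv_into U \<phi> has_derivative ?D) (at (\<phi> x) within ?S)"
    by (rule has_derivative_subset[OF D]) (use SX in auto)
  have im: "(\<psi> \<circ> inv_into U \<phi>) ` ?S \<subseteq> coord_space l"
  proof clarify
    fix z assume "z \<in> coord_space k" "z \<in> A"
    then obtain y where y: "y \<in> U \<inter> V \<inter> X" "z = \<phi> y" using SX by blast
    then have "inv_into U \<phi> z = y" using inv_into_f_f[OF chartD(3)[OF cU(3)], of y] by simp
    then show "(\<psi> \<circ> inv_into U \<phi>) z \<in> coord_space l" using cV(4)[of y] y by simp
  qed
  have Dl: "?D v \<in> coord_space l" if "v \<in> coord_space k" for v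
    using has_derivative_in_subspace[OF subspace_coord_space S \<open>\<phi> x \<in> ?S\<close> D' that subspace_coord_space im] .
  \<comment> \<open>The derivative of the opposite transition is a left inverse.\<close>
  have inj: "v = 0" if "v \<in> coord_space k" "?D v = 0" for v
  proof -
    have v: "v \<in> model M" using that km by blast
    have "chart_deriv (U, \<phi>) \<phi> x v = chart_deriv (V, \<psi>) \<phi> x (?D v)"
      by (rule chart_deriv_change(1)[OF M cU(1) cV(1) x(1,2,1) chartD(1)[OF cU(3)] smooth_fun_on_chart_self[OF M cU(1)] v])
    then show ?thesis
      using chart_deriv_self[OF M cU(1) x(1) v] that(2)
        linear_0[OF chart_deriv_linear[OF M cV(1) chartD(1)[OF cU(3)] smooth_fun_on_chart_self[OF M cU(1)] x(2,1)]] by simp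
  qed
  have "dim (coord_space k :: 'e set) = dim (?D ` coord_space k)"
    using dim_image_inj_subspace[OF lin subspace_coord_space inj] by simp
  also have "\<dots> \<le> dim (coord_space l :: 'e set)" using Dl by (intro dim_subset) auto
  finally show ?thesis using kl mdim_le[OF M] by (simp add: dim_coord_space)
qed

text \<open>\<open>submfd_dim\<close> is defined as a least value; comparing slice charts at
  \<open>x\<close> in both directions shows that a nonempty set admits no other.\<close>

lemma submfd_dim_eq:
  assumes M: "smooth_manifold M" and X: "embedded_of_dim M X k" and x: "x \<in> X"
  shows "submfd_dim M X = k"
proof -
  have X': "embedded_submanifold M X" using X unfolding embedded_submanifold_def by blast
  obtain U \<phi> where U: "(U, \<phi>) \<in> slice_charts M X (submfd_dim M X)" "x \<in> U" using slice_chart_cover[OF X' x] by metis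
  obtain V \<psi> where V: "(V, \<psi>) \<in> slice_charts M X k" "x \<in> V" "k \<le> mdim M" 
    using X x unfolding embedded_of_dim_def by fastforce
  show ?thesis
    using slice_chart_dim_le[OF M U(1) V(1) submfd_dim_le[OF X'] V(3) U(2) V(2) x]
      slice_chart_dim_le[OF M V(1) U(1) V(3) submfd_dim_le[OF X'] V(2) U(2) x] by simp
qed

section \<open>Tangent spaces of submanifolds\<close>

lemma deriv_at_submfd:
  assumes M: "smooth_manifold M" and X: "embedded_submanifold M X" and x: "x \<in> X"
    and W: "openin (mtop M) W" "x \<in> W" and f: "smooth_fun_on M W f" and u: "u \<in> model (submfd M X)"
  shows "deriv_at (submfd M X) f x u = deriv_at M f x (incl_push M X x u)"
  using deriv_at_chain[OF smooth_manifold_submfd[OF M X] M smooth_map_incl[OF M X] _ W f u] x embedded_subset[OF X]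
  by (auto simp: comp_def)

lemma incl_push_model:
  assumes M: "smooth_manifold M" and X: "embedded_submanifold M X" and x: "x \<in> X" and u: "u \<in> model (submfd M X)"
  shows "incl_push M X x u \<in> model M"
  using tangent_map_in_model[OF smooth_manifold_submfd[OF M X] M smooth_map_incl[OF M X] _ u] x embedded_subset[OF X] by auto

lemma incl_push_linear:
  assumes M: "smooth_manifold M" and X: "embedded_submanifold M X" and x: "x \<in> X"
  shows "linear (incl_push M X x)"
  using tangent_map_linear[OF smooth_manifold_submfd[OF M X] M smooth_map_incl[OF M X]] x embedded_subset[OF X] by auto

lemma deriv_slice_incl_push:
  assumes M: "smooth_manifold M" and X: "embedded_submanifold M X" and x: "x \<in> X"
    and c: "(U, \<phi>) \<in> slice_charts M X (submfd_dim M X)" "x \<in> U" and u: "u \<in> model (submfd M X)"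
  shows "deriv_at M \<phi> x (incl_push M X x u) = deriv_at (submfd M X) \<phi> x u"
  using deriv_at_submfd[OF M X x chartD(1)[OF slice_chartD(3)[OF c(1)]] c(2) smooth_fun_on_chart_self[OF M slice_chartD(1)[OF c(1)]] u] by simp

text \<open>The charts of \<open>X\<close> and of \<open>M\<close> share the map
  \<open>\<phi>\<close>. For the harder inclusion, a vector with the given coordinates is first
  realised in \<open>submfd M X\<close> and then pushed forward.\<close>

lemma sub_tangent_slice:
  assumes M: "smooth_manifold M" and X: "embedded_submanifold M X" and x: "x \<in> X"
    and c: "(U, \<phi>) \<in> slice_charts M X (submfd_dim M X)" "x \<in> U"
  shows "sub_tangent M X x = {v\<in>model M. deriv_at M \<phi> x v \<in> coord_space (submfd_dim M X)}"
proof -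
  let ?N = "submfd M X" 
  have N: "smooth_manifold ?N" using smooth_manifold_submfd[OF M X] .
  note cN = slice_chart_submfd_atlas(2)[OF M X c(1)] and cM = slice_chartD(1)[OF c(1)]
  note push = deriv_slice_incl_push[OF M X x c]
  have xN: "x \<in> U \<inter> X" using x c by blast
  have kM: "coord_space (submfd_dim M X) \<subseteq> model M" using coord_space_mono[OF submfd_dim_le[OF X]] by (simp add: model_def)
  show ?thesis
  proof
    show "sub_tangent M X x \<subseteq> {v\<in>model M. deriv_at M \<phi> x v \<in> coord_space (submfd_dim M X)}"
      unfolding sub_tangent_def tangent_space_def
    proof clarify
      fix u assume u: "u \<in> model ?N"
      have "deriv_at ?N \<phi> x u \<in> model ?N"
        by (rule deriv_at_in_chart(2)[OF N cN xN xN chartD(1)[OF max_atlas_chart[OF cN]] smooth_fun_on_chart_self[OF N cN] u])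
      then show "incl_push M X x u \<in> model M \<and> deriv_at M \<phi> x (incl_push M X x u) \<in> coord_space (submfd_dim M X)"
        using push[OF u] incl_push_model[OF M X x u] by simp
    qed
    show "{v\<in>model M. deriv_at M \<phi> x v \<in> coord_space (submfd_dim M X)} \<subseteq> sub_tangent M X x"
    proof clarify
      fix v assume v: "v \<in> model M" "deriv_at M \<phi> x v \<in> coord_space (submfd_dim M X)"
      let ?w = "deriv_at M \<phi> x v" let ?u = "chart_vec ?N (U \<inter> X, \<phi>) x ?w"
      have w: "?w \<in> model ?N" using v by simp
      have u: "?u \<in> model ?N" "deriv_at ?N \<phi> x ?u = ?w" using chart_vec(1,2)[OF N cN xN w] by auto
      have "deriv_at M \<phi> x (incl_push M X x ?u) = ?w" using push[OF u(1)] u(2) by simp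
      then have "incl_push M X x ?u = v"
        using chart_vec(3)[OF M cM c(2) v(1)] chart_vec(3)[OF M cM c(2) incl_push_model[OF M X x u(1)]] by simp
      then show "v \<in> sub_tangent M X x" using imageI[OF u(1), of "incl_push M X x"] unfolding sub_tangent_def tangent_space_def by simp
    qed
  qed
qed

lemma incl_push_eq_0:
  assumes M: "smooth_manifold M" and X: "embedded_submanifold M X" and x: "x \<in> X" and u: "u \<in> model (submfd M X)"
    and 0: "incl_push M X x u = 0"
  shows "u = 0"
proof -
  let ?N = "submfd M X" 
  have N: "smooth_manifold ?N" using smooth_manifold_submfd[OF M X] .
  obtain U \<phi> where c: "(U, \<phi>) \<in> slice_charts M X (submfd_dim M X)" "x \<in> U" using slice_chart_cover[OF X x] by metis
  note cN = slice_chart_submfd_atlas(2)[OF M X c(1)]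
  have xN: "x \<in> U \<inter> X" using x c by blast
  have "deriv_at ?N \<phi> x u = 0"
    using deriv_slice_incl_push[OF M X x c u] 0 linear_0[OF deriv_at_chart_linear[OF M slice_chartD(1)[OF c(1)] c(2)]] by simp
  then show "u = 0" using chart_vec(3)[OF N cN xN u] linear_0[OF chart_vec(4)[OF N cN xN u]] by simp
qed

lemma subspace_sub_tangent:
  assumes M: "smooth_manifold M" and X: "embedded_submanifold M X" and x: "x \<in> X"
  shows "subspace (sub_tangent M X x)" "sub_tangent M X x \<subseteq> model M" "dim (sub_tangent M X x) = submfd_dim M X"
proof -
  have eq: "sub_tangent M X x = incl_push M X x ` model (submfd M X)" by (simp add: sub_tangent_def tangent_space_def)
  show "subspace (sub_tangent M X x)"
    unfolding eq by (rule linear_subspace_image[OF incl_push_linear[OF M X x] subspace_model])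
  show "sub_tangent M X x \<subseteq> model M" unfolding eq using incl_push_model[OF M X x] by blast
  have "dim (sub_tangent M X x) = dim (model (submfd M X))"
    unfolding eq using dim_image_inj_subspace[OF incl_push_linear[OF M X x] subspace_model] incl_push_eq_0[OF M X x] by blast
  then show "dim (sub_tangent M X x) = submfd_dim M X"
    using dim_coord_space[of "submfd_dim M X", where 'e='b] submfd_dim_le[OF X] mdim_le[OF M] by simp
qed

lemma incl_pull_inner:
  assumes M: "smooth_manifold M" and X: "embedded_submanifold M X" and x: "x \<in> X" and u: "u \<in> model (submfd M X)"
  shows "incl_pull M X x \<xi> \<bullet> u = \<xi> \<bullet> incl_push M X x u"
  using cotangent_map_inner[OF smooth_manifold_submfd[OF M X] M smooth_map_incl[OF M X] _ u] x embedded_subset[OF X] by auto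

section \<open>Pointwise linear algebra of coregular submanifolds\<close>

text \<open>The component of \<open>v\<close> orthogonal to \<open>T\<close> lies in
  \<open>E\<close> and annihilates \<open>T\<close>, so by assumption it is orthogonal to
  \<open>v\<close> and hence zero.\<close>

lemma double_annihilator:
  fixes E T :: "'e::euclidean_space set"
  assumes E: "subspace E" and T: "subspace T" "T \<subseteq> E" and v: "v \<in> E"
    and ann: "\<And>\<xi>. \<xi> \<in> E \<Longrightarrow> (\<And>t. t \<in> T \<Longrightarrow> \<xi> \<bullet> t = 0) \<Longrightarrow> \<xi> \<bullet> v = 0"
  shows "v \<in> T"
proof -
  obtain y z where y: "y \<in> span T" and z: "\<And>w. w \<in> span T \<Longrightarrow> orthogonal z w" and yz: "v = y + z"
    using orthogonal_subspace_decomp_exists[of T v] by metis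
  have sT: "span T = T" using T by (simp add: span_eq_iff)
  have "z = v - y" using yz by simp
  then have "z \<in> E" using v y sT T(2) E by (auto intro: subspace_diff)
  moreover have "\<And>t. t \<in> T \<Longrightarrow> z \<bullet> t = 0" using z sT by (simp add: orthogonal_def)
  ultimately have "z \<bullet> v = 0" using ann by blast
  then have "z = 0" using z[OF y] by (simp add: yz inner_add_right orthogonal_def)
  then show ?thesis using yz y sT by simp
qed

text \<open>Dual form of \<open>T\<close> and \<open>C\<close> meeting only in 0: their annihilators
  \<open>A\<close> and \<open>B\<close> together span \<open>E\<close>, since a vector of
  \<open>E\<close> orthogonal to both annihilators lies in \<open>T\<close> and in \<open>C\<close>.
  The summand of \<open>\<xi>0\<close> in \<open>B\<close> is the covector sought.\<close>

lemma extend_covector: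
  fixes E T C :: "'e::euclidean_space set"
  assumes E: "subspace E" and T: "subspace T" "T \<subseteq> E" and C: "subspace C" "C \<subseteq> E"
    and TC: "\<And>v. v \<in> T \<Longrightarrow> v \<in> C \<Longrightarrow> v = 0" and \<xi>0: "\<xi>0 \<in> E"
  shows "\<exists>\<xi>\<in>E. (\<forall>v\<in>T. \<xi> \<bullet> v = \<xi>0 \<bullet> v) \<and> (\<forall>v\<in>C. \<xi> \<bullet> v = 0)"
proof -
  define A where "A = {a\<in>E. \<forall>v\<in>T. a \<bullet> v = 0}"
  define B where "B = {b\<in>E. \<forall>v\<in>C. b \<bullet> v = 0}"
  define U where "U = {a + b | a b. a \<in> A \<and> b \<in> B}"
  have sA: "subspace A" using E unfolding A_def subspace_def by (auto simp: inner_add_left)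
  have sB: "subspace B" using E unfolding B_def subspace_def by (auto simp: inner_add_left)
  have sU: "span U = U" using subspace_sums[OF sA sB] by (simp add: U_def span_eq_iff)
  obtain y z where y: "y \<in> span U" and z: "\<And>w. w \<in> span U \<Longrightarrow> orthogonal z w" and yz: "\<xi>0 = y + z"
    using orthogonal_subspace_decomp_exists[of U \<xi>0] by metis
  have AU: "A \<subseteq> U" "B \<subseteq> U" using subspace_0[OF sA] subspace_0[OF sB] unfolding U_def by force+
  have "y \<in> U" using y sU by simp
  then obtain a b where ab: "a \<in> A" "b \<in> B" "y = a + b" unfolding U_def by blast
  have "z = \<xi>0 - (a + b)" using yz ab by simp
  then have zE: "z \<in> E" using \<xi>0 ab E by (auto simp: A_def B_def intro!: subspace_diff subspace_add)
  have "z \<in> T"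
  proof (rule double_annihilator[OF E T zE])
    fix \<xi> assume "\<xi> \<in> E" "\<And>t. t \<in> T \<Longrightarrow> \<xi> \<bullet> t = 0"
    then have "\<xi> \<in> U" using AU by (auto simp: A_def)
    then show "\<xi> \<bullet> z = 0" using z[of \<xi>] sU by (simp add: orthogonal_def inner_commute)
  qed
  moreover have "z \<in> C"
  proof (rule double_annihilator[OF E C zE])
    fix \<xi> assume "\<xi> \<in> E" "\<And>t. t \<in> C \<Longrightarrow> \<xi> \<bullet> t = 0"
    then have "\<xi> \<in> U" using AU by (auto simp: B_def)
    then show "\<xi> \<bullet> z = 0" using z[of \<xi>] sU by (simp add: orthogonal_def inner_commute)
  qed
  ultimately have "z = 0" using TC by blast
  then have "\<xi>0 = a + b" using yz ab by simp
  then show ?thesis using ab by (intro bexI[of _ b]) (auto simp: A_def B_def inner_add_left)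
qed

section \<open>Contraction on annihilators and tangent lifts of covectors\<close>

lemma sharp_linear:
  assumes a: "alternating_on (model M) (\<pi> x)" and "\<xi> \<in> model M" "\<eta> \<in> model M"
  shows "sharp M \<pi> x (a *\<^sub>R \<xi> + b *\<^sub>R \<eta>) = a *\<^sub>R sharp M \<pi> x \<xi> + b *\<^sub>R sharp M \<pi> x \<eta>"
proof -
  have "sharp M \<pi> x (a *\<^sub>R \<xi> + b *\<^sub>R \<eta>) =
    (\<Sum>i<mdim M. (a * \<pi> x \<xi> (coord_vec i) + b * \<pi> x \<eta> (coord_vec i)) *\<^sub>R coord_vec i)"
    unfolding sharp_def
    by (rule sum.cong) (simp_all add: alternating_onD(1)[OF a assms(2,3) subspace_model coord_vec_in_model])
  then show ?thesis by (simp add: sharp_def scaleR_add_left sum.distrib scaleR_sum_right)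
qed

lemma sharp_diff:
  assumes a: "alternating_on (model M) (\<pi> x)" and "\<xi> \<in> model M" "\<eta> \<in> model M"
  shows "sharp M \<pi> x (\<xi> - \<eta>) = sharp M \<pi> x \<xi> - sharp M \<pi> x \<eta>"
  using sharp_linear[where \<pi>=\<pi> and x=x, OF assms, where a=1 and b="-1"] by simp

lemma sharp_skew:
  assumes M: "smooth_manifold M" and a: "alternating_on (model M) (\<pi> x)" and "\<xi> \<in> model M" "\<eta> \<in> model M"
  shows "\<eta> \<bullet> sharp M \<pi> x \<xi> = - (\<xi> \<bullet> sharp M \<pi> x \<eta>)"
  unfolding sharp_inner[where \<pi>=\<pi> and x=x, OF M a assms(3,4)] sharp_inner[where \<pi>=\<pi> and x=x, OF M a assms(4,3)]
  by (rule alternating_onD(3)[OF a assms(3,4) subspace_model])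

lemma subspace_sharp_image:
  assumes a: "alternating_on (model M) (\<pi> x)" and N: "subspace N" "N \<subseteq> model M"
  shows "subspace (sharp M \<pi> x ` N)"
  unfolding subspace_def
proof (intro conjI ballI allI)
  have "sharp M \<pi> x 0 = 0" using sharp_linear[where \<pi>=\<pi> and x=x, OF a subspace_0[OF subspace_model] subspace_0[OF subspace_model], where a=0 and b=0] by simp
  then show "0 \<in> sharp M \<pi> x ` N" using subspace_0[OF N(1)] by force
  fix u assume "u \<in> sharp M \<pi> x ` N"
  then obtain \<xi> where \<xi>: "\<xi> \<in> N" "u = sharp M \<pi> x \<xi>" by blast
  show "c *\<^sub>R u \<in> sharp M \<pi> x ` N" for c
    using sharp_linear[where \<pi>=\<pi> and x=x, OF a, of \<xi> \<xi> c 0] \<xi> N subspace_scale[OF N(1) \<xi>(1), of c] by force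
  fix v assume "v \<in> sharp M \<pi> x ` N"
  then obtain \<eta> where \<eta>: "\<eta> \<in> N" "v = sharp M \<pi> x \<eta>" by blast
  show "u + v \<in> sharp M \<pi> x ` N"
    using sharp_linear[where \<pi>=\<pi> and x=x, OF a, of \<xi> \<eta> 1 1] \<xi> \<eta> N subspace_add[OF N(1) \<xi>(1) \<eta>(1)] by force
qed

lemma annihilator_alt: "annihilator M x F = {\<xi>\<in>model M. \<forall>v\<in>F. \<xi> \<bullet> v = 0}"
  by (simp add: annihilator_def cotangent_space_def)

lemma subspace_annihilator: "subspace (annihilator M x F)" "annihilator M x F \<subseteq> model M"
  using subspace_model[of M] unfolding annihilator_alt subspace_def by (auto simp: inner_add_left)

lemma in_annihilator_annihilator:
  assumes "subspace T" "T \<subseteq> model M" "v \<in> model M" "\<And>\<nu>. \<nu> \<in> annihilator M x T \<Longrightarrow> \<nu> \<bullet> v = 0"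
  shows "v \<in> T"
  by (rule double_annihilator[OF subspace_model assms(1,2,3)]) (use assms(4) in \<open>auto simp: annihilator_alt\<close>)

text \<open>Skewness turns the assumption into the statement that
  \<open>sharp M \<pi> x \<xi>\<close> is annihilated by the annihilator of \<open>T\<close>; the
  double annihilator is \<open>T\<close> itself.\<close>

lemma sharp_in_subspaceI:
  assumes M: "smooth_manifold M" and a: "alternating_on (model M) (\<pi> x)" and T: "subspace T" "T \<subseteq> model M"
    and \<xi>: "\<xi> \<in> model M" "\<And>\<nu>. \<nu> \<in> annihilator M x T \<Longrightarrow> \<xi> \<bullet> sharp M \<pi> x \<nu> = 0"
  shows "sharp M \<pi> x \<xi> \<in> T"
proof (rule in_annihilator_annihilator[OF T sharp_in_model])
  fix \<nu> assume n: "\<nu> \<in> annihilator M x T"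
  then have "\<nu> \<in> model M" by (simp add: annihilator_alt)
  then show "\<nu> \<bullet> sharp M \<pi> x \<xi> = 0" using sharp_skew[where \<pi>=\<pi> and x=x, OF M a \<xi>(1)] \<xi>(2)[OF n] by simp
qed

text \<open>With \<open>?C\<close> the image under \<open>sharp\<close> of the annihilator of
  \<open>T\<close>, a covector has its \<open>sharp\<close> in \<open>T\<close> as soon as it
  vanishes on \<open>?C\<close>. Transversality leaves its values on \<open>T\<close> free.\<close>

lemma tangent_lift:
  assumes M: "smooth_manifold M" and a: "alternating_on (model M) (\<pi> x)" and T: "subspace T" "T \<subseteq> model M"
    and trans: "sharp M \<pi> x ` annihilator M x T \<inter> T = {0}" and \<xi>0: "\<xi>0 \<in> model M"
  shows "\<exists>\<xi>\<in>model M. (\<forall>v\<in>T. \<xi> \<bullet> v = \<xi>0 \<bullet> v) \<and> sharp M \<pi> x \<xi> \<in> T"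
proof -
  let ?C = "sharp M \<pi> x ` annihilator M x T"
  have C: "subspace ?C" by (rule subspace_sharp_image[where \<pi>=\<pi> and x=x, OF a subspace_annihilator(1) subspace_annihilator(2)])
  have CE: "?C \<subseteq> model M" by (rule image_subsetI) (rule sharp_in_model)
  have "v = 0" if "v \<in> T" "v \<in> ?C" for v using trans that by (metis IntI singletonD)
  then obtain \<xi> where \<xi>: "\<xi> \<in> model M" "\<forall>v\<in>T. \<xi> \<bullet> v = \<xi>0 \<bullet> v" "\<forall>v\<in>?C. \<xi> \<bullet> v = 0"
    using extend_covector[OF subspace_model T C CE _ \<xi>0] by metis
  have "sharp M \<pi> x \<xi> \<in> T"
    by (rule sharp_in_subspaceI[where \<pi>=\<pi> and x=x, OF M a T \<xi>(1)]) (use \<xi>(3) in simp)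
  then show ?thesis using \<xi>(1,2) by (intro bexI[of _ \<xi>] conjI)
qed

text \<open>The difference of two lifts annihilates \<open>T\<close>, so its \<open>sharp\<close>
  lies in both of the transverse spaces. Lifts of a covector thus differ by covectors with zero
  \<open>sharp\<close>, which makes the induced bivector well defined.\<close>

lemma sharp_tangent_unique:
  assumes M: "smooth_manifold M" and a: "alternating_on (model M) (\<pi> x)"
    and trans: "sharp M \<pi> x ` annihilator M x T \<inter> T = {0}" and T: "subspace T"
    and \<xi>: "\<xi> \<in> model M" "sharp M \<pi> x \<xi> \<in> T" and \<eta>: "\<eta> \<in> model M" "sharp M \<pi> x \<eta> \<in> T"
    and eq: "\<And>v. v \<in> T \<Longrightarrow> \<xi> \<bullet> v = \<eta> \<bullet> v"
  shows "sharp M \<pi> x \<xi> = sharp M \<pi> x \<eta>"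
proof -
  have "\<xi> - \<eta> \<in> annihilator M x T"
    using \<xi>(1) \<eta>(1) eq by (simp add: annihilator_alt inner_diff_left subspace_diff)
  moreover have "sharp M \<pi> x (\<xi> - \<eta>) \<in> T"
    using sharp_diff[where \<pi>=\<pi> and x=x, OF a \<xi>(1) \<eta>(1)] subspace_diff[OF T \<xi>(2) \<eta>(2)] by simp
  ultimately have "sharp M \<pi> x (\<xi> - \<eta>) = 0" using trans by blast
  then show ?thesis using sharp_diff[where \<pi>=\<pi> and x=x, OF a \<xi>(1) \<eta>(1)] by simp
qed

section \<open>Inclusion of a submanifold and the graph of the induced bivector\<close>

lemma conormal_eq: "conormal M X x = annihilator M x (sub_tangent M X x)"
  by (simp add: conormal_def)

lemma incl_push_sub_tangent: "u \<in> model (submfd M X) \<Longrightarrow> incl_push M X x u \<in> sub_tangent M X x"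
  unfolding sub_tangent_def tangent_space_def by (rule imageI)

lemma sub_tangentE:
  assumes "v \<in> sub_tangent M X x" obtains u where "u \<in> model (submfd M X)" "v = incl_push M X x u"
  using assms unfolding sub_tangent_def tangent_space_def by (elim imageE)

lemma incl_pull_model: "incl_pull M X x \<xi> \<in> model (submfd M X)"
  by (rule cotangent_map_in_model)

lemma incl_pull_eq_iff:
  assumes M: "smooth_manifold M" and X: "embedded_submanifold M X" and x: "x \<in> X"
  shows "incl_pull M X x \<xi> = incl_pull M X x \<eta> \<longleftrightarrow> (\<forall>v\<in>sub_tangent M X x. \<xi> \<bullet> v = \<eta> \<bullet> v)"
proof
  assume eq: "incl_pull M X x \<xi> = incl_pull M X x \<eta>"
  show "\<forall>v\<in>sub_tangent M X x. \<xi> \<bullet> v = \<eta> \<bullet> v"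
  proof
    fix v assume "v \<in> sub_tangent M X x"
    then obtain u where u: "u \<in> model (submfd M X)" "v = incl_push M X x u" by (rule sub_tangentE)
    then show "\<xi> \<bullet> v = \<eta> \<bullet> v"
      using incl_pull_inner[OF M X x u(1), of \<xi>] incl_pull_inner[OF M X x u(1), of \<eta>] eq by simp
  qed
next
  assume eq: "\<forall>v\<in>sub_tangent M X x. \<xi> \<bullet> v = \<eta> \<bullet> v"
  show "incl_pull M X x \<xi> = incl_pull M X x \<eta>"
  proof (rule model_eqI[OF smooth_manifold_submfd[OF M X] incl_pull_model incl_pull_model])
    fix u assume u: "u \<in> model (submfd M X)"
    show "u \<bullet> incl_pull M X x \<xi> = u \<bullet> incl_pull M X x \<eta>"
      using incl_pull_inner[OF M X x u, of \<xi>] incl_pull_inner[OF M X x u, of \<eta>] eq incl_push_sub_tangent[OF u, of x]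
      by (simp add: inner_commute)
  qed
qed

lemma incl_pull_linear:
  "incl_pull M X x (a *\<^sub>R \<xi> + b *\<^sub>R \<eta>) = a *\<^sub>R incl_pull M X x \<xi> + b *\<^sub>R incl_pull M X x \<eta>"
  unfolding cotangent_map_def
  by (simp add: inner_add_left scaleR_add_left sum.distrib scaleR_sum_right)

text \<open>A covector of \<open>X\<close> is extended to \<open>M\<close> by composition with a
  linear left inverse of the injective inclusion of tangent spaces.\<close>

lemma incl_pull_surj:
  fixes M :: "('a, 'e::euclidean_space) mfd"
  assumes M: "smooth_manifold M" and X: "embedded_submanifold M X" and x: "x \<in> X" and \<zeta>: "\<zeta> \<in> model (submfd M X)"
  shows "\<exists>\<xi>\<in>model M. incl_pull M X x \<xi> = \<zeta>"
proof -
  let ?E = "model (submfd M X)" 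
  have sE: "span ?E = ?E" using span_eq_iff[of ?E] by simp
  have "inj_on (incl_push M X x) (span ?E)"
    unfolding sE linear_inj_on_iff_eq_0[OF incl_push_linear[OF M X x] subspace_model]
    using incl_push_eq_0[OF M X x] by simp
  then obtain g where g: "linear g" "\<forall>u\<in>?E. g (incl_push M X x u) = u"
    using linear_inj_on_left_inverse[OF incl_push_linear[OF M X x], of ?E] unfolding sE by blast
  have lin: "linear (\<lambda>v. \<zeta> \<bullet> g v)"
    using linear_compose[OF g(1) bounded_linear.linear[OF bounded_linear_inner_right[of \<zeta>]]] by (simp add: comp_def)
  let ?\<xi> = "\<Sum>i<mdim M. (\<zeta> \<bullet> g (coord_vec i)) *\<^sub>R coord_vec i"
  have "incl_pull M X x ?\<xi> = \<zeta>"
  proof (rule model_eqI[OF smooth_manifold_submfd[OF M X] incl_pull_model \<zeta>])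
    fix u assume u: "u \<in> ?E"
    have "?\<xi> \<bullet> incl_push M X x u = \<zeta> \<bullet> g (incl_push M X x u)"
      by (rule sum_coord_vec_inner[OF M incl_push_model[OF M X x u] lin])
    then show "u \<bullet> incl_pull M X x ?\<xi> = u \<bullet> \<zeta>" using incl_pull_inner[OF M X x u, of ?\<xi>] g(2) u by (simp add: inner_commute)
  qed
  then show ?thesis using sum_coord_vec_in_model by (intro bexI[of _ ?\<xi>])
qed

lemma covector_tangent_lift:
  assumes M: "smooth_manifold M" and X: "embedded_submanifold M X" and x: "x \<in> X"
    and a: "alternating_on (model M) (\<pi> x)" and trans: "sharp M \<pi> x ` conormal M X x \<inter> sub_tangent M X x = {0}"
    and \<zeta>: "\<zeta> \<in> model (submfd M X)"
  shows "\<exists>\<xi>\<in>model M. sharp M \<pi> x \<xi> \<in> sub_tangent M X x \<and> incl_pull M X x \<xi> = \<zeta>"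
proof -
  obtain \<xi>0 where \<xi>0: "\<xi>0 \<in> model M" "incl_pull M X x \<xi>0 = \<zeta>" using incl_pull_surj[OF M X x \<zeta>] by blast
  obtain \<xi> where \<xi>: "\<xi> \<in> model M" "\<forall>v\<in>sub_tangent M X x. \<xi> \<bullet> v = \<xi>0 \<bullet> v" "sharp M \<pi> x \<xi> \<in> sub_tangent M X x"
    using tangent_lift[where \<pi>=\<pi> and x=x, OF M a subspace_sub_tangent(1,2)[OF M X x] trans[unfolded conormal_eq] \<xi>0(1)]
    by (elim bexE conjE)
  then show ?thesis using incl_pull_eq_iff[OF M X x, of \<xi> \<xi>0] \<xi>0(2) by auto
qed

lemma induced_sharp:
  assumes M: "smooth_manifold M" and X: "embedded_submanifold M X" and x: "x \<in> X"
    and graph: "pullback_graph M \<pi> X x = bivector_graph (submfd M X) \<rho> x"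
    and \<xi>: "\<xi> \<in> model M" "sharp M \<pi> x \<xi> \<in> sub_tangent M X x"
  shows "incl_push M X x (sharp (submfd M X) \<rho> x (incl_pull M X x \<xi>)) = sharp M \<pi> x \<xi>"
proof -
  obtain u where u: "u \<in> model (submfd M X)" "sharp M \<pi> x \<xi> = incl_push M X x u" using \<xi>(2) by (rule sub_tangentE)
  have "(u, incl_pull M X x \<xi>) \<in> pullback_graph M \<pi> X x"
    unfolding pullback_graph_def tangent_space_def cotangent_space_def using u \<xi>(1) by auto
  then have "u = sharp (submfd M X) \<rho> x (incl_pull M X x \<xi>)" unfolding graph bivector_graph_def by auto
  then show ?thesis using u(2) by simp
qed

text \<open>Equality of the graphs identifies the Hamiltonian vectors of \<open>\<xi>\<close> and of
  its restriction. Tangency is asked of \<open>\<xi>\<close> alone; \<open>\<eta>\<close> is merely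
  paired with a vector already tangent to \<open>X\<close>.\<close>

lemma induced_apply:
  assumes M: "smooth_manifold M" and X: "embedded_submanifold M X" and x: "x \<in> X"
    and graph: "pullback_graph M \<pi> X x = bivector_graph (submfd M X) \<rho> x"
    and a: "alternating_on (model M) (\<pi> x)" and a': "alternating_on (model (submfd M X)) (\<rho> x)"
    and \<xi>: "\<xi> \<in> model M" "sharp M \<pi> x \<xi> \<in> sub_tangent M X x" and \<eta>: "\<eta> \<in> model M"
  shows "\<rho> x (incl_pull M X x \<xi>) (incl_pull M X x \<eta>) = \<pi> x \<xi> \<eta>"
proof -
  have "\<rho> x (incl_pull M X x \<xi>) (incl_pull M X x \<eta>) = incl_pull M X x \<eta> \<bullet> sharp (submfd M X) \<rho> x (incl_pull M X x \<xi>)"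
    using sharp_inner[where \<pi>=\<rho> and x=x, OF smooth_manifold_submfd[OF M X] a' incl_pull_model incl_pull_model] by simp
  also have "\<dots> = \<eta> \<bullet> sharp M \<pi> x \<xi>"
    using incl_pull_inner[OF M X x sharp_in_model] induced_sharp[OF M X x graph \<xi>] by metis
  also have "\<dots> = \<pi> x \<xi> \<eta>" using sharp_inner[where \<pi>=\<pi> and x=x, OF M a \<xi>(1) \<eta>] .
  finally show ?thesis .
qed

text \<open>The vector components are compared by pairing with covectors of \<open>X\<close>. Each
  of these is the restriction of a covector with tangent Hamiltonian vector, so agreement of the two
  bilinear forms on such lifts is enough.\<close>

lemma induced_graphI:
  assumes M: "smooth_manifold M" and X: "embedded_submanifold M X" and x: "x \<in> X"
    and a: "alternating_on (model M) (\<pi> x)" and a': "alternating_on (model (submfd M X)) (\<rho> x)"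
    and trans: "sharp M \<pi> x ` conormal M X x \<inter> sub_tangent M X x = {0}"
    and eq: "\<And>\<xi> \<eta>. \<xi> \<in> model M \<Longrightarrow> \<eta> \<in> model M \<Longrightarrow> sharp M \<pi> x \<xi> \<in> sub_tangent M X x \<Longrightarrow> sharp M \<pi> x \<eta> \<in> sub_tangent M X x \<Longrightarrow>
      \<rho> x (incl_pull M X x \<xi>) (incl_pull M X x \<eta>) = \<pi> x \<xi> \<eta>"
  shows "pullback_graph M \<pi> X x = bivector_graph (submfd M X) \<rho> x"
proof -
  let ?N = "submfd M X"
  note N = smooth_manifold_submfd[OF M X]
  have key: "u = sharp ?N \<rho> x (incl_pull M X x \<xi>)"
    if u: "u \<in> model ?N" "\<xi> \<in> model M" "incl_push M X x u = sharp M \<pi> x \<xi>" for u \<xi>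
  proof (rule model_eqI[OF N u(1) sharp_in_model])
    have \<xi>T: "sharp M \<pi> x \<xi> \<in> sub_tangent M X x" using incl_push_sub_tangent[OF u(1), of x] u(3) by simp
    fix \<zeta> assume \<zeta>: "\<zeta> \<in> model ?N"
    obtain \<eta> where \<eta>: "\<eta> \<in> model M" "sharp M \<pi> x \<eta> \<in> sub_tangent M X x" "incl_pull M X x \<eta> = \<zeta>"
      using covector_tangent_lift[where \<pi>=\<pi>, OF M X x a trans \<zeta>] by blast
    have "\<zeta> \<bullet> u = \<eta> \<bullet> sharp M \<pi> x \<xi>" using incl_pull_inner[OF M X x u(1), of \<eta>] \<eta>(3) u(3) by simp
    also have "\<dots> = \<pi> x \<xi> \<eta>" using sharp_inner[where \<pi>=\<pi> and x=x, OF M a u(2) \<eta>(1)] .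
    also have "\<dots> = \<rho> x (incl_pull M X x \<xi>) \<zeta>" using eq[OF u(2) \<eta>(1) \<xi>T \<eta>(2)] \<eta>(3) by simp
    also have "\<dots> = \<zeta> \<bullet> sharp ?N \<rho> x (incl_pull M X x \<xi>)"
      using sharp_inner[where \<pi>=\<rho> and x=x, OF N a' incl_pull_model \<zeta>] by simp
    finally show "\<zeta> \<bullet> u = \<zeta> \<bullet> sharp ?N \<rho> x (incl_pull M X x \<xi>)" .
  qed
  show ?thesis
  proof
    show "pullback_graph M \<pi> X x \<subseteq> bivector_graph ?N \<rho> x"
    proof
      fix w assume "w \<in> pullback_graph M \<pi> X x"
      then obtain u \<xi> where w: "w = (u, incl_pull M X x \<xi>)" "u \<in> model ?N" "\<xi> \<in> model M" "incl_push M X x u = sharp M \<pi> x \<xi>"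
        unfolding pullback_graph_def tangent_space_def cotangent_space_def by blast
      show "w \<in> bivector_graph ?N \<rho> x"
        unfolding bivector_graph_def cotangent_space_def w(1) using key[OF w(2-4)] incl_pull_model[of M X x \<xi>]
        by (intro CollectI exI[of _ "incl_pull M X x \<xi>"]) simp
    qed
    show "bivector_graph ?N \<rho> x \<subseteq> pullback_graph M \<pi> X x"
    proof
      fix w assume "w \<in> bivector_graph ?N \<rho> x"
      then obtain \<zeta> where w: "w = (sharp ?N \<rho> x \<zeta>, \<zeta>)" "\<zeta> \<in> model ?N"
        unfolding bivector_graph_def cotangent_space_def by blast
      obtain \<xi> where \<xi>: "\<xi> \<in> model M" "sharp M \<pi> x \<xi> \<in> sub_tangent M X x" "incl_pull M X x \<xi> = \<zeta>"
        using covector_tangent_lift[where \<pi>=\<pi>, OF M X x a trans w(2)] by blast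
      obtain u where u: "u \<in> model ?N" "sharp M \<pi> x \<xi> = incl_push M X x u" using \<xi>(2) by (rule sub_tangentE)
      then have "u = sharp ?N \<rho> x \<zeta>" using key[OF u(1) \<xi>(1)] \<xi>(3) by simp
      then have "w = (u, incl_pull M X x \<xi>)" using w(1) \<xi>(3) by simp
      then show "w \<in> pullback_graph M \<pi> X x"
        unfolding pullback_graph_def tangent_space_def cotangent_space_def using u \<xi>(1) by auto
    qed
  qed
qed

lemma induced_bivector_exists_at:
  assumes M: "smooth_manifold M" and X: "embedded_submanifold M X" and x: "x \<in> X"
    and a: "alternating_on (model M) (\<pi> x)" and trans: "sharp M \<pi> x ` conormal M X x \<inter> sub_tangent M X x = {0}"
  shows "\<exists>\<beta>. alternating_on (model (submfd M X)) \<beta> \<and>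
    (\<forall>\<xi>\<in>model M. \<forall>\<eta>\<in>model M. sharp M \<pi> x \<xi> \<in> sub_tangent M X x \<longrightarrow> sharp M \<pi> x \<eta> \<in> sub_tangent M X x \<longrightarrow>
      \<beta> (incl_pull M X x \<xi>) (incl_pull M X x \<eta>) = \<pi> x \<xi> \<eta>)"
proof -
  let ?E = "model (submfd M X)" and ?T = "sub_tangent M X x" and ?p = "incl_pull M X x"
  note sT = subspace_sub_tangent(1)[OF M X x]
  have "\<exists>L. \<forall>\<zeta>\<in>?E. L \<zeta> \<in> model M \<and> sharp M \<pi> x (L \<zeta>) \<in> ?T \<and> ?p (L \<zeta>) = \<zeta>"
  proof (rule bchoice, rule ballI)
    fix \<zeta> assume "\<zeta> \<in> ?E"
    from covector_tangent_lift[where \<pi>=\<pi>, OF M X x a trans this]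
    show "\<exists>\<xi>. \<xi> \<in> model M \<and> sharp M \<pi> x \<xi> \<in> ?T \<and> ?p \<xi> = \<zeta>" unfolding Bex_def .
  qed
  then obtain L where L0: "\<forall>\<zeta>\<in>?E. L \<zeta> \<in> model M \<and> sharp M \<pi> x (L \<zeta>) \<in> ?T \<and> ?p (L \<zeta>) = \<zeta>" ..
  then have L: "\<And>\<zeta>. \<zeta> \<in> ?E \<Longrightarrow> L \<zeta> \<in> model M" "\<And>\<zeta>. \<zeta> \<in> ?E \<Longrightarrow> sharp M \<pi> x (L \<zeta>) \<in> ?T"
    "\<And>\<zeta>. \<zeta> \<in> ?E \<Longrightarrow> ?p (L \<zeta>) = \<zeta>" by auto
  \<comment> \<open>The form is defined through chosen lifts. By \<open>same\<close>, the
    Hamiltonian vector of a lift is determined by the covector on \<open>X\<close>, and skewness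
    carries this independence of the choice to both arguments.\<close>
  define \<beta> where "\<beta> \<zeta> \<theta> = \<pi> x (L \<zeta>) (L \<theta>)" for \<zeta> \<theta>
  have same: "sharp M \<pi> x \<xi> = sharp M \<pi> x \<xi>'" 
    if "\<xi> \<in> model M" "\<xi>' \<in> model M" "sharp M \<pi> x \<xi> \<in> ?T" "sharp M \<pi> x \<xi>' \<in> ?T" "?p \<xi> = ?p \<xi>'" for \<xi> \<xi>'
    by (rule sharp_tangent_unique[where \<pi>=\<pi> and x=x, OF M a trans[unfolded conormal_eq] sT that(1,3,2,4)])
       (use that(5)[unfolded incl_pull_eq_iff[OF M X x]] in simp)
  have pe: "\<pi> x \<xi> \<eta> = \<eta> \<bullet> sharp M \<pi> x \<xi>" "\<pi> x \<xi> \<eta> = - (\<xi> \<bullet> sharp M \<pi> x \<eta>)"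
    if "\<xi> \<in> model M" "\<eta> \<in> model M" for \<xi> \<eta>
    using sharp_inner[where \<pi>=\<pi> and x=x, OF M a that] sharp_skew[where \<pi>=\<pi> and x=x, OF M a that] by simp_all
  have key: "\<beta> (?p \<xi>) (?p \<eta>) = \<pi> x \<xi> \<eta>"
    if "\<xi> \<in> model M" "\<eta> \<in> model M" "sharp M \<pi> x \<xi> \<in> ?T" "sharp M \<pi> x \<eta> \<in> ?T" for \<xi> \<eta>
  proof -
    note LL = L[OF incl_pull_model[of M X x]]
    have 1: "sharp M \<pi> x (L (?p \<xi>)) = sharp M \<pi> x \<xi>" using same[OF LL(1) that(1) LL(2) that(3) LL(3)] .
    have 2: "sharp M \<pi> x (L (?p \<eta>)) = sharp M \<pi> x \<eta>" using same[OF LL(1) that(2) LL(2) that(4) LL(3)] .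
    have "\<beta> (?p \<xi>) (?p \<eta>) = L (?p \<eta>) \<bullet> sharp M \<pi> x \<xi>"
      unfolding \<beta>_def using pe(1)[OF LL(1)[of \<xi>] LL(1)[of \<eta>]] 1 by simp
    also have "\<dots> = \<pi> x \<xi> (L (?p \<eta>))" using pe(1)[OF that(1) LL(1)] by simp
    also have "\<dots> = - (\<xi> \<bullet> sharp M \<pi> x \<eta>)" using pe(2)[OF that(1) LL(1)[of \<eta>]] 2 by simp
    also have "\<dots> = \<pi> x \<xi> \<eta>" using pe(2)[OF that(1,2)] by simp
    finally show ?thesis .
  qed
  \<comment> \<open>A combination of chosen lifts need not be the chosen lift of the combination,
    but it is a lift, and \<open>key\<close> holds for every lift. Bilinearity of
    \<open>\<beta>\<close> follows.\<close>
  have comb: "c *\<^sub>R L \<zeta> + d *\<^sub>R L \<theta> \<in> model M" "sharp M \<pi> x (c *\<^sub>R L \<zeta> + d *\<^sub>R L \<theta>) \<in> ?T" 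
      "?p (c *\<^sub>R L \<zeta> + d *\<^sub>R L \<theta>) = c *\<^sub>R \<zeta> + d *\<^sub>R \<theta>"
    if z: "\<zeta> \<in> ?E" "\<theta> \<in> ?E" for \<zeta> \<theta> c d
  proof -
    show "c *\<^sub>R L \<zeta> + d *\<^sub>R L \<theta> \<in> model M" using L(1) z by (intro subspace_add subspace_scale subspace_model) auto
    show "sharp M \<pi> x (c *\<^sub>R L \<zeta> + d *\<^sub>R L \<theta>) \<in> ?T"
      unfolding sharp_linear[where \<pi>=\<pi> and x=x, OF a L(1)[OF z(1)] L(1)[OF z(2)]]
      using L(2) z by (intro subspace_add[OF sT] subspace_scale[OF sT]) auto
    show "?p (c *\<^sub>R L \<zeta> + d *\<^sub>R L \<theta>) = c *\<^sub>R \<zeta> + d *\<^sub>R \<theta>"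
      unfolding incl_pull_linear L(3)[OF z(1)] L(3)[OF z(2)] ..
  qed
  have "alternating_on ?E \<beta>"
    unfolding alternating_on_def
  proof (intro conjI ballI allI)
    fix \<zeta> \<theta> \<kappa> c d assume z: "\<zeta> \<in> ?E" "\<theta> \<in> ?E" "\<kappa> \<in> ?E"
    note cz = comb[OF z(1,2), of c d] 
    have "\<beta> (c *\<^sub>R \<zeta> + d *\<^sub>R \<theta>) \<kappa> = \<pi> x (c *\<^sub>R L \<zeta> + d *\<^sub>R L \<theta>) (L \<kappa>)"
      using key[OF cz(1) L(1)[OF z(3)] cz(2) L(2)[OF z(3)]] unfolding cz(3) L(3)[OF z(3)] .
    then show "\<beta> (c *\<^sub>R \<zeta> + d *\<^sub>R \<theta>) \<kappa> = c * \<beta> \<zeta> \<kappa> + d * \<beta> \<theta> \<kappa>"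
      unfolding \<beta>_def using alternating_onD(1)[OF a L(1)[OF z(1)] L(1)[OF z(2)] subspace_model L(1)[OF z(3)]] by (rule HOL.trans)
    have "\<beta> \<kappa> (c *\<^sub>R \<zeta> + d *\<^sub>R \<theta>) = \<pi> x (L \<kappa>) (c *\<^sub>R L \<zeta> + d *\<^sub>R L \<theta>)"
      using key[OF L(1)[OF z(3)] cz(1) L(2)[OF z(3)] cz(2)] unfolding cz(3) L(3)[OF z(3)] .
    then show "\<beta> \<kappa> (c *\<^sub>R \<zeta> + d *\<^sub>R \<theta>) = c * \<beta> \<kappa> \<zeta> + d * \<beta> \<kappa> \<theta>"
      unfolding \<beta>_def using alternating_onD(2)[OF a L(1)[OF z(1)] L(1)[OF z(2)] subspace_model L(1)[OF z(3)]] by (rule HOL.trans)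
  next
    fix \<zeta> assume "\<zeta> \<in> ?E"
    then have "L \<zeta> \<in> model M" by (rule L(1))
    then show "\<beta> \<zeta> \<zeta> = 0" using a unfolding \<beta>_def alternating_on_def by simp
  qed
  then show ?thesis using key by (intro exI[of _ \<beta>] conjI ballI impI)
qed

text \<open>A dual family makes the vectors independent, and independent vectors in number equal to
  the dimension span.\<close>

lemma dual_frame_span:
  fixes \<tau> \<theta> :: "'i \<Rightarrow> 'e::euclidean_space"
  assumes I: "finite I" and F: "\<And>i. i \<in> I \<Longrightarrow> \<tau> i \<in> F" and d: "dim F = card I"
    and dual: "\<And>i j. i \<in> I \<Longrightarrow> j \<in> I \<Longrightarrow> \<theta> i \<bullet> \<tau> j = (if i = j then 1 else 0)" and sF: "subspace F"
  shows "F = span (\<tau> ` I)"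
proof -
  have inj: "inj_on \<tau> I" by (rule inj_onI) (metis dual zero_neq_one)
  have "independent (\<tau> ` I)"
  proof (rule independent_if_scalars_zero)
    fix c v assume c: "(\<Sum>v\<in>\<tau> ` I. c v *\<^sub>R v) = 0" and v: "v \<in> \<tau> ` I"
    then obtain i where i: "i \<in> I" "v = \<tau> i" by blast
    have "0 = \<theta> i \<bullet> (\<Sum>j\<in>I. c (\<tau> j) *\<^sub>R \<tau> j)" using c by (simp add: sum.reindex[OF inj])
    also have "\<dots> = (\<Sum>j\<in>I. if j = i then c (\<tau> j) else 0)"
      unfolding inner_sum_right by (rule sum.cong) (use dual i in auto)
    finally show "c v = 0" using i I by simp
  qed (use I in simp)
  moreover have "\<tau> ` I \<subseteq> F" using F by blast
  moreover have "card (\<tau> ` I) = dim F" using card_image[OF inj] d by simp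
  ultimately have "F \<subseteq> span (\<tau> ` I)" using card_eq_dim[of "\<tau> ` I" F] I by simp
  moreover have "span (\<tau> ` I) \<subseteq> F" using span_minimal[OF \<open>\<tau> ` I \<subseteq> F\<close> sF] .
  ultimately show ?thesis by blast
qed

text \<open>The basis is recorded by indices and not by vectors, so that the same selection can be
  followed to neighbouring points, where the family takes other values.\<close>

lemma basis_index_exists:
  fixes \<tau> :: "'i \<Rightarrow> 'e::euclidean_space"
  assumes J: "finite J"
  obtains I where "I \<subseteq> J" "card I = dim (span (\<tau> ` J))" "\<And>c. (\<Sum>i\<in>I. c i *\<^sub>R \<tau> i) = 0 \<Longrightarrow> \<forall>i\<in>I. c i = 0"
proof -
  obtain B where B: "B \<subseteq> \<tau> ` J" "independent B" "\<tau> ` J \<subseteq> span B" "card B = dim (\<tau> ` J)"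
    using basis_exists by blast
  then obtain I where I: "I \<subseteq> J" "inj_on \<tau> I" "B = \<tau> ` I" using subset_image_inj[of B \<tau> J] by blast
  have "\<forall>i\<in>I. c i = 0" if c: "(\<Sum>i\<in>I. c i *\<^sub>R \<tau> i) = 0" for c
  proof
    fix i assume i: "i \<in> I"
    have "(\<Sum>v\<in>B. c (the_inv_into I \<tau> v) *\<^sub>R v) = (\<Sum>i\<in>I. c i *\<^sub>R \<tau> i)"
      unfolding I(3) sum.reindex[OF I(2)] by (rule sum.cong) (simp_all add: the_inv_into_f_f[OF I(2)])
    then have "(\<Sum>v\<in>B. c (the_inv_into I \<tau> v) *\<^sub>R v) = 0" using c by simp
    from independentD[OF B(2) independent_imp_finite[OF B(2)] order_refl this, of "\<tau> i"]
    show "c i = 0" using i I(3) the_inv_into_f_f[OF I(2) i] by simp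
  qed
  then show ?thesis using that[of I] I B(4) card_image[OF I(2)] by simp
qed

section \<open>Local frames and tangent extensions along a submanifold\<close>

lemma sharp_sum:
  assumes a: "alternating_on (model M) (\<pi> x)" and I: "finite I" and e: "\<And>i. i \<in> I \<Longrightarrow> e i \<in> model M"
  shows "sharp M \<pi> x (\<Sum>i\<in>I. c i *\<^sub>R e i) = (\<Sum>i\<in>I. c i *\<^sub>R sharp M \<pi> x (e i))"
proof -
  have "sharp M \<pi> x (\<Sum>i\<in>I. c i *\<^sub>R e i) = (\<Sum>j<mdim M. (\<Sum>i\<in>I. c i * \<pi> x (e i) (coord_vec j)) *\<^sub>R coord_vec j)"
    unfolding sharp_def
    by (rule sum.cong) (simp_all add: alternating_on_sum(1)[OF a subspace_model I e coord_vec_in_model])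
  also have "\<dots> = (\<Sum>i\<in>I. c i *\<^sub>R sharp M \<pi> x (e i))"
    unfolding sharp_def scaleR_sum_left scaleR_sum_right scaleR_scaleR by (rule sum.swap)
  finally show ?thesis .
qed

abbreviation tangent_sharp_sum :: "('a, 'e::euclidean_space) mfd \<Rightarrow> ('a, 'e) bivector_field \<Rightarrow> 'a set \<Rightarrow> 'a \<Rightarrow> 'e set"
  where "tangent_sharp_sum M \<pi> X x \<equiv> {u + v | u v. u \<in> sub_tangent M X x \<and> v \<in> sharp M \<pi> x ` conormal M X x}"

text \<open>A slice chart puts tangent and conormal data into standard position: along
  \<open>X\<close>, the tangent space becomes \<open>coord_space k\<close>, and the conormal space
  is spanned by the differentials of the coordinates with index at least \<open>k\<close>.\<close>

locale slice_bivector =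
  fixes M :: "('a, 'e::euclidean_space) mfd" and \<pi> :: "('a, 'e) bivector_field" and X U \<phi>
  assumes M: "smooth_manifold M" and b: "smooth_bivector M \<pi>" and X: "embedded_submanifold M X"
    and slice: "(U, \<phi>) \<in> slice_charts M X (submfd_dim M X)"
begin

abbreviation "n \<equiv> mdim M"
abbreviation "k \<equiv> submfd_dim M X"
abbreviation "N \<equiv> submfd M X"

lemmas cM = slice_chartD(1)[OF slice]
lemmas chM = slice_chartD(3)[OF slice]
lemmas cN = slice_chart_submfd_atlas(2)[OF M X slice]
lemmas N = smooth_manifold_submfd[OF M X]
lemmas oU = chartD(1)[OF chM]
lemmas sU = smooth_fun_on_chart_self[OF M cM]

definition dcoord :: "nat \<Rightarrow> 'a \<Rightarrow> 'e"
  where "dcoord i y = differential M (\<lambda>z. \<phi> z \<bullet> coord_vec i) y"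

text \<open>Along \<open>X\<close>, a spanning family of TX + sharp(N*X) in the coordinates of the
  chart: the coordinate vectors of the slice, then the Hamiltonian vectors of the transversal
  coordinates. It has \<open>n\<close> members whatever the rank, so in general it is not
  independent.\<close>

definition \<tau> :: "nat \<Rightarrow> 'a \<Rightarrow> 'e"
  where "\<tau> i y = (if i < k then coord_vec i else deriv_at M \<phi> y (sharp M \<pi> y (dcoord i y)))"

lemma alt: "y \<in> U \<Longrightarrow> alternating_on (model M) (\<pi> y)"
  using smooth_bivector_alternating[OF b] chartD(2)[OF chM] by blast

lemma dcoord_model: "dcoord i y \<in> model M"
  unfolding dcoord_def by (rule differential_in_model)

lemma dcoord_inner: "y \<in> U \<Longrightarrow> v \<in> model M \<Longrightarrow> dcoord i y \<bullet> v = deriv_at M \<phi> y v \<bullet> coord_vec i"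
  unfolding dcoord_def by (rule differential_coord_inner[OF M cM])

lemma A_model: "y \<in> U \<Longrightarrow> v \<in> model M \<Longrightarrow> deriv_at M \<phi> y v \<in> model M"
  using deriv_at_in_chart(2)[OF M cM _ _ oU sU] by blast

lemma A_linear: "y \<in> U \<Longrightarrow> linear (deriv_at M \<phi> y)"
  by (rule deriv_at_chart_linear[OF M cM])

lemma A_eq_0: "y \<in> U \<Longrightarrow> v \<in> model M \<Longrightarrow> deriv_at M \<phi> y v = 0 \<Longrightarrow> v = 0"
  using chart_vec(3)[OF M cM, of y v] linear_0[OF chart_vec(4)[OF M cM]] by (metis subspace_0 subspace_model)

lemma k_le_n: "k \<le> n" by (rule submfd_dim_le[OF X])

lemma coord_k_model: "coord_space k \<subseteq> model M"
  using coord_space_mono[OF k_le_n] by (simp add: model_def)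

lemma tangent_iff:
  assumes "y \<in> U" "y \<in> X"
  shows "v \<in> sub_tangent M X y \<longleftrightarrow> v \<in> model M \<and> deriv_at M \<phi> y v \<in> coord_space k"
  using sub_tangent_slice[OF M X assms(2) slice assms(1)] by blast

text \<open>The coordinate vectors supplied by \<open>chart_vec\<close> form the basis dual to the
  coordinate differentials \<open>dcoord\<close>.\<close>

lemma covector_expansion:
  assumes y: "y \<in> U" and \<nu>: "\<nu> \<in> model M"
  shows "\<nu> = (\<Sum>l<n. (\<nu> \<bullet> chart_vec M (U, \<phi>) y (coord_vec l)) *\<^sub>R dcoord l y)"
proof (rule model_eqI[OF M \<nu>])
  let ?B = "chart_vec M (U, \<phi>) y"
  show "(\<Sum>l<n. (\<nu> \<bullet> ?B (coord_vec l)) *\<^sub>R dcoord l y) \<in> model M"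
    by (rule subspace_sum[OF subspace_model], rule subspace_scale[OF subspace_model]) (rule dcoord_model)
  fix v assume v: "v \<in> model M"
  have lB: "linear ?B" by (rule chart_vec(4)[OF M cM y v])
  let ?w = "deriv_at M \<phi> y v"
  have "v = ?B ?w" using chart_vec(3)[OF M cM y v] by simp
  also have "\<dots> = ?B (\<Sum>l<n. (?w \<bullet> coord_vec l) *\<^sub>R coord_vec l)"
    using model_expansion[OF M A_model[OF y v]] by (rule arg_cong)
  also have "\<dots> = (\<Sum>l<n. (?w \<bullet> coord_vec l) *\<^sub>R ?B (coord_vec l))"
    by (simp add: linear_sum[OF lB] linear_scale[OF lB])
  finally have "\<nu> \<bullet> v = \<nu> \<bullet> (\<Sum>l<n. (?w \<bullet> coord_vec l) *\<^sub>R ?B (coord_vec l))" by (rule arg_cong)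
  also have "\<dots> = (\<Sum>l<n. (\<nu> \<bullet> ?B (coord_vec l)) *\<^sub>R dcoord l y) \<bullet> v"
    unfolding inner_sum_left inner_sum_right by (rule sum.cong) (simp_all add: dcoord_inner[OF y v])
  finally show "v \<bullet> \<nu> = v \<bullet> (\<Sum>l<n. (\<nu> \<bullet> ?B (coord_vec l)) *\<^sub>R dcoord l y)" by (simp add: inner_commute)
qed

lemma dcoord_conormal:
  assumes y: "y \<in> U" "y \<in> X" and l: "k \<le> l" "l < n"
  shows "dcoord l y \<in> conormal M X y"
  unfolding conormal_eq annihilator_alt
proof (intro CollectI conjI ballI dcoord_model)
  fix v assume "v \<in> sub_tangent M X y"
  then have v: "v \<in> model M" "deriv_at M \<phi> y v \<in> coord_space k" using tangent_iff[OF y] by auto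
  have "deriv_at M \<phi> y v \<bullet> coord_vec l = 0"
    using coord_space_iff[OF mdim_le[OF M] k_le_n, of "deriv_at M \<phi> y v"] v(2) coord_k_model l unfolding model_def by blast
  then show "dcoord l y \<bullet> v = 0" by (simp add: dcoord_inner[OF y(1) v(1)])
qed

text \<open>The coefficient of \<open>dcoord l\<close> is the value of the covector on the
  coordinate vector with index \<open>l\<close>, which is tangent to \<open>X\<close> for
  \<open>l < k\<close>.\<close>

lemma conormal_expansion:
  assumes y: "y \<in> U" "y \<in> X" and \<nu>: "\<nu> \<in> conormal M X y"
  shows "\<exists>c. \<nu> = (\<Sum>l\<in>{k..<n}. c l *\<^sub>R dcoord l y)"
proof -
  let ?c = "\<lambda>l. \<nu> \<bullet> chart_vec M (U, \<phi>) y (coord_vec l)"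
  have \<nu>': "\<nu> \<in> model M" "\<And>v. v \<in> sub_tangent M X y \<Longrightarrow> \<nu> \<bullet> v = 0"
    using \<nu> by (auto simp: conormal_eq annihilator_alt)
  have "?c l = 0" if "l < k" for l
  proof -
    have m: "coord_vec l \<in> model M" using that k_le_n coord_vec_in_model[of l M] by simp
    have "chart_vec M (U, \<phi>) y (coord_vec l) \<in> sub_tangent M X y"
      unfolding tangent_iff[OF y] using chart_vec(1,2)[OF M cM y(1) m] coord_vec_in_coord_space[OF that] by simp
    then show ?thesis by (rule \<nu>'(2))
  qed
  then have "(\<Sum>l<n. ?c l *\<^sub>R dcoord l y) = (\<Sum>l\<in>{k..<n}. ?c l *\<^sub>R dcoord l y)"
    by (intro sum.mono_neutral_right) auto
  then show ?thesis using covector_expansion[OF y(1) \<nu>'(1)] by (intro exI[of _ ?c]) simp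
qed

lemma subspace_conormal: "subspace (conormal M X y)" "conormal M X y \<subseteq> model M"
  unfolding conormal_eq by (rule subspace_annihilator)+

lemma sharp_conormal_image:
  assumes y: "y \<in> U" "y \<in> X"
  shows "deriv_at M \<phi> y ` (sharp M \<pi> y ` conormal M X y) = span ((\<lambda>l. \<tau> l y) ` {k..<n})"
proof
  have \<tau>: "\<tau> l y = deriv_at M \<phi> y (sharp M \<pi> y (dcoord l y))" if "l \<in> {k..<n}" for l using that by (simp add: \<tau>_def)
  show "deriv_at M \<phi> y ` (sharp M \<pi> y ` conormal M X y) \<subseteq> span ((\<lambda>l. \<tau> l y) ` {k..<n})"
  proof clarify
    fix \<nu> assume "\<nu> \<in> conormal M X y"
    then obtain c where c: "\<nu> = (\<Sum>l\<in>{k..<n}. c l *\<^sub>R dcoord l y)" using conormal_expansion[OF y] by blast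
    have "deriv_at M \<phi> y (sharp M \<pi> y \<nu>) = (\<Sum>l\<in>{k..<n}. c l *\<^sub>R deriv_at M \<phi> y (sharp M \<pi> y (dcoord l y)))"
      unfolding c sharp_sum[where \<pi>=\<pi> and x=y, OF alt[OF y(1)] finite_atLeastLessThan dcoord_model]
      by (simp add: linear_sum[OF A_linear[OF y(1)]] linear_scale[OF A_linear[OF y(1)]])
    also have "\<dots> = (\<Sum>l\<in>{k..<n}. c l *\<^sub>R \<tau> l y)" using \<tau> by simp
    also have "\<dots> \<in> span ((\<lambda>l. \<tau> l y) ` {k..<n})"
      by (rule span_sum, rule span_scale, rule span_base) blast
    finally show "deriv_at M \<phi> y (sharp M \<pi> y \<nu>) \<in> span ((\<lambda>l. \<tau> l y) ` {k..<n})" .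
  qed
  show "span ((\<lambda>l. \<tau> l y) ` {k..<n}) \<subseteq> deriv_at M \<phi> y ` (sharp M \<pi> y ` conormal M X y)"
  proof (rule span_minimal)
    show "subspace (deriv_at M \<phi> y ` (sharp M \<pi> y ` conormal M X y))"
      by (rule linear_subspace_image[OF A_linear[OF y(1)] subspace_sharp_image[where \<pi>=\<pi> and x=y, OF alt[OF y(1)] subspace_conormal]])
    show "(\<lambda>l. \<tau> l y) ` {k..<n} \<subseteq> deriv_at M \<phi> y ` (sharp M \<pi> y ` conormal M X y)"
    proof (rule image_subsetI)
      fix l assume l: "l \<in> {k..<n}"
      show "\<tau> l y \<in> deriv_at M \<phi> y ` (sharp M \<pi> y ` conormal M X y)"
        unfolding \<tau>[OF l] by (intro imageI dcoord_conormal[OF y]) (use l in auto)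
    qed
  qed
qed

lemma tangent_image:
  assumes y: "y \<in> U" "y \<in> X"
  shows "deriv_at M \<phi> y ` sub_tangent M X y = span ((\<lambda>l. \<tau> l y) ` {..<k})"
proof -
  have "deriv_at M \<phi> y ` sub_tangent M X y = coord_space k"
  proof
    show "deriv_at M \<phi> y ` sub_tangent M X y \<subseteq> coord_space k" using tangent_iff[OF y] by blast
    show "coord_space k \<subseteq> deriv_at M \<phi> y ` sub_tangent M X y"
    proof
      fix v :: 'e assume v: "v \<in> coord_space k"
      then have "v \<in> model M" using coord_k_model by blast
      note B = chart_vec(1,2)[OF M cM y(1) this]
      have "chart_vec M (U, \<phi>) y v \<in> sub_tangent M X y" unfolding tangent_iff[OF y] using B v by simp
      then show "v \<in> deriv_at M \<phi> y ` sub_tangent M X y" using B(2) by (metis imageI)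
    qed
  qed
  moreover have "(\<lambda>l. \<tau> l y) ` {..<k} = coord_vec ` {..<k}" by (rule image_cong) (simp_all add: \<tau>_def)
  ultimately show ?thesis by (simp add: coord_space_def)
qed

lemma sum_image:
  assumes y: "y \<in> U" "y \<in> X"
  shows "deriv_at M \<phi> y ` tangent_sharp_sum M \<pi> X y = span ((\<lambda>l. \<tau> l y) ` {..<n})"
proof -
  have "{..<n} = {..<k} \<union> {k..<n}" using k_le_n by auto
  then have "span ((\<lambda>l. \<tau> l y) ` {..<n}) = span ((\<lambda>l. \<tau> l y) ` {..<k} \<union> (\<lambda>l. \<tau> l y) ` {k..<n})"
    by (simp add: image_Un)
  also have "\<dots> = {u + v | u v. u \<in> deriv_at M \<phi> y ` sub_tangent M X y \<and> v \<in> deriv_at M \<phi> y ` (sharp M \<pi> y ` conormal M X y)}"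
    unfolding span_Un tangent_image[OF y] sharp_conormal_image[OF y] by auto
  also have "\<dots> = deriv_at M \<phi> y ` tangent_sharp_sum M \<pi> X y"
  proof (intro equalityI subsetI)
    fix w assume "w \<in> {u + v | u v. u \<in> deriv_at M \<phi> y ` sub_tangent M X y \<and> v \<in> deriv_at M \<phi> y ` (sharp M \<pi> y ` conormal M X y)}"
    then obtain a c where ac: "w = deriv_at M \<phi> y a + deriv_at M \<phi> y c" "a \<in> sub_tangent M X y" "c \<in> sharp M \<pi> y ` conormal M X y"
      by blast
    then have "w = deriv_at M \<phi> y (a + c)" by (simp add: linear_add[OF A_linear[OF y(1)]])
    moreover have "a + c \<in> tangent_sharp_sum M \<pi> X y" using ac by blast
    ultimately show "w \<in> deriv_at M \<phi> y ` tangent_sharp_sum M \<pi> X y" by (rule image_eqI)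
  next
    fix w assume "w \<in> deriv_at M \<phi> y ` tangent_sharp_sum M \<pi> X y"
    then obtain a c where ac: "w = deriv_at M \<phi> y (a + c)" "a \<in> sub_tangent M X y" "c \<in> sharp M \<pi> y ` conormal M X y"
      by blast
    then have "w = deriv_at M \<phi> y a + deriv_at M \<phi> y c" by (simp add: linear_add[OF A_linear[OF y(1)]])
    then show "w \<in> {u + v | u v. u \<in> deriv_at M \<phi> y ` sub_tangent M X y \<and> v \<in> deriv_at M \<phi> y ` (sharp M \<pi> y ` conormal M X y)}"
      using ac by blast
  qed
  finally show ?thesis by simp
qed

lemma subspace_tangent_sharp_sum:
  assumes y: "y \<in> U" "y \<in> X"
  shows "subspace (tangent_sharp_sum M \<pi> X y)" "tangent_sharp_sum M \<pi> X y \<subseteq> model M"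
proof -
  show "subspace (tangent_sharp_sum M \<pi> X y)"
    by (rule subspace_sums[OF subspace_sub_tangent(1)[OF M X y(2)]
      subspace_sharp_image[where \<pi>=\<pi> and x=y, OF alt[OF y(1)] subspace_conormal]])
  show "tangent_sharp_sum M \<pi> X y \<subseteq> model M"
    using subspace_sub_tangent(2)[OF M X y(2)] by (auto intro!: subspace_add[OF subspace_model] sharp_in_model)
qed

lemma dim_span_\<tau>:
  assumes y: "y \<in> U" "y \<in> X"
  shows "dim (span ((\<lambda>l. \<tau> l y) ` {..<n})) = dim (tangent_sharp_sum M \<pi> X y)"
  unfolding sum_image[OF y, symmetric]
  by (rule dim_image_inj_subspace[OF A_linear[OF y(1)] subspace_tangent_sharp_sum(1)[OF y]])
     (use A_eq_0[OF y(1)] subspace_tangent_sharp_sum(2)[OF y] in blast)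

text \<open>The components of the Hamiltonian vector of a coordinate are brackets of coordinate
  functions, which are smooth on \<open>U\<close>.\<close>

lemma \<tau>_smooth:
  assumes "i < n" shows "smooth_fun_on N (U \<inter> X) (\<tau> i)"
proof (cases "i < k")
  case True
  then have "\<tau> i = (\<lambda>_. coord_vec i)" by (simp add: \<tau>_def fun_eq_iff)
  then show ?thesis by (simp add: smooth_fun_on_const)
next
  case False
  let ?b = "\<lambda>m. bracket M \<pi> (\<lambda>z. \<phi> z \<bullet> coord_vec i) (\<lambda>z. \<phi> z \<bullet> coord_vec m)"
  have c: "smooth_fun_on M U (\<lambda>z. \<phi> z \<bullet> coord_vec m)" for m
    by (rule smooth_fun_on_bounded_linear[OF bounded_linear_inner_left sU])
  have "smooth_fun_on M U (\<lambda>y. \<Sum>m<n. ?b m y *\<^sub>R coord_vec m)"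
    by (intro smooth_fun_on_sum smooth_fun_on_bilinear[OF bounded_bilinear_scaleR] smooth_fun_on_const
      smooth_fun_on_bracket[OF M b oU c c])
  then have s: "smooth_fun_on N (U \<inter> X) (\<lambda>y. \<Sum>m<n. ?b m y *\<^sub>R coord_vec m)" by (rule smooth_fun_on_restrict[OF M X oU])
  have "(\<Sum>m<n. ?b m y *\<^sub>R coord_vec m) = \<tau> i y" if "y \<in> U \<inter> X" for y
  proof -
    have y: "y \<in> U" using that by blast
    let ?v = "sharp M \<pi> y (dcoord i y)"
    have v: "?v \<in> model M" by (rule sharp_in_model)
    have "deriv_at M \<phi> y ?v \<bullet> coord_vec m = ?b m y" for m
      using dcoord_inner[OF y v, of m] sharp_inner[where \<pi>=\<pi> and x=y, OF M alt[OF y] dcoord_model[of i y] dcoord_model[of m y]]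
      by (simp add: bracket_def dcoord_def)
    then have "(\<Sum>m<n. ?b m y *\<^sub>R coord_vec m) = (\<Sum>m<n. (deriv_at M \<phi> y ?v \<bullet> coord_vec m) *\<^sub>R coord_vec m)" by simp
    also have "\<dots> = deriv_at M \<phi> y ?v" using model_expansion[OF M A_model[OF y v]] by (rule sym)
    finally show ?thesis using False by (simp add: \<tau>_def)
  qed
  then show ?thesis by (rule smooth_fun_on_cong[OF N _ s])
qed

text \<open>Constant rank argument: members of the family that form a basis at \<open>x\<close> stay
  independent nearby, as their dual frame shows. Since the dimension is \<open>r\<close> at every
  point of \<open>X\<close>, they still span there.\<close>

lemma frame:
  assumes x: "x \<in> U" "x \<in> X" and r: "\<forall>y\<in>X. dim (tangent_sharp_sum M \<pi> X y) = r"
  shows "\<exists>W I \<theta>. openin (mtop N) W \<and> x \<in> W \<and> W \<subseteq> U \<inter> X \<and> I \<subseteq> {..<n} \<and> card I = r \<and>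
    (\<forall>i\<in>I. smooth_fun_on N W (\<theta> i)) \<and>
    (\<forall>y\<in>W. \<forall>i\<in>I. \<forall>j\<in>I. \<theta> i y \<bullet> \<tau> j y = (if i = j then 1 else 0)) \<and>
    (\<forall>y\<in>W. span ((\<lambda>i. \<tau> i y) ` {..<n}) = span ((\<lambda>i. \<tau> i y) ` I))"
proof -
  obtain I where I: "I \<subseteq> {..<n}" "card I = dim (span ((\<lambda>i. \<tau> i x) ` {..<n}))"
    and ind: "\<And>c. (\<Sum>i\<in>I. c i *\<^sub>R \<tau> i x) = 0 \<Longrightarrow> \<forall>i\<in>I. c i = 0"
    using basis_index_exists[of "{..<n}" "\<lambda>i. \<tau> i x"] by auto
  have cI: "card I = r" using I(2) dim_span_\<tau>[OF x] r x(2) by simp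
  have fI: "finite I" using I(1) finite_subset by blast
  let ?E = "coord_space k :: 'e set" and ?S = "\<phi> ` (U \<inter> X)" and ?inv = "inv_into (U \<inter> X) \<phi>"
  note chN = max_atlas_chart[OF cN]
  have S: "openin (top_of_set ?E) ?S" using chartD(4)[OF chN] by simp
  have inv: "?inv (\<phi> y) = y" if "y \<in> U \<inter> X" for y using inv_into_f_f[OF chartD(3)[OF chN] that] .
  have xS: "\<phi> x \<in> ?S" using x by blast
  have sm: "smooth_on ?E ?S (\<tau> i \<circ> ?inv)" if "i \<in> I" for i
  proof -
    have "i < n" using that I(1) by auto
    from smooth_fun_onD[OF N chartD(1)[OF chN] \<tau>_smooth[OF this] cN] show ?thesis by simp
  qed
  \<comment> \<open>The dual frame is built on the coordinate image of \<open>U \<inter> X\<close>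
    inside \<open>coord_space k\<close> and is later pulled back by the chart to an open set of
    \<open>X\<close>.\<close>
  have "\<exists>T \<theta>. openin (top_of_set ?E) T \<and> \<phi> x \<in> T \<and> T \<subseteq> ?S \<and>
    (\<forall>z\<in>T. \<forall>i\<in>I. \<forall>j\<in>I. \<theta> i z \<bullet> (\<tau> j \<circ> ?inv) z = (if i = j then 1 else 0)) \<and>
    (\<forall>m. (\<forall>i\<in>I. Ck_on m ?E ?S (\<tau> i \<circ> ?inv)) \<longrightarrow> (\<forall>i\<in>I. Ck_on m ?E T (\<theta> i)))"
  proof (rule Ck_on_dual_frame[OF subspace_coord_space S xS fI])
    show "continuous_on ?S (\<tau> i \<circ> ?inv)" if "i \<in> I" for i by (rule smooth_on_continuous[OF sm[OF that]])
    show "\<forall>i\<in>I. c i = 0" if "(\<Sum>i\<in>I. c i *\<^sub>R (\<tau> i \<circ> ?inv) (\<phi> x)) = 0" for c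
      using ind[of c] that inv[of x] x by simp
  qed
  then obtain T \<theta> where T: "openin (top_of_set ?E) T" "\<phi> x \<in> T" "T \<subseteq> ?S"
    and dual: "\<forall>z\<in>T. \<forall>i\<in>I. \<forall>j\<in>I. \<theta> i z \<bullet> (\<tau> j \<circ> ?inv) z = (if i = j then 1 else 0)"
    and sth: "\<forall>m. (\<forall>i\<in>I. Ck_on m ?E ?S (\<tau> i \<circ> ?inv)) \<longrightarrow> (\<forall>i\<in>I. Ck_on m ?E T (\<theta> i))"
    by (elim exE conjE)
  have sth': "smooth_on ?E T (\<theta> i)" if "i \<in> I" for i
    using sth sm that unfolding smooth_on_def by simp
  define W where "W = {y\<in>U \<inter> X. \<phi> y \<in> T}"
  have W: "openin (mtop N) W" unfolding W_def by (rule chart_preimage_open[OF chN]) (use T(1) in simp)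
  have WU: "W \<subseteq> U \<inter> X" by (auto simp: W_def)
  have xW: "x \<in> W" using x T(2) by (simp add: W_def)
  have \<theta>s: "smooth_fun_on N W (\<lambda>y. \<theta> i (\<phi> y))" if "i \<in> I" for i
    by (rule smooth_fun_on_chart[OF N cN W WU], simp, rule smooth_on_subset[OF sth'[OF that]]) (auto simp: W_def)
  have d: "\<theta> i (\<phi> y) \<bullet> \<tau> j y = (if i = j then 1 else 0)" if "y \<in> W" "i \<in> I" "j \<in> I" for y i j
  proof -
    have yT: "\<phi> y \<in> T" and yU: "y \<in> U \<inter> X" using that(1) by (auto simp: W_def)
    show ?thesis using dual[rule_format, OF yT that(2,3)] inv[OF yU] by simp
  qed
  have sp: "span ((\<lambda>i. \<tau> i y) ` {..<n}) = span ((\<lambda>i. \<tau> i y) ` I)" if "y \<in> W" for y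
  proof (rule dual_frame_span[OF fI, where \<theta>="\<lambda>i. \<theta> i (\<phi> y)"])
    have yU: "y \<in> U" "y \<in> X" using that by (auto simp: W_def)
    show "dim (span ((\<lambda>i. \<tau> i y) ` {..<n})) = card I" using dim_span_\<tau>[OF yU] r yU(2) cI by simp
    show "\<tau> i y \<in> span ((\<lambda>i. \<tau> i y) ` {..<n})" if "i \<in> I" for i
      by (rule span_base) (use that I(1) in blast)
    show "\<theta> i (\<phi> y) \<bullet> \<tau> j y = (if i = j then 1 else 0)" if "i \<in> I" "j \<in> I" for i j
      by (rule d[OF \<open>y \<in> W\<close> that])
  qed simp
  show ?thesis
    by (rule exI[of _ W], rule exI[of _ I], rule exI[of _ "\<lambda>i y. \<theta> i (\<phi> y)"])
       (intro conjI ballI; (rule W xW WU I(1) cI \<theta>s d sp; assumption)?)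
qed

text \<open>The selected members of the family are carried from chart coordinates back to tangent
  vectors. In another chart of \<open>M\<close> their components come from the derivative of the
  transition, whose coefficients are smooth.\<close>

lemma local_sections:
  assumes x: "x \<in> U" "x \<in> X" and r: "\<forall>y\<in>X. dim (tangent_sharp_sum M \<pi> X y) = r"
  shows "\<exists>W s. openin (mtop N) W \<and> x \<in> W \<and>
    (\<forall>i<r. \<forall>(V, \<psi>)\<in>atlas M. smooth_fun_on N (W \<inter> V) (\<lambda>y. deriv_at M \<psi> y (s i y))) \<and>
    (\<forall>y\<in>W. tangent_sharp_sum M \<pi> X y = span ((\<lambda>i. s i y) ` {..<r}) \<and> dim (tangent_sharp_sum M \<pi> X y) = r)"
proof -
  obtain W I \<theta> where W: "openin (mtop N) W" "x \<in> W" "W \<subseteq> U \<inter> X" and I: "I \<subseteq> {..<n}" "card I = r"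
    and sp: "\<forall>y\<in>W. span ((\<lambda>i. \<tau> i y) ` {..<n}) = span ((\<lambda>i. \<tau> i y) ` I)"
    using frame[OF x r] by (elim exE conjE)
  have "finite I" using I(1) finite_subset by blast
  then obtain e where e: "bij_betw e {0..<r} I" using ex_bij_betw_nat_finite I(2) by blast
  have eI: "e i \<in> I" if "i < r" for i using e that bij_betwE by fastforce
  have eim: "e ` {..<r} = I" using e by (simp add: bij_betw_def atLeast0LessThan)
  let ?B = "chart_vec M (U, \<phi>)"
  define s where "s i y = ?B y (\<tau> (e i) y)" for i y
  have \<tau>m: "\<tau> l y \<in> model M" if "y \<in> U" "l < n" for l y
    using A_model[OF that(1) sharp_in_model] coord_vec_in_model[OF that(2)] by (simp add: \<tau>_def)
  have sm: "smooth_fun_on N (W \<inter> V) (\<lambda>y. deriv_at M \<psi> y (s i y))" if i: "i < r" and V: "(V, \<psi>) \<in> atlas M" for i V \<psi>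
  proof -
    note mV = smooth_manifoldD(7)[OF M V]
    note oV = chartD(1)[OF max_atlas_chart[OF mV]] and sV = smooth_fun_on_chart_self[OF M mV]
    have en: "e i < n" using eI[OF i] I(1) by auto
    have oUV: "openin (mtop M) (U \<inter> V)" using oU oV by blast
    have "smooth_fun_on N (U \<inter> V \<inter> X) (\<lambda>y. chart_deriv (U, \<phi>) \<psi> y (coord_vec m))" if "m < n" for m
      by (rule smooth_fun_on_restrict[OF M X oUV smooth_fun_on_chart_deriv[OF M cM oV sV coord_vec_in_model[OF that]]])
    then have 1: "smooth_fun_on N (W \<inter> V) (\<lambda>y. chart_deriv (U, \<phi>) \<psi> y (coord_vec m))" if "m < n" for m
      by (rule smooth_fun_on_subset) (use that W(3) in auto)
    have 2: "smooth_fun_on N (W \<inter> V) (\<tau> (e i))" by (rule smooth_fun_on_subset[OF \<tau>_smooth[OF en]]) (use W(3) in auto)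
    have "smooth_fun_on N (W \<inter> V) (\<lambda>y. \<Sum>m<n. (\<tau> (e i) y \<bullet> coord_vec m) *\<^sub>R chart_deriv (U, \<phi>) \<psi> y (coord_vec m))"
      by (intro smooth_fun_on_sum smooth_fun_on_bilinear[OF bounded_bilinear_scaleR] 
        smooth_fun_on_bounded_linear[OF bounded_linear_inner_left 2] 1) auto
    then show ?thesis
    proof (rule smooth_fun_on_cong[OF N, rotated])
      fix y assume y: "y \<in> W \<inter> V"
      then have yU: "y \<in> U" "y \<in> V" using W(3) by auto
      note \<tau>y = \<tau>m[OF yU(1) en]
      note B = chart_vec(1,2)[OF M cM yU(1) \<tau>y]
      have lin: "linear (chart_deriv (U, \<phi>) \<psi> y)" by (rule chart_deriv_linear[OF M cM oV sV yU])
      have "deriv_at M \<psi> y (s i y) = chart_deriv (U, \<phi>) \<psi> y (\<tau> (e i) y)"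
        using deriv_at_in_chart(1)[OF M cM yU oV sV B(1)] B(2) by (simp add: s_def)
      also have "\<dots> = chart_deriv (U, \<phi>) \<psi> y (\<Sum>m<n. (\<tau> (e i) y \<bullet> coord_vec m) *\<^sub>R coord_vec m)"
        using model_expansion[OF M \<tau>y] by (rule arg_cong)
      also have "\<dots> = (\<Sum>m<n. (\<tau> (e i) y \<bullet> coord_vec m) *\<^sub>R chart_deriv (U, \<phi>) \<psi> y (coord_vec m))"
        by (simp add: linear_sum[OF lin] linear_scale[OF lin])
      finally show "(\<Sum>m<n. (\<tau> (e i) y \<bullet> coord_vec m) *\<^sub>R chart_deriv (U, \<phi>) \<psi> y (coord_vec m)) = deriv_at M \<psi> y (s i y)" by simp
    qed
  qed
  have sps: "tangent_sharp_sum M \<pi> X y = span ((\<lambda>i. s i y) ` {..<r})" if y: "y \<in> W" for y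
  proof -
    have yU: "y \<in> U" "y \<in> X" using y W(3) by auto
    let ?F = "tangent_sharp_sum M \<pi> X y"
    have lB: "linear (?B y)" using chart_vec(4)[OF M cM yU(1) subspace_0[OF subspace_model]] .
    have "?F = ?B y ` (deriv_at M \<phi> y ` ?F)"
      using chart_vec(3)[OF M cM yU(1)] subspace_tangent_sharp_sum(2)[OF yU] by (force simp: image_image)
    also have "\<dots> = ?B y ` span ((\<lambda>i. \<tau> i y) ` I)" unfolding sum_image[OF yU] using sp y by simp
    also have "\<dots> = span (?B y ` ((\<lambda>i. \<tau> i y) ` e ` {..<r}))" unfolding eim linear_span_image[OF lB] ..
    also have "?B y ` ((\<lambda>i. \<tau> i y) ` e ` {..<r}) = (\<lambda>i. s i y) ` {..<r}" by (simp add: image_image s_def)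
    finally show ?thesis .
  qed
  show ?thesis
  proof (rule exI[of _ W], rule exI[of _ s], intro conjI ballI allI impI)
    show "openin (mtop N) W" "x \<in> W" using W by auto
    show "case c of (V, \<psi>) \<Rightarrow> smooth_fun_on N (W \<inter> V) (\<lambda>y. deriv_at M \<psi> y (s i y))" if "i < r" "c \<in> atlas M" for i c
      using sm[of i "fst c" "snd c"] that by (simp add: split_beta)
    fix y assume y: "y \<in> W"
    show "tangent_sharp_sum M \<pi> X y = span ((\<lambda>i. s i y) ` {..<r})" by (rule sps[OF y])
    have "y \<in> X" using y W(3) by blast
    then show "dim (tangent_sharp_sum M \<pi> X y) = r" using r by blast
  qed
qed

lemma inner_span_eq_0:
  fixes \<alpha> :: "'c::euclidean_space"
  assumes "\<And>s. s \<in> S \<Longrightarrow> \<alpha> \<bullet> s = 0" "w \<in> span S" shows "\<alpha> \<bullet> w = 0"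
  using assms(2)
proof (induction rule: span_induct)
  case base show ?case by (simp add: subspace_hyperplane)
qed (use assms(1) in blast)

text \<open>In slice coordinates the extension is affine in the transversal directions:
  \<open>f\<close> at the projected point plus the pairing of the transversal displacement with a
  covector field \<open>\<alpha>\<close> along \<open>X\<close>. Its differential on
  \<open>X\<close> is \<open>\<alpha>\<close>, so \<open>\<alpha>\<close> has to restrict to df on
  TX and to vanish on sharp(N*X). Transversality provides such a covector, constancy of the rank
  makes it smooth.\<close>

lemma extend_tangent:
  fixes f :: "'a \<Rightarrow> real"
  assumes x: "x \<in> U" "x \<in> X" and r: "\<forall>y\<in>X. dim (tangent_sharp_sum M \<pi> X y) = r"
    and tr: "\<forall>y\<in>X. sharp M \<pi> y ` conormal M X y \<inter> sub_tangent M X y = {0}"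
    and Q: "openin (mtop N) Q" "x \<in> Q" and f: "smooth_fun_on N Q f"
  shows "\<exists>G F. openin (mtop M) G \<and> x \<in> G \<and> smooth_fun_on M G F \<and>
    (\<forall>y\<in>G \<inter> X. y \<in> Q \<and> F y = f y \<and> sharp M \<pi> y (differential M F y) \<in> sub_tangent M X y)"
proof -
  obtain W I \<theta> where W: "openin (mtop N) W" "x \<in> W" "W \<subseteq> U \<inter> X" and I: "I \<subseteq> {..<n}" "card I = r"
    and \<theta>: "\<forall>i\<in>I. smooth_fun_on N W (\<theta> i)"
    and dual: "\<forall>y\<in>W. \<forall>i\<in>I. \<forall>j\<in>I. \<theta> i y \<bullet> \<tau> j y = (if i = j then 1 else 0)"
    and sp: "\<forall>y\<in>W. span ((\<lambda>i. \<tau> i y) ` {..<n}) = span ((\<lambda>i. \<tau> i y) ` I)"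
    using frame[OF x r] by (elim exE conjE)
  have fI: "finite I" using I(1) finite_subset by blast
  let ?E = "coord_space k :: 'e set" and ?P = "coord_proj k :: 'e \<Rightarrow> 'e" and ?inv = "inv_into (U \<inter> X) \<phi>"
  note chN = max_atlas_chart[OF cN]
  have kD: "k \<le> DIM('e)" using k_le_n mdim_le[OF M] by simp
  have inv: "?inv (\<phi> y) = y" if "y \<in> U \<inter> X" for y using inv_into_f_f[OF chartD(3)[OF chN] that] .
  have invU: "inv_into U \<phi> (\<phi> y) = y" if "y \<in> U" for y using inv_into_f_f[OF chartD(3)[OF chM] that] .
  let ?Q = "W \<inter> Q"
  have oQ: "openin (mtop N) ?Q" using W(1) Q(1) by blast
  \<comment> \<open>The values wanted for \<open>\<alpha>\<close> on the spanning family: partial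
    derivatives of \<open>f\<close> on the coordinate vectors of the slice, zero on the Hamiltonian
    vectors.\<close>
  define \<gamma> where "\<gamma> i y = (if i < k then chart_deriv (U \<inter> X, \<phi>) f y (coord_vec i) else 0)" for i y
  define \<alpha> where "\<alpha> y = (\<Sum>i\<in>I. \<gamma> i y *\<^sub>R \<theta> i y)" for y
  have "smooth_fun_on N ?Q (\<gamma> i)" for i
  proof (cases "i < k")
    case True
    have "smooth_fun_on N (U \<inter> X \<inter> Q) (\<lambda>y. chart_deriv (U \<inter> X, \<phi>) f y (coord_vec i))"
      by (rule smooth_fun_on_chart_deriv[OF N cN Q(1) f]) (use True in \<open>simp add: coord_vec_in_coord_space\<close>)
    then have "smooth_fun_on N ?Q (\<lambda>y. chart_deriv (U \<inter> X, \<phi>) f y (coord_vec i))"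
      by (rule smooth_fun_on_subset) (use W(3) in auto)
    then show ?thesis using True by (simp add: \<gamma>_def[abs_def])
  next
    case False then show ?thesis by (simp add: \<gamma>_def[abs_def] smooth_fun_on_const)
  qed
  then have \<alpha>s: "smooth_fun_on N ?Q \<alpha>"
    unfolding \<alpha>_def[abs_def]
    by (intro smooth_fun_on_sum smooth_fun_on_bilinear[OF bounded_bilinear_scaleR]) (use \<theta> in \<open>auto intro: smooth_fun_on_subset\<close>)
  \<comment> \<open>By construction \<open>\<alpha>\<close> has the wanted values on the members
    with index in \<open>I\<close>. For the remaining ones it is compared with a covector
    \<open>\<beta>\<close> that has all the wanted values and exists by transversality: the two
    agree on the members in \<open>I\<close>, hence on their span.\<close>
  have key: "\<alpha> y \<bullet> \<tau> i y = \<gamma> i y" if y: "y \<in> W" and i: "i < n" for y i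
  proof -
    have yU: "y \<in> U" "y \<in> X" using y W(3) by auto
    let ?C = "span ((\<lambda>l. \<tau> l y) ` {k..<n})"
    have CM: "?C \<subseteq> model M"
      unfolding sharp_conormal_image[OF yU, symmetric] by (auto intro!: A_model[OF yU(1)] sharp_in_model)
    have EC: "v = 0" if v: "v \<in> ?E" "v \<in> ?C" for v
    proof -
      obtain w where w: "w \<in> sharp M \<pi> y ` conormal M X y" "v = deriv_at M \<phi> y w"
        using v(2) unfolding sharp_conormal_image[OF yU, symmetric] by (rule imageE)
      have "w \<in> model M" using w(1) by (auto intro: sharp_in_model)
      then have "w \<in> sub_tangent M X y" unfolding tangent_iff[OF yU] using v(1) w(2) by simp
      then have "w \<in> sharp M \<pi> y ` conormal M X y \<inter> sub_tangent M X y" using w(1) by (rule IntI[rotated])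
      then have "w = 0" using bspec[OF tr yU(2)] by simp
      then show ?thesis using w(2) linear_0[OF A_linear[OF yU(1)]] by simp
    qed
    let ?\<xi> = "\<Sum>j<k. \<gamma> j y *\<^sub>R coord_vec j :: 'e"
    have \<xi>: "?\<xi> \<in> model M"
      by (rule subspace_sum[OF subspace_model], rule subspace_scale[OF subspace_model], rule coord_vec_in_model)
         (use k_le_n in auto)
    have "\<exists>\<beta>\<in>model M. (\<forall>v\<in>?E. \<beta> \<bullet> v = ?\<xi> \<bullet> v) \<and> (\<forall>v\<in>?C. \<beta> \<bullet> v = 0)"
      by (rule extend_covector[OF subspace_model subspace_coord_space coord_k_model subspace_span CM EC \<xi>])
    then obtain \<beta> where \<beta>: "\<forall>v\<in>?E. \<beta> \<bullet> v = ?\<xi> \<bullet> v" "\<forall>v\<in>?C. \<beta> \<bullet> v = 0" by (elim bexE conjE)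
    have \<beta>\<tau>: "\<beta> \<bullet> \<tau> l y = \<gamma> l y" if l: "l < n" for l
    proof (cases "l < k")
      case True
      have "\<beta> \<bullet> coord_vec l = ?\<xi> \<bullet> coord_vec l" using \<beta>(1) coord_vec_in_coord_space[OF True] by blast
      also have "\<dots> = (\<Sum>j<k. if j = l then \<gamma> j y else 0)"
        unfolding inner_sum_left by (rule sum.cong) (use True kD in \<open>auto simp: inner_coord_vec\<close>)
      finally show ?thesis using True by (simp add: \<tau>_def)
    next
      case False
      have "\<tau> l y \<in> ?C" by (rule span_base) (use False l in auto)
      then show ?thesis using \<beta>(2) False by (simp add: \<gamma>_def)
    qed
    have \<alpha>\<tau>: "\<alpha> y \<bullet> \<tau> l y = \<gamma> l y" if l: "l \<in> I" for l
    proof -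
      have "\<alpha> y \<bullet> \<tau> l y = (\<Sum>j\<in>I. \<gamma> j y * (\<theta> j y \<bullet> \<tau> l y))" by (simp add: \<alpha>_def inner_sum_left)
      also have "\<dots> = (\<Sum>j\<in>I. if j = l then \<gamma> j y else 0)" by (rule sum.cong) (use dual y l in auto)
      finally show ?thesis using l fI by simp
    qed
    have "(\<alpha> y - \<beta>) \<bullet> \<tau> i y = 0"
    proof (rule inner_span_eq_0)
      show "\<tau> i y \<in> span ((\<lambda>i. \<tau> i y) ` I)"
        using sp y i span_base[of "\<tau> i y" "(\<lambda>i. \<tau> i y) ` {..<n}"] by auto
      fix s assume "s \<in> (\<lambda>i. \<tau> i y) ` I"
      then obtain l where l: "l \<in> I" "s = \<tau> l y" by blast
      then show "(\<alpha> y - \<beta>) \<bullet> s = 0" using \<alpha>\<tau>[OF l(1)] \<beta>\<tau>[of l] I(1) by (auto simp: inner_diff_left)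
    qed
    then show ?thesis using \<beta>\<tau>[OF i] by (simp add: inner_diff_left)
  qed
  define f1 where "f1 = f \<circ> ?inv"
  define \<alpha>1 where "\<alpha>1 = \<alpha> \<circ> ?inv"
  let ?S = "\<phi> ` (U \<inter> X \<inter> ?Q)"
  have oS: "openin (top_of_set ?E) ?S"
  proof -
    have "openin (mtop N) (U \<inter> X \<inter> ?Q)" using chartD(1)[OF chN] oQ by (rule openin_Int)
    from chart_image_open[OF chN this Int_lower1] show ?thesis by (simp only: submfd_simps)
  qed
  have f1s: "smooth_on ?E ?S f1"
    using smooth_fun_onD[OF N oQ smooth_fun_on_subset[OF f Int_lower2] cN] unfolding f1_def by (simp only: submfd_simps)
  have \<alpha>1s: "smooth_on ?E ?S \<alpha>1"
    using smooth_fun_onD[OF N oQ \<alpha>s cN] unfolding \<alpha>1_def by (simp only: submfd_simps)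
  obtain B where B: "open B" "?S = ?E \<inter> B" using oS by (auto simp: openin_open)
  have PE: "?P v \<in> ?E" for v by (rule coord_proj_in_coord_space)
  have Pid: "?P v = v" if "v \<in> ?E" for v by (rule coord_proj_ident[OF kD that])
  \<comment> \<open>The points whose projection falls into the part of the slice where
    \<open>f\<close> and \<open>\<alpha>\<close> are available.\<close>
  define D where "D = {z\<in>model M. ?P z \<in> B}"
  have linP: "linear ?P" by (rule linear_coord_proj)
  have contP: "continuous_on UNIV ?P" using linP by (simp add: linear_continuous_on linear_conv_bounded_linear)
  have "open (?P -` B)" using B(1) contP by (rule open_vimage)
  then have oD: "openin (top_of_set (model M)) D"
  proof -
    have "D = model M \<inter> ?P -` B" by (auto simp: D_def)
    then show ?thesis using openin_open_Int[OF \<open>open (?P -` B)\<close>, of "model M"] by simp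
  qed
  have PD: "?P ` D \<subseteq> ?S" unfolding B(2) D_def using PE by blast
  define F1 where "F1 z = f1 (?P z) + (z - ?P z) \<bullet> \<alpha>1 (?P z)" for z
  have Ps: "smooth_on (model M) D ?P" by (rule smooth_on_linear[OF linear_coord_proj])
  have SE: "?S \<subseteq> ?E" using B(2) by blast
  have lin1: "linear (\<lambda>z. z - ?P z)"
    by (rule linear_compose_sub[OF linear_ident linP])
  have "smooth_on (model M) D F1"
    unfolding F1_def
    by (rule smooth_on_add[OF smooth_on_compose[OF subspace_model oD subspace_coord_space SE PD Ps f1s]
        smooth_on_bilinear[OF bounded_bilinear_inner smooth_on_linear[OF lin1]
          smooth_on_compose[OF subspace_model oD subspace_coord_space SE PD Ps \<alpha>1s]]])
  moreover define G where "G = {y\<in>U. \<phi> y \<in> D}"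
  moreover define F where "F y = F1 (\<phi> y)" for y
  have oG: "openin (mtop M) G" unfolding G_def by (rule chart_preimage_open[OF chM oD])
  ultimately have Fs: "smooth_fun_on M G F"
    unfolding F_def[abs_def] by (intro smooth_fun_on_chart[OF M cM oG]) (auto simp: G_def intro: smooth_on_subset)
  have "\<phi> x \<in> ?S" using x W(2) Q(2) by blast
  then have "\<phi> x \<in> ?E" "\<phi> x \<in> B" unfolding B(2) by auto
  then have xG: "x \<in> G" using x(1) Pid[of "\<phi> x"] coord_k_model by (auto simp: G_def D_def)
  have main: "y \<in> Q \<and> F y = f y \<and> sharp M \<pi> y (differential M F y) \<in> sub_tangent M X y" if y: "y \<in> G" "y \<in> X" for y
  proof -
    have yU: "y \<in> U" "y \<in> X" and yD: "\<phi> y \<in> D" using y by (auto simp: G_def)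
    have yE: "\<phi> y \<in> ?E" using slice_chartD(4)[OF slice yU(1)] yU(2) by simp
    have Py: "?P (\<phi> y) = \<phi> y" by (rule Pid[OF yE])
    have yS: "\<phi> y \<in> ?S" using PD yD Py by force
    then obtain w where "w \<in> U \<inter> X \<inter> ?Q" "\<phi> y = \<phi> w" by blast
    then have yW: "y \<in> W" "y \<in> Q" using inj_onD[OF chartD(3)[OF chM], of y w] yU(1) by auto
    have yUX: "y \<in> U \<inter> X" using yU by blast
    have Ff: "F y = f y" by (simp add: F_def F1_def Py f1_def inv[OF yUX])
    let ?f' = "chart_deriv (U \<inter> X, \<phi>) f y" and ?a' = "chart_deriv (U \<inter> X, \<phi>) \<alpha> y"
    have df: "(f1 has_derivative ?f') (at (\<phi> y) within ?S)"
      unfolding f1_def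
      by (rule has_derivative_subset[OF chart_has_derivative[OF N cN Q(1) f yUX yW(2)]]) auto
    have da: "(\<alpha>1 has_derivative ?a') (at (\<phi> y) within ?S)"
      unfolding \<alpha>1_def
      by (rule has_derivative_subset[OF chart_has_derivative[OF N cN oQ \<alpha>s yUX]]) (use yW in auto)
    let ?S' = "\<phi> ` (U \<inter> G)"
    have S'D: "?S' \<subseteq> D" by (auto simp: G_def)
    have dP: "(?P has_derivative ?P) (at (\<phi> y) within ?S')"
      using linP by (simp add: bounded_linear_imp_has_derivative linear_conv_bounded_linear)
    have PS': "?P ` ?S' \<subseteq> ?S" using PD S'D by blast
    have c1: "((\<lambda>z. f1 (?P z)) has_derivative (\<lambda>v. ?f' (?P v))) (at (\<phi> y) within ?S')"
      by (rule has_derivative_in_compose[OF dP], rule has_derivative_subset[OF _ PS']) (simp add: Py df)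
    have c2: "((\<lambda>z. \<alpha>1 (?P z)) has_derivative (\<lambda>v. ?a' (?P v))) (at (\<phi> y) within ?S')"
      by (rule has_derivative_in_compose[OF dP], rule has_derivative_subset[OF _ PS']) (simp add: Py da)
    have c3: "((\<lambda>z. z - ?P z) has_derivative (\<lambda>v. v - ?P v)) (at (\<phi> y) within ?S')"
      by (rule has_derivative_diff[OF has_derivative_ident dP])
    \<comment> \<open>At a point of the slice the displacement
      \<open>\<phi> y - ?P (\<phi> y)\<close> is zero, so the derivative of \<open>\<alpha>1\<close>
      will drop out.\<close>
    have dF1: "(F1 has_derivative (\<lambda>v. ?f' (?P v) + ((\<phi> y - ?P (\<phi> y)) \<bullet> ?a' (?P v) + (v - ?P v) \<bullet> \<alpha>1 (?P (\<phi> y)))))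
      (at (\<phi> y) within ?S')"
      unfolding F1_def by (rule has_derivative_add[OF c1 has_derivative_inner[OF c3 c2]])
    have dF: "(F \<circ> inv_into U \<phi> has_derivative (\<lambda>v. ?f' (?P v) + (v - ?P v) \<bullet> \<alpha> y)) (at (\<phi> y) within ?S')"
    proof (rule has_derivative_transform[where f=F1])
      show "\<phi> y \<in> ?S'" using y yU by blast
      show "(F \<circ> inv_into U \<phi>) z = F1 z" if "z \<in> ?S'" for z using that invU by (auto simp: F_def)
      show "(F1 has_derivative (\<lambda>v. ?f' (?P v) + (v - ?P v) \<bullet> \<alpha> y)) (at (\<phi> y) within ?S')"
        using dF1 by (simp add: Py \<alpha>1_def inv[OF yUX])
    qed
    have lf: "linear ?f'" using df by (rule has_derivative_linear)
    \<comment> \<open>The first \<open>k\<close> members of the family are coordinate vectors, so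
      \<open>\<alpha>\<close> and the derivative of \<open>f\<close> agree along the slice. With the
      transversal term added, the differential of \<open>F\<close> at \<open>y\<close> is
      \<open>\<alpha> y\<close> read in the chart.\<close>
    have fP: "?f' (?P v) = \<alpha> y \<bullet> ?P v" for v
    proof -
      have "?f' (?P v) = (\<Sum>i<k. (v \<bullet> coord_vec i) * ?f' (coord_vec i))"
        unfolding coord_proj_def by (simp add: linear_sum[OF lf] linear_scale[OF lf])
      also have "\<dots> = (\<Sum>i<k. (v \<bullet> coord_vec i) * (\<alpha> y \<bullet> coord_vec i))"
      proof (rule sum.cong)
        fix i assume "i \<in> {..<k}"
        then have i: "i < k" "i < n" using k_le_n by auto
        show "(v \<bullet> coord_vec i) * ?f' (coord_vec i) = (v \<bullet> coord_vec i) * (\<alpha> y \<bullet> coord_vec i)"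
          using key[OF yW(1) i(2)] i(1) by (simp add: \<tau>_def \<gamma>_def)
      qed simp
      also have "\<dots> = \<alpha> y \<bullet> ?P v" by (simp add: coord_proj_def inner_sum_right)
      finally show ?thesis .
    qed
    have dFv: "differential M F y \<bullet> v = \<alpha> y \<bullet> deriv_at M \<phi> y v" if v: "v \<in> model M" for v
    proof -
      note w = A_model[OF yU(1) v]
      have "chart_deriv (U, \<phi>) F y (deriv_at M \<phi> y v) = \<alpha> y \<bullet> deriv_at M \<phi> y v"
        using chart_deriv_eqI[OF M cM oG yU(1) y(1) dF w] fP[of "deriv_at M \<phi> y v"]
        by (simp add: inner_diff_left inner_diff_right inner_commute)
      then show ?thesis
        using differential_inner[OF M oG Fs y(1) v] deriv_at_in_chart(1)[OF M cM yU(1) y(1) oG Fs v] by simp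
    qed
    have "sharp M \<pi> y (differential M F y) \<in> sub_tangent M X y"
    proof (rule sharp_in_subspaceI[where \<pi>=\<pi> and x=y, OF M alt[OF yU(1)] subspace_sub_tangent(1,2)[OF M X yU(2)] differential_in_model])
      fix \<nu> assume "\<nu> \<in> annihilator M y (sub_tangent M X y)"
      then have "deriv_at M \<phi> y (sharp M \<pi> y \<nu>) \<in> span ((\<lambda>l. \<tau> l y) ` {k..<n})"
        unfolding sharp_conormal_image[OF yU, symmetric] by (simp add: conormal_eq)
      then have "\<alpha> y \<bullet> deriv_at M \<phi> y (sharp M \<pi> y \<nu>) = 0"
      proof (rule inner_span_eq_0[rotated])
        fix s assume "s \<in> (\<lambda>l. \<tau> l y) ` {k..<n}"
        then obtain l where l: "k \<le> l" "l < n" "s = \<tau> l y" by auto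
        then show "\<alpha> y \<bullet> s = 0" using key[OF yW(1) l(2)] by (simp add: \<gamma>_def)
      qed
      then show "differential M F y \<bullet> sharp M \<pi> y \<nu> = 0" using dFv[OF sharp_in_model] by simp
    qed
    then show ?thesis using yW(2) Ff by blast
  qed
  show ?thesis
    by (rule exI[of _ G], rule exI[of _ F]) (use oG xG Fs main in auto)
qed
end

section \<open>Induced Poisson structures\<close>

lemma coregularD:
  assumes "coregular_poisson_dirac M \<pi> X"
  shows "embedded_submanifold M X" "\<forall>x\<in>X. sharp M \<pi> x ` conormal M X x \<inter> sub_tangent M X x = {0}"
    "\<exists>r. \<forall>y\<in>X. dim (tangent_sharp_sum M \<pi> X y) = r"
proof -
  note c = assms[unfolded coregular_poisson_dirac_def]
  show "embedded_submanifold M X" by (rule conjunct1[OF c])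
  show "\<forall>x\<in>X. sharp M \<pi> x ` conormal M X x \<inter> sub_tangent M X x = {0}"
    by (rule conjunct1[OF conjunct2[OF c]])
  have "vector_subbundle M X (\<lambda>x. tangent_sharp_sum M \<pi> X x)"
    using assms unfolding coregular_poisson_dirac_def by (elim conjE)
  then obtain r where r: "\<forall>x\<in>X. \<exists>W s. openin (mtop (submfd M X)) W \<and> x \<in> W \<and>
       (\<forall>i<r. \<forall>(U, \<phi>)\<in>atlas M. smooth_fun_on (submfd M X) (W \<inter> U) (\<lambda>y. deriv_at M \<phi> y (s i y))) \<and>
       (\<forall>y\<in>W. tangent_sharp_sum M \<pi> X y = span ((\<lambda>i. s i y) ` {..<r}) \<and> dim (tangent_sharp_sum M \<pi> X y) = r)"
    unfolding vector_subbundle_def by (elim conjE exE)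
  have "dim (tangent_sharp_sum M \<pi> X y) = r" if y: "y \<in> X" for y
    using bspec[OF r y] by (elim exE conjE) (drule bspec, assumption, erule conjunct2)
  then show "\<exists>r. \<forall>y\<in>X. dim (tangent_sharp_sum M \<pi> X y) = r" by (intro exI[of _ r] ballI)
qed

lemma coregularI:
  assumes M: "smooth_manifold M" and b: "smooth_bivector M \<pi>" and X: "embedded_submanifold M X"
    and tr: "\<forall>x\<in>X. sharp M \<pi> x ` conormal M X x \<inter> sub_tangent M X x = {0}"
    and r: "\<forall>y\<in>X. dim (tangent_sharp_sum M \<pi> X y) = r"
  shows "coregular_poisson_dirac M \<pi> X"
  unfolding coregular_poisson_dirac_def vector_subbundle_def
proof (intro conjI ballI X exI[of _ r])
  show "sharp M \<pi> x ` conormal M X x \<inter> sub_tangent M X x = {0}" if "x \<in> X" for x using tr that by blast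
  fix x assume x: "x \<in> X"
  obtain U \<phi> where c: "(U, \<phi>) \<in> slice_charts M X (submfd_dim M X)" "x \<in> U" using slice_chart_cover[OF X x] by metis
  interpret slice_bivector M \<pi> X U \<phi> by unfold_locales (rule M b X c(1))+
  show "tangent_sharp_sum M \<pi> X x \<subseteq> tangent_space M x"
    unfolding tangent_space_def by (rule subspace_tangent_sharp_sum(2)[OF c(2) x])
  show "\<exists>W s. openin (mtop (submfd M X)) W \<and> x \<in> W \<and>
       (\<forall>i<r. \<forall>(U, \<phi>)\<in>atlas M. smooth_fun_on (submfd M X) (W \<inter> U) (\<lambda>y. deriv_at M \<phi> y (s i y))) \<and>
       (\<forall>y\<in>W. tangent_sharp_sum M \<pi> X y = span ((\<lambda>i. s i y) ` {..<r}) \<and> dim (tangent_sharp_sum M \<pi> X y) = r)"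
    by (rule local_sections[OF c(2) x r])
qed

lemma coregular_extend_tangent:
  fixes f :: "'a \<Rightarrow> real" and M :: "('a, 'e::euclidean_space) mfd"
  assumes M: "smooth_manifold M" and b: "smooth_bivector M \<pi>" and co: "coregular_poisson_dirac M \<pi> X"
    and x: "x \<in> X" and Q: "openin (mtop (submfd M X)) Q" "x \<in> Q" and f: "smooth_fun_on (submfd M X) Q f"
  shows "\<exists>G F. openin (mtop M) G \<and> x \<in> G \<and> smooth_fun_on M G F \<and>
    (\<forall>y\<in>G \<inter> X. y \<in> Q \<and> F y = f y \<and> sharp M \<pi> y (differential M F y) \<in> sub_tangent M X y)"
proof -
  note X = coregularD(1)[OF co]
  obtain r where r: "\<forall>y\<in>X. dim (tangent_sharp_sum M \<pi> X y) = r" using coregularD(3)[OF co] ..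
  obtain U \<phi> where c: "(U, \<phi>) \<in> slice_charts M X (submfd_dim M X)" "x \<in> U" using slice_chart_cover[OF X x] by metis
  interpret slice_bivector M \<pi> X U \<phi> by unfold_locales (rule M b X c(1))+
  show ?thesis by (rule extend_tangent[OF c(2) x r coregularD(2)[OF co] Q f])
qed

section \<open>Restriction of differentials and brackets to a submanifold\<close>

lemma differential_restrict:
  assumes M: "smooth_manifold M" and X: "embedded_submanifold M X" and W: "openin (mtop M) W" and F: "smooth_fun_on M W F"
    and y: "y \<in> W" "y \<in> X" and eq: "\<And>z. z \<in> W \<Longrightarrow> z \<in> X \<Longrightarrow> F z = f z"
  shows "differential (submfd M X) f y = incl_pull M X y (differential M F y)"
proof (rule model_eqI[OF smooth_manifold_submfd[OF M X] differential_in_model incl_pull_model])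
  let ?N = "submfd M X"
  note N = smooth_manifold_submfd[OF M X] and oW = openin_submfd[OF W, of X]
  have yW: "y \<in> W \<inter> X" using y by blast
  have f: "smooth_fun_on ?N (W \<inter> X) f"
    by (rule smooth_fun_on_cong[OF N _ smooth_fun_on_restrict[OF M X W F]]) (simp add: eq)
  fix u assume u: "u \<in> model ?N"
  have "differential ?N f y \<bullet> u = deriv_at ?N f y u" by (rule differential_inner[OF N oW f yW u])
  also have "\<dots> = deriv_at ?N F y u" by (rule fun_cong[OF deriv_at_cong[OF N oW yW]]) (simp add: eq)
  also have "\<dots> = deriv_at M F y (incl_push M X y u)" by (rule deriv_at_submfd[OF M X y(2) W y(1) F u])
  also have "\<dots> = differential M F y \<bullet> incl_push M X y u"
    by (rule differential_inner[OF M W F y(1) incl_push_model[OF M X y(2) u], symmetric])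
  also have "\<dots> = incl_pull M X y (differential M F y) \<bullet> u" by (rule incl_pull_inner[OF M X y(2) u, symmetric])
  finally show "u \<bullet> differential ?N f y = u \<bullet> incl_pull M X y (differential M F y)" by (simp add: inner_commute)
qed

text \<open>The Hamiltonian vector of \<open>F\<close> is tangent at the point considered, so only
  the restriction to \<open>X\<close> of the differential of \<open>G\<close> enters. Hence
  \<open>G\<close> may be any smooth extension of \<open>g\<close>, for instance one that is itself
  a bracket.\<close>

lemma bracket_restrict:
  assumes M: "smooth_manifold M" and b: "smooth_bivector M \<pi>" and X: "embedded_submanifold M X"
    and W: "openin (mtop M) W" and F: "smooth_fun_on M W F" and G: "smooth_fun_on M W G" and y: "y \<in> W" "y \<in> X"
    and graph: "pullback_graph M \<pi> X y = bivector_graph (submfd M X) \<rho> y"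
    and a': "alternating_on (model (submfd M X)) (\<rho> y)"
    and Ff: "\<And>z. z \<in> W \<Longrightarrow> z \<in> X \<Longrightarrow> F z = f z" and Gg: "\<And>z. z \<in> W \<Longrightarrow> z \<in> X \<Longrightarrow> G z = g z"
    and tan: "sharp M \<pi> y (differential M F y) \<in> sub_tangent M X y"
  shows "bracket (submfd M X) \<rho> f g y = bracket M \<pi> F G y"
proof -
  have a: "alternating_on (model M) (\<pi> y)" using smooth_bivector_alternating[OF b] embedded_subset[OF X] y(2) by blast
  have df: "differential (submfd M X) f y = incl_pull M X y (differential M F y)"
    by (rule differential_restrict[OF M X W F y Ff])
  have dg: "differential (submfd M X) g y = incl_pull M X y (differential M G y)"
    by (rule differential_restrict[OF M X W G y Gg])
  show ?thesis
    unfolding bracket_def df dg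
    by (rule induced_apply[where \<pi>=\<pi> and \<rho>=\<rho>, OF M X y(2) graph a a' differential_in_model tan differential_in_model])
qed

text \<open>At each point the induced form exists by transversality alone; constancy of the rank
  enters through smoothness. Coordinate functions of \<open>X\<close> are extended with tangent
  Hamiltonian vector fields, and their brackets on \<open>X\<close> are restrictions of smooth
  brackets on \<open>M\<close>.\<close>

lemma coregular_induced_exists:
  fixes M :: "('a, 'e::euclidean_space) mfd"
  assumes M: "smooth_manifold M" and b: "smooth_bivector M \<pi>" and co: "coregular_poisson_dirac M \<pi> X"
  shows "\<exists>\<rho>. induced_poisson M \<pi> X \<rho>"
proof -
  note X = coregularD(1)[OF co]
  let ?N = "submfd M X"
  note N = smooth_manifold_submfd[OF M X]
  have a: "alternating_on (model M) (\<pi> y)" if "y \<in> X" for y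
    using smooth_bivector_alternating[OF b] embedded_subset[OF X] that by blast
  have "\<exists>\<rho>. \<forall>y\<in>X. alternating_on (model ?N) (\<rho> y) \<and>
    (\<forall>\<xi>\<in>model M. \<forall>\<eta>\<in>model M. sharp M \<pi> y \<xi> \<in> sub_tangent M X y \<longrightarrow> sharp M \<pi> y \<eta> \<in> sub_tangent M X y \<longrightarrow>
      \<rho> y (incl_pull M X y \<xi>) (incl_pull M X y \<eta>) = \<pi> y \<xi> \<eta>)"
  proof (rule bchoice, rule ballI)
    fix y assume y: "y \<in> X"
    show "\<exists>\<beta>. alternating_on (model ?N) \<beta> \<and>
      (\<forall>\<xi>\<in>model M. \<forall>\<eta>\<in>model M. sharp M \<pi> y \<xi> \<in> sub_tangent M X y \<longrightarrow> sharp M \<pi> y \<eta> \<in> sub_tangent M X y \<longrightarrow>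
        \<beta> (incl_pull M X y \<xi>) (incl_pull M X y \<eta>) = \<pi> y \<xi> \<eta>)"
      by (rule induced_bivector_exists_at[OF M X y a[OF y] bspec[OF coregularD(2)[OF co] y]])
  qed
  then obtain \<rho> where \<rho>0: "\<forall>y\<in>X. alternating_on (model ?N) (\<rho> y) \<and>
    (\<forall>\<xi>\<in>model M. \<forall>\<eta>\<in>model M. sharp M \<pi> y \<xi> \<in> sub_tangent M X y \<longrightarrow> sharp M \<pi> y \<eta> \<in> sub_tangent M X y \<longrightarrow>
      \<rho> y (incl_pull M X y \<xi>) (incl_pull M X y \<eta>) = \<pi> y \<xi> \<eta>)" ..
  have a': "alternating_on (model ?N) (\<rho> y)" if "y \<in> X" for y using \<rho>0 that by blast
  have graph: "pullback_graph M \<pi> X y = bivector_graph ?N \<rho> y" if y: "y \<in> X" for y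
    by (rule induced_graphI[where \<pi>=\<pi> and \<rho>=\<rho>, OF M X y a[OF y] a'[OF y] bspec[OF coregularD(2)[OF co] y]])
       (use \<rho>0 y in simp)
  have "smooth_bivector ?N \<rho>"
    unfolding smooth_bivector_def cotangent_space_def carrier_submfd[OF X]
  proof (intro conjI ballI a', assumption, clarify)
    fix A \<phi> i j assume A: "(A, \<phi>) \<in> atlas ?N"
    note mA = smooth_manifoldD(7)[OF N A]
    note oA = chartD(1)[OF max_atlas_chart[OF mA]]
    have AX: "A \<subseteq> X" using chartD(2)[OF max_atlas_chart[OF mA]] carrier_submfd[OF X] by blast
    let ?f = "\<lambda>l y. \<phi> y \<bullet> coord_vec l"
    have f: "smooth_fun_on ?N A (?f l)" for l
      by (rule smooth_fun_on_bounded_linear[OF bounded_linear_inner_left smooth_fun_on_chart_self[OF N mA]])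
    show "smooth_fun_on ?N A (bracket ?N \<rho> (?f i) (?f j))"
    proof (rule smooth_fun_on_local[OF N oA])
      fix x assume x: "x \<in> A"
      then have xX: "x \<in> X" using AX by blast
      obtain G1 F1 where 1: "openin (mtop M) G1" "x \<in> G1" "smooth_fun_on M G1 F1"
        "\<forall>y\<in>G1 \<inter> X. y \<in> A \<and> F1 y = ?f i y \<and> sharp M \<pi> y (differential M F1 y) \<in> sub_tangent M X y"
        using coregular_extend_tangent[OF M b co xX oA x f[of i]] by (elim exE conjE)
      obtain G2 F2 where 2: "openin (mtop M) G2" "x \<in> G2" "smooth_fun_on M G2 F2"
        "\<forall>y\<in>G2 \<inter> X. y \<in> A \<and> F2 y = ?f j y \<and> sharp M \<pi> y (differential M F2 y) \<in> sub_tangent M X y"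
        using coregular_extend_tangent[OF M b co xX oA x f[of j]] by (elim exE conjE)
      let ?G = "G1 \<inter> G2"
      have G: "openin (mtop M) ?G" using 1(1) 2(1) by (rule openin_Int)
      have s: "smooth_fun_on M ?G F1" "smooth_fun_on M ?G F2"
        using 1(3) 2(3) by (auto intro: smooth_fun_on_subset)
      have eq: "bracket ?N \<rho> (?f i) (?f j) y = bracket M \<pi> F1 F2 y" if y: "y \<in> ?G \<inter> X" for y
        by (rule bracket_restrict[where \<pi>=\<pi> and \<rho>=\<rho>, OF M b X G s _ _ graph a'])
           (use y 1(4) 2(4) in auto)
      have "smooth_fun_on ?N (?G \<inter> X) (bracket M \<pi> F1 F2)"
        by (rule smooth_fun_on_restrict[OF M X G smooth_fun_on_bracket[OF M b G s]])
      then have "smooth_fun_on ?N (?G \<inter> X) (bracket ?N \<rho> (?f i) (?f j))"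
        by (rule smooth_fun_on_cong[OF N, rotated]) (rule eq[symmetric])
      moreover have "x \<in> ?G \<inter> X" using 1(2) 2(2) xX by blast
      ultimately show "\<exists>G. openin (mtop ?N) G \<and> x \<in> G \<and> smooth_fun_on ?N G (bracket ?N \<rho> (?f i) (?f j))"
        using openin_submfd[OF G, of X] by blast
    qed
  qed
  then show ?thesis unfolding induced_poisson_def using graph by blast
qed

lemma poisson_manifoldD:
  assumes "poisson_manifold M \<pi>"
  shows "smooth_manifold M" "smooth_bivector M \<pi>"
    "smooth_fun_on M (carrier M) f \<Longrightarrow> smooth_fun_on M (carrier M) g \<Longrightarrow> smooth_fun_on M (carrier M) h \<Longrightarrow> x \<in> carrier M \<Longrightarrow>
      bracket M \<pi> f (bracket M \<pi> g h) x + bracket M \<pi> g (bracket M \<pi> h f) x + bracket M \<pi> h (bracket M \<pi> f g) x = 0"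
  using assms unfolding poisson_manifold_def by auto

text \<open>Cutting off changes neither the function near \<open>x\<close> nor its differential
  there, so tangency survives on the smaller neighbourhood.\<close>

lemma coregular_global_extension:
  fixes f :: "'a \<Rightarrow> real" and M :: "('a, 'e::euclidean_space) mfd"
  assumes M: "smooth_manifold M" and b: "smooth_bivector M \<pi>" and co: "coregular_poisson_dirac M \<pi> X"
    and x: "x \<in> X" and f: "smooth_fun_on (submfd M X) (carrier (submfd M X)) f"
  shows "\<exists>G F. openin (mtop M) G \<and> x \<in> G \<and> smooth_fun_on M (carrier M) F \<and>
    (\<forall>y\<in>G \<inter> X. F y = f y \<and> sharp M \<pi> y (differential M F y) \<in> sub_tangent M X y)"
proof -
  note X = coregularD(1)[OF co]
  have xc: "x \<in> carrier (submfd M X)" using carrier_submfd[OF X] x by simp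
  obtain G F where G: "openin (mtop M) G" "x \<in> G" "smooth_fun_on M G F"
    "\<forall>y\<in>G \<inter> X. y \<in> carrier (submfd M X) \<and> F y = f y \<and> sharp M \<pi> y (differential M F y) \<in> sub_tangent M X y"
    using coregular_extend_tangent[OF M b co x openin_topspace xc f] by (elim exE conjE)
  obtain F' :: "'a \<Rightarrow> real" and H where H: "openin (mtop M) H" "x \<in> H" "H \<subseteq> G" "smooth_fun_on M (carrier M) F'" "\<forall>y\<in>H. F' y = F y"
    using smooth_fun_extend_global[OF M G(1,3,2)] by (elim exE conjE)
  have "differential M F' y = differential M F y" if "y \<in> H" for y
    unfolding differential_def using deriv_at_cong[OF M H(1) that, of F' F] H(5) by simp
  then have "\<forall>y\<in>H \<inter> X. F' y = f y \<and> sharp M \<pi> y (differential M F' y) \<in> sub_tangent M X y"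
    using G(4) H(3,5) by auto
  then show ?thesis using H(1,2,4) by blast
qed

text \<open>Brackets of functions with tangent Hamiltonian vector field along \<open>X\<close> restrict to brackets on \<open>X\<close>,
  so the Jacobi identity is inherited.\<close>

lemma coregular_induced_poisson_manifold:
  fixes M :: "('a, 'e::euclidean_space) mfd"
  assumes P: "poisson_manifold M \<pi>" and co: "coregular_poisson_dirac M \<pi> X" and ind: "induced_poisson M \<pi> X \<rho>"
  shows "poisson_manifold (submfd M X) \<rho>"
proof -
  note M = poisson_manifoldD(1)[OF P] and b = poisson_manifoldD(2)[OF P] and X = coregularD(1)[OF co]
  let ?N = "submfd M X"
  note N = smooth_manifold_submfd[OF M X]
  have bN: "smooth_bivector ?N \<rho>" and graph: "y \<in> X \<Longrightarrow> pullback_graph M \<pi> X y = bivector_graph ?N \<rho> y" for y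
    using ind unfolding induced_poisson_def by auto
  have a': "alternating_on (model ?N) (\<rho> y)" if "y \<in> X" for y
    using smooth_bivector_alternating[OF bN] carrier_submfd[OF X] that by blast
  show ?thesis
    unfolding poisson_manifold_def
  proof (intro conjI N bN allI impI ballI, elim conjE)
    fix f g h :: "'a \<Rightarrow> real" and x
    assume f: "smooth_fun_on ?N (carrier ?N) f" and g: "smooth_fun_on ?N (carrier ?N) g" and h: "smooth_fun_on ?N (carrier ?N) h"
      and xc: "x \<in> carrier ?N"
    then have x: "x \<in> X" using carrier_submfd[OF X] by simp
    have xM: "x \<in> carrier M" using x embedded_subset[OF X] by blast
    obtain G1 and F :: "'a \<Rightarrow> real" where 1: "openin (mtop M) G1" "x \<in> G1" and F: "smooth_fun_on M (carrier M) F"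
      and F': "\<forall>y\<in>G1 \<inter> X. F y = f y \<and> sharp M \<pi> y (differential M F y) \<in> sub_tangent M X y"
      using coregular_global_extension[OF M b co x f] by (elim exE conjE)
    obtain G2 and G :: "'a \<Rightarrow> real" where 2: "openin (mtop M) G2" "x \<in> G2" and G: "smooth_fun_on M (carrier M) G"
      and G': "\<forall>y\<in>G2 \<inter> X. G y = g y \<and> sharp M \<pi> y (differential M G y) \<in> sub_tangent M X y"
      using coregular_global_extension[OF M b co x g] by (elim exE conjE)
    obtain G3 and H :: "'a \<Rightarrow> real" where 3: "openin (mtop M) G3" "x \<in> G3" and H: "smooth_fun_on M (carrier M) H"
      and H': "\<forall>y\<in>G3 \<inter> X. H y = h y \<and> sharp M \<pi> y (differential M H y) \<in> sub_tangent M X y"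
      using coregular_global_extension[OF M b co x h] by (elim exE conjE)
    define O' where "O' = G1 \<inter> G2 \<inter> G3"
    have O: "openin (mtop M) O'" "x \<in> O'" unfolding O'_def using 1 2 3 by (auto intro!: openin_Int)
    have sm: "smooth_fun_on M O' u" if "smooth_fun_on M (carrier M) u" for u :: "'a \<Rightarrow> real"
      using that openin_subset[OF O(1)] by (rule smooth_fun_on_subset)
    define good where "good u v \<longleftrightarrow> smooth_fun_on M O' u \<and>
      (\<forall>y\<in>O' \<inter> X. u y = v y \<and> sharp M \<pi> y (differential M u y) \<in> sub_tangent M X y)" for u v :: "'a \<Rightarrow> real"
    have good: "good F f" "good G g" "good H h"
      unfolding good_def using sm F G H F' G' H' by (auto simp: O'_def)
    have br: "bracket ?N \<rho> v v' y = bracket M \<pi> u u' y"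
      if "good u v" "smooth_fun_on M O' u'" "\<And>z. z \<in> O' \<Longrightarrow> z \<in> X \<Longrightarrow> u' z = v' z" "y \<in> O'" "y \<in> X" for u v u' v' y
      by (rule bracket_restrict[where \<pi>=\<pi> and \<rho>=\<rho>, OF M b X O(1) _ that(2,4,5) graph[OF that(5)] a'[OF that(5)] _ that(3)])
         (use that(1,4,5) in \<open>auto simp: good_def\<close>)
    \<comment> \<open>The inner bracket on \<open>M\<close> plays the role of an arbitrary extension
      of the inner bracket on \<open>X\<close>. Their agreement is needed at all points of
      \<open>X\<close> near \<open>x\<close>, not at \<open>x\<close> alone, because the outer
      bracket differentiates it.\<close>
    have br2: "bracket ?N \<rho> v (bracket ?N \<rho> v' v'') x = bracket M \<pi> u (bracket M \<pi> u' u'') x"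
      if uv: "good u v" "good u' v'" "good u'' v''" for u v u' v' u'' v''
    proof (rule br[OF uv(1) _ _ O(2) x])
      show "smooth_fun_on M O' (bracket M \<pi> u' u'')"
        by (rule smooth_fun_on_bracket[OF M b O(1)]) (use uv in \<open>auto simp: good_def\<close>)
      show "bracket M \<pi> u' u'' z = bracket ?N \<rho> v' v'' z" if "z \<in> O'" "z \<in> X" for z
        by (rule br[symmetric, OF uv(2) _ _ that]) (use uv(3) in \<open>auto simp: good_def\<close>)
    qed
    show "bracket ?N \<rho> f (bracket ?N \<rho> g h) x + bracket ?N \<rho> g (bracket ?N \<rho> h f) x + bracket ?N \<rho> h (bracket ?N \<rho> f g) x = 0"
      unfolding br2[OF good(1,2,3)] br2[OF good(2,3,1)] br2[OF good(3,1,2)]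
      by (rule poisson_manifoldD(3)[OF P F G H xM])
  qed
qed

section \<open>Preimages of submanifolds under submersions\<close>

text \<open>Rank and nullity for \<open>f\<close> on \<open>A\<close> and on the preimage of
  \<open>B\<close>: the two kernels coincide, since \<open>B\<close> contains 0.\<close>

lemma dim_linear_preimage:
  fixes f :: "'e::euclidean_space \<Rightarrow> 'f::euclidean_space"
  assumes f: "linear f" and A: "subspace A" and B: "subspace B" "B \<subseteq> f ` A"
  shows "dim {v\<in>A. f v \<in> B} + dim (f ` A) = dim A + dim B"
proof -
  have ker: "dim {v\<in>V. f v = 0} + dim (f ` V) = dim V" if V: "subspace V" for V
  proof -
    define K where "K = {v\<in>V. f v = 0}"
    \<comment> \<open>The complement of the kernel within \<open>V\<close>, on which
      \<open>f\<close> is injective with the same image.\<close>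
    define C where "C = {y\<in>V. \<forall>x\<in>K. orthogonal x y}"
    have K: "subspace K" unfolding K_def
      using V linear_0[OF f] by (simp add: subspace_def linear_add[OF f] linear_scale[OF f])
    have C: "subspace C"
      using V by (simp add: C_def subspace_def orthogonal_def inner_add_right)
    have KV: "K \<subseteq> V" by (auto simp: K_def)
    have d: "dim C + dim K = dim V"
      unfolding C_def by (rule dim_subspace_orthogonal_to_vectors[OF K V KV])
    have "f ` V \<subseteq> f ` C"
    proof (rule image_subsetI)
      fix v assume v: "v \<in> V"
      obtain y z where y: "y \<in> span K" and z: "\<And>w. w \<in> span K \<Longrightarrow> orthogonal z w" and yz: "v = y + z"
        using orthogonal_subspace_decomp_exists[of K v] by metis
      have sK: "span K = K" using K by (simp add: span_eq_iff)
      have "y \<in> K" using y sK by simp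
      then have yK: "y \<in> V" "f y = 0" by (simp_all add: K_def)
      have "z = v - y" using yz by simp
      then have "z \<in> V" using subspace_diff[OF V v yK(1)] by simp
      then have "z \<in> C" using z unfolding sK by (simp add: C_def orthogonal_commute)
      moreover have "f v = f z" unfolding yz linear_add[OF f] yK(2) by simp
      ultimately show "f v \<in> f ` C" by simp
    qed
    then have "f ` V = f ` C" by (auto simp: C_def)
    moreover have "dim (f ` C) = dim C"
    proof (rule dim_image_inj_subspace[OF f C])
      fix v assume "v \<in> C" "f v = 0"
      then have "orthogonal v v" by (simp add: C_def K_def)
      then show "v = 0" by (simp add: orthogonal_def)
    qed
    ultimately show ?thesis using d unfolding K_def[symmetric] by simp
  qed
  let ?V = "{v\<in>A. f v \<in> B}"
  have V: "subspace ?V"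
    using subspace_inter[OF A linear_subspace_vimage[OF f B(1)]] by (simp add: Int_def)
  have "f ` ?V = B" using B(2) by auto
  moreover have "{v\<in>?V. f v = 0} = {v\<in>A. f v = 0}" using subspace_0[OF B(1)] by auto
  ultimately show ?thesis using ker[OF A] ker[OF V] by simp
qed

text \<open>Moves the transversal coordinates \<open>k, \<dots>, m - 1\<close> of \<open>M\<close> to the last coordinates of \<open>S\<close>, with \<open>d = dim S - dim M\<close>.\<close>

definition shift_coords :: "nat \<Rightarrow> nat \<Rightarrow> nat \<Rightarrow> 'f::euclidean_space \<Rightarrow> 'e::euclidean_space"
  where "shift_coords k m d w = (\<Sum>i\<in>{k..<m}. (w \<bullet> coord_vec i) *\<^sub>R coord_vec (i + d))"

lemma linear_shift_coords: "linear (shift_coords k m d)"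
  unfolding shift_coords_def
  by (rule linearI) (simp_all add: inner_add_left scaleR_add_left sum.distrib scaleR_sum_right)

lemma shift_coords_in: "shift_coords k m d w \<in> coord_space (m + d)"
  unfolding shift_coords_def
  by (rule subspace_sum[OF subspace_coord_space], rule subspace_scale[OF subspace_coord_space])
     (auto intro: coord_vec_in_coord_space)

lemma shift_coords_inner:
  fixes w :: "'f::euclidean_space"
  assumes "m + d \<le> DIM('e)" "j < DIM('e)"
  shows "(shift_coords k m d w :: 'e::euclidean_space) \<bullet> coord_vec j =
    (if k + d \<le> j \<and> j < m + d then w \<bullet> coord_vec (j - d) else 0)"
proof -
  have "(shift_coords k m d w :: 'e) \<bullet> coord_vec j = (\<Sum>i\<in>{k..<m}. if i = j - d \<and> d \<le> j then w \<bullet> coord_vec i else 0)"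
    unfolding shift_coords_def inner_sum_left
    by (rule sum.cong) (use assms in \<open>auto simp: inner_coord_vec\<close>)
  then show ?thesis by (cases "d \<le> j") (auto simp: le_diff_conv)
qed

lemma shift_coords_eq_0_iff:
  fixes w :: "'f::euclidean_space"
  assumes d: "m + d \<le> DIM('e)" and m: "m \<le> DIM('f)" and k: "k \<le> m" and w: "w \<in> coord_space m"
  shows "(shift_coords k m d w :: 'e::euclidean_space) = 0 \<longleftrightarrow> w \<in> coord_space k"
proof
  assume 0: "(shift_coords k m d w :: 'e) = 0"
  show "w \<in> coord_space k"
    unfolding coord_space_iff[OF m k w]
  proof (intro allI impI)
    fix i assume i: "k \<le> i \<and> i < m"
    then have "(shift_coords k m d w :: 'e) \<bullet> coord_vec (i + d) = w \<bullet> coord_vec i"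
      using shift_coords_inner[OF d, of "i + d" k w] d by simp
    then show "w \<bullet> coord_vec i = 0" using 0 by simp
  qed
next
  assume "w \<in> coord_space k"
  then show "(shift_coords k m d w :: 'e) = 0"
    unfolding coord_space_iff[OF m k w] by (simp add: shift_coords_def)
qed

text \<open>The shifted coordinates occupy the indices from \<open>k + d\<close> on, so their span
  meets \<open>coord_space (k + d)\<close> only in 0.\<close>

lemma shift_coords_add_in_iff:
  fixes w :: "'f::euclidean_space" and l :: "'e::euclidean_space"
  assumes d: "m + d \<le> DIM('e)" and k: "k \<le> m" and l: "l \<in> coord_space (k + d)"
  shows "shift_coords k m d w + l \<in> coord_space (k + d) \<longleftrightarrow> (shift_coords k m d w :: 'e) = 0"
proof
  assume "shift_coords k m d w + l \<in> coord_space (k + d)"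
  from subspace_diff[OF subspace_coord_space this l]
  have s: "(shift_coords k m d w :: 'e) \<in> coord_space (k + d)" by simp
  have kd: "k + d \<le> DIM('e)" using d k by simp
  show "(shift_coords k m d w :: 'e) = 0"
    by (rule coord_space_eqI[OF kd s subspace_0[OF subspace_coord_space]])
       (use kd in \<open>simp add: shift_coords_inner[OF d]\<close>)
qed (use l in simp)

section \<open>Slice charts for the preimage of a submanifold\<close>

lemma submersion_dim_le:
  fixes S :: "('a, 's::euclidean_space) mfd" and M :: "('b, 'm::euclidean_space) mfd"
  assumes S: "smooth_manifold S" and M: "smooth_manifold M" and p: "submersion S M p" and x: "x \<in> carrier S"
  shows "mdim M \<le> mdim S"
proof -
  have sm: "smooth_map S M p" and sur: "tangent_map S M p x ` model S = model M"
    using p x unfolding submersion_def tangent_space_def by auto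
  have "dim (tangent_map S M p x ` model S) \<le> dim (model S)"
    by (rule dim_image_le[OF tangent_map_linear[OF S M sm x]])
  then show ?thesis unfolding sur using mdim_le[OF S] mdim_le[OF M] by (simp add: model_def dim_coord_space)
qed

text \<open>The new coordinates add two terms: the transversal coordinates of \<open>p z\<close>,
  placed last, and a linear map that takes the prospective tangent space \<open>?K\<close> of the
  preimage isomorphically onto \<open>coord_space (k + d)\<close>. Membership in the preimage
  becomes vanishing of the last block. The derivative is injective at \<open>x\<close>: on its
  kernel the last block vanishes, which puts the vector into \<open>?K\<close>, and there the linear
  map detects it.\<close>

lemma preimage_slice_chart:
  fixes S :: "('a, 's::euclidean_space) mfd" and M :: "('b, 'm::euclidean_space) mfd"
  assumes S: "smooth_manifold S" and M: "smooth_manifold M" and p: "submersion S M p"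
    and Y: "embedded_submanifold M Y" and x: "x \<in> carrier S" "p x \<in> Y"
  shows "\<exists>c\<in>slice_charts S {z\<in>carrier S. p z \<in> Y} (submfd_dim M Y + (mdim S - mdim M)). x \<in> fst c"
proof -
  define k where "k = submfd_dim M Y"
  define m where "m = mdim M"
  define d where "d = mdim S - mdim M"
  let ?X = "{z\<in>carrier S. p z \<in> Y}"
  have sm: "smooth_map S M p" and sur: "tangent_map S M p x ` model S = model M"
    using p x unfolding submersion_def tangent_space_def by auto
  have md: "m + d = mdim S" using submersion_dim_le[OF S M p x(1)] by (simp add: d_def m_def)
  have km: "k \<le> m" using submfd_dim_le[OF Y] by (simp add: k_def m_def)
  have dD: "m + d \<le> DIM('s)" using mdim_le[OF S] md by simp
  have mD: "m \<le> DIM('m)" using mdim_le[OF M] by (simp add: m_def)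
  have kdD: "k + d \<le> DIM('s)" using dD km by simp
  have ES: "model S = coord_space (m + d)" by (simp add: model_def md)
  have EM: "model M = coord_space m" by (simp add: model_def m_def)
  obtain V \<psi> where V: "(V, \<psi>) \<in> slice_charts M Y k" "p x \<in> V" using slice_chart_cover[OF Y x(2)] unfolding k_def by metis
  obtain U \<phi> where U: "(U, \<phi>) \<in> atlas S" "(U, \<phi>) \<in> max_atlas S" "x \<in> U" using atlas_cover[OF S x(1)] by metis
  note chU = max_atlas_chart[OF U(2)] and cV = slice_chartD(1)[OF V(1)] and chV = slice_chartD(3)[OF V(1)]
  note oV = chartD(1)[OF chV]
  let ?W = "U \<inter> {z\<in>carrier S. p z \<in> V}"
  have oP: "openin (mtop S) {z\<in>carrier S. p z \<in> V}" by (rule smooth_map_preimage_open[OF sm oV])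
  have oW: "openin (mtop S) ?W" using chartD(1)[OF chU] oP by (rule openin_Int)
  have xW: "x \<in> ?W" using U(3) x V(2) by simp
  have sP: "smooth_fun_on S {z\<in>carrier S. p z \<in> V} (\<psi> \<circ> p)"
    by (rule smooth_fun_on_pullback[OF S M sm oV smooth_fun_on_chart_self[OF M cV]])
  let ?g = "(\<psi> \<circ> p) \<circ> inv_into U \<phi>"
  have inv: "inv_into U \<phi> (\<phi> z) = z" if "z \<in> U" for z using inv_into_f_f[OF chartD(3)[OF chU] that] .
  have gs: "smooth_on (model S) (\<phi> ` ?W) ?g" by (rule smooth_fun_onD[OF S oP sP U(2)])
  let ?D = "chart_deriv (U, \<phi>) (\<psi> \<circ> p) x"
  have Dd: "(?g has_derivative ?D) (at (\<phi> x) within \<phi> ` U)"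
    by (rule chart_has_derivative[OF S U(2) oP sP U(3)]) (use x V in simp)
  have linD: "linear ?D" using Dd by (rule has_derivative_linear)
  have DM: "?D v \<in> model M" if "v \<in> model S" for v
    by (rule chart_deriv_chain(2)[OF S M sm U(2,3) cV V(2) V(2) oV smooth_fun_on_chart_self[OF M cV] that])
  have Dsur: "model M \<subseteq> ?D ` model S"
  proof
    fix w assume w: "w \<in> model M"
    note B = chart_vec(1,2)[OF M cV V(2) w]
    obtain v where v: "v \<in> model S" "chart_vec M (V, \<psi>) (p x) w = tangent_map S M p x v"
      using B(1) unfolding sur[symmetric] by (rule imageE)
    have "deriv_at S (\<psi> \<circ> p) x v = w"
      using deriv_at_chain[OF S M sm x(1) oV V(2) smooth_fun_on_chart_self[OF M cV] v(1)] v(2) B(2) by simp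
    moreover have "deriv_at S (\<psi> \<circ> p) x v = ?D (deriv_at S \<phi> x v)" "deriv_at S \<phi> x v \<in> model S"
      using deriv_at_in_chart[OF S U(2,3) _ oP sP v(1)] x V(2) by auto
    ultimately show "w \<in> ?D ` model S" by (metis imageI)
  qed
  have Deq: "?D ` model S = model M" using Dsur DM by blast
  let ?K = "{v\<in>model S. ?D v \<in> coord_space k}"
  have K: "subspace ?K"
    using subspace_model[of S] subspace_coord_space[of k] linear_0[OF linD] unfolding subspace_def
    by (auto simp: linear_add[OF linD] linear_scale[OF linD])
  have kM: "coord_space k \<subseteq> model M" unfolding EM by (rule coord_space_mono[OF km])
  have "dim ?K + dim (?D ` model S) = dim (model S) + dim (coord_space k :: 'm set)"
    by (rule dim_linear_preimage[OF linD subspace_model subspace_coord_space]) (simp add: Deq kM)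
  moreover have "dim (model M) = m" "dim (model S) = m + d" "dim (coord_space k :: 'm set) = k"
    unfolding EM ES using mD dD km by (simp_all add: dim_coord_space)
  ultimately have "dim ?K = k + d" unfolding Deq by simp
  then have "dim ?K = dim (coord_space (k + d) :: 's set)" using kdD by (simp add: dim_coord_space)
  then obtain g0 where g0: "linear g0" "g0 ` ?K = (coord_space (k + d) :: 's set)" "inj_on g0 ?K"
    using subspace_isomorphism[OF K subspace_coord_space] by blast
  \<comment> \<open>\<open>g0\<close> is controlled on \<open>?K\<close> only; the projection forces
    its values into \<open>coord_space (k + d)\<close> everywhere without changing it on
    \<open>?K\<close>.\<close>
  define L where "L = (\<lambda>v. coord_proj (k + d) (g0 v))"
  have linL: "linear L" unfolding L_def using linear_compose[OF g0(1) linear_coord_proj] by (simp add: comp_def)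
  have Lin: "L v \<in> coord_space (k + d)" for v by (simp add: L_def coord_proj_in_coord_space)
  have LK: "L v = g0 v" if "v \<in> ?K" for v
    unfolding L_def by (rule coord_proj_ident[OF kdD]) (use g0(2) that in blast)
  define J where "J = (shift_coords k m d :: 'm \<Rightarrow> 's)"
  have linJ: "linear J" unfolding J_def by (rule linear_shift_coords)
  define h where "h z = J (?g z) + L z" for z
  have gM: "?g z \<in> model M" if "z \<in> \<phi> ` ?W" for z using that inv chartD(5)[OF chV] by auto
  have Lm: "L v \<in> model S" for v using Lin coord_space_mono[of "k + d" "m + d"] km unfolding ES by fastforce
  have hs: "smooth_on (model S) (\<phi> ` ?W) h"
    unfolding h_def
    by (rule smooth_on_add[OF smooth_on_bounded_linear[OF linJ[unfolded linear_conv_bounded_linear] gs] smooth_on_linear[OF linL]])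
  have him: "h ` \<phi> ` ?W \<subseteq> model S"
  proof (rule image_subsetI)
    fix z
    show "h z \<in> model S" unfolding h_def
      by (rule subspace_add[OF subspace_model _ Lm]) (simp add: J_def ES shift_coords_in)
  qed
  have fr: "frechet_derivative h (at (\<phi> x) within \<phi> ` ?W) v = J (?D v) + L v" if v: "v \<in> model S" for v
  proof (rule has_derivative_unique_subspace[OF subspace_model chart_image_open[OF chU oW] imageI[OF xW] _ _ v])
    show "(h has_derivative frechet_derivative h (at (\<phi> x) within \<phi> ` ?W)) (at (\<phi> x) within \<phi> ` ?W)"
      by (rule smooth_on_has_derivative[OF hs imageI[OF xW]])
    have "(?g has_derivative ?D) (at (\<phi> x) within \<phi> ` ?W)" by (rule has_derivative_subset[OF Dd]) auto
    then show "(h has_derivative (\<lambda>v. J (?D v) + L v)) (at (\<phi> x) within \<phi> ` ?W)"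
      unfolding h_def
      by (intro has_derivative_add bounded_linear.has_derivative[OF linJ[unfolded linear_conv_bounded_linear]]
        bounded_linear_imp_has_derivative linL[unfolded linear_conv_bounded_linear])
  qed auto
  have inj: "v = 0" if v: "v \<in> model S" and 0: "frechet_derivative h (at (\<phi> x) within \<phi> ` ?W) v = 0" for v
  proof -
    have s0: "J (?D v) + L v = 0" using fr[OF v] 0 by simp
    then have "J (?D v) + L v \<in> coord_space (k + d)" using subspace_0[OF subspace_coord_space] by metis
    then have J0: "J (?D v) = 0" unfolding J_def shift_coords_add_in_iff[OF dD km Lin] .
    then have "v \<in> ?K" using shift_coords_eq_0_iff[OF dD mD km, of "?D v"] DM[OF v] v by (simp add: J_def EM)
    moreover have "L v = 0" using s0 J0 by simp
    ultimately have "g0 v = g0 0" "v \<in> ?K" using LK linear_0[OF g0(1)] by auto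
    then show "v = 0" using inj_onD[OF g0(3), of v 0] subspace_0[OF K] by blast
  qed
  obtain G where G: "openin (mtop S) G" "x \<in> G" "G \<subseteq> ?W" "(G, h \<circ> \<phi>) \<in> max_atlas S"
    using max_atlas_compose_local_diffeo[OF S U(2) oW Int_lower1 xW hs him inj] by blast
  have iff: "h (\<phi> z) \<in> coord_space (k + d) \<longleftrightarrow> z \<in> ?X" if z: "z \<in> G" for z
  proof -
    have zU: "z \<in> U" "z \<in> carrier S" "p z \<in> V" using z G(3) by auto
    have hz: "h (\<phi> z) = J (\<psi> (p z)) + L (\<phi> z)" by (simp add: h_def inv[OF zU(1)])
    have pm: "\<psi> (p z) \<in> coord_space m" using chartD(5)[OF chV] zU(3) unfolding EM by blast
    have "h (\<phi> z) \<in> coord_space (k + d) \<longleftrightarrow> J (\<psi> (p z)) = 0"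
      unfolding hz J_def by (rule shift_coords_add_in_iff[OF dD km Lin])
    also have "\<dots> \<longleftrightarrow> \<psi> (p z) \<in> coord_space k" unfolding J_def by (rule shift_coords_eq_0_iff[OF dD mD km pm])
    also have "\<dots> \<longleftrightarrow> p z \<in> Y" by (rule slice_chartD(4)[OF V(1) zU(3)])
    finally show ?thesis using zU(2) by simp
  qed
  have "(h \<circ> \<phi>) ` (G \<inter> ?X) = (h \<circ> \<phi>) ` G \<inter> coord_space (k + d)" using iff by auto
  then have "(G, h \<circ> \<phi>) \<in> slice_charts S ?X (k + d)" unfolding slice_charts_def using G(4) by simp
  then show ?thesis using G(2) unfolding k_def d_def by (intro bexI[of _ "(G, h \<circ> \<phi>)"]) auto
qed

lemma embedded_preimage:
  assumes S: "smooth_manifold S" and M: "smooth_manifold M" and p: "submersion S M p"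
    and Y: "embedded_submanifold M Y"
  shows "embedded_submanifold S {z\<in>carrier S. p z \<in> Y}"
    and "x \<in> carrier S \<Longrightarrow> p x \<in> Y \<Longrightarrow>
      submfd_dim S {z\<in>carrier S. p z \<in> Y} = submfd_dim M Y + (mdim S - mdim M)"
proof -
  let ?X = "{z\<in>carrier S. p z \<in> Y}"
  have e: "embedded_of_dim S ?X (submfd_dim M Y + (mdim S - mdim M))" if "x \<in> carrier S" "p x \<in> Y" for x
    unfolding embedded_of_dim_def
    using preimage_slice_chart[OF S M p Y] submersion_dim_le[OF S M p that(1)] submfd_dim_le[OF Y] by auto
  show "submfd_dim S ?X = submfd_dim M Y + (mdim S - mdim M)" if "x \<in> carrier S" "p x \<in> Y"
    by (rule submfd_dim_eq[OF S e[OF that]]) (use that in simp)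
  show "embedded_submanifold S ?X"
  \<comment> \<open>The dimension inequality is obtained at a point of the preimage, so an empty
    preimage is treated separately, as a submanifold of dimension 0.\<close>
  proof (cases "?X = {}")
    case True
    have "embedded_of_dim S {} 0" unfolding embedded_of_dim_def by simp
    then show ?thesis unfolding True embedded_submanifold_def by (rule exI)
  next
    case False
    then obtain x where "x \<in> carrier S" "p x \<in> Y" by blast
    then show ?thesis unfolding embedded_submanifold_def using e by blast
  qed
qed

section \<open>Coregular submanifolds and Poisson submersions\<close>

lemma tangent_map_compose:
  assumes A: "smooth_manifold A" and B: "smooth_manifold B" and C: "smooth_manifold C"
    and f: "smooth_map A B f" and g: "smooth_map B C g" and x: "x \<in> carrier A" and v: "v \<in> model A"
  shows "tangent_map A C (g \<circ> f) x v = tangent_map B C g (f x) (tangent_map A B f x v)"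
proof -
  have fx: "f x \<in> carrier B" using smooth_map_carrier[OF f x] .
  have gx: "g (f x) \<in> carrier C" using smooth_map_carrier[OF g fx] .
  let ?V = "fst (chart_at C (g (f x)))" and ?\<psi> = "snd (chart_at C (g (f x)))"
  note c = chart_at_max[OF C gx]
  note oV = chartD(1)[OF max_atlas_chart[OF c]]
  have s: "smooth_fun_on B {y\<in>carrier B. g y \<in> ?V} (?\<psi> \<circ> g)"
    by (rule smooth_fun_on_pullback[OF B C g oV smooth_fun_on_chart_self[OF C c]])
  have "deriv_at A ((?\<psi> \<circ> g) \<circ> f) x v = deriv_at B (?\<psi> \<circ> g) (f x) (tangent_map A B f x v)"
    by (rule deriv_at_chain[OF A B f x smooth_map_preimage_open[OF g oV] _ s v])
       (use fx chart_at_atlas(2)[OF C gx] in simp)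
  then show ?thesis by (simp add: tangent_map_def comp_assoc)
qed

lemma submersionD:
  assumes "submersion S M p"
  shows "smooth_map S M p" "x \<in> carrier S \<Longrightarrow> tangent_map S M p x ` model S = model M"
  using assms unfolding submersion_def tangent_space_def by auto

text \<open>A covector vanishing on the preimage of \<open>T\<close> vanishes on the kernel of the
  tangent map, since \<open>T\<close> contains 0. It therefore descends to \<open>M\<close>, by
  composition with a linear right inverse of the tangent map.\<close>

lemma annihilator_preimage:
  fixes S :: "('a, 's::euclidean_space) mfd" and M :: "('b, 'm::euclidean_space) mfd"
  assumes S: "smooth_manifold S" and M: "smooth_manifold M" and p: "submersion S M p" and x: "x \<in> carrier S"
    and T: "subspace T" "T \<subseteq> model M"
  shows "annihilator S x {v\<in>model S. tangent_map S M p x v \<in> T} = cotangent_map S M p x ` annihilator M (p x) T"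
proof
  note sm = submersionD(1)[OF p] and sur = submersionD(2)[OF p x]
  let ?P = "tangent_map S M p x"
  have linP: "linear ?P" by (rule tangent_map_linear[OF S M sm x])
  show "cotangent_map S M p x ` annihilator M (p x) T \<subseteq> annihilator S x {v\<in>model S. ?P v \<in> T}"
    using cotangent_map_inner[OF S M sm x] cotangent_map_in_model[of S M p x] by (auto simp: annihilator_alt)
  show "annihilator S x {v\<in>model S. ?P v \<in> T} \<subseteq> cotangent_map S M p x ` annihilator M (p x) T"
  proof
    fix \<nu> assume "\<nu> \<in> annihilator S x {v\<in>model S. ?P v \<in> T}"
    then have \<nu>: "\<nu> \<in> model S" "\<And>v. v \<in> model S \<Longrightarrow> ?P v \<in> T \<Longrightarrow> \<nu> \<bullet> v = 0" by (auto simp: annihilator_alt)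
    have sS: "span (model S) = model S" and sM: "span (model M) = model M" by (simp_all add: span_eq_iff)
    have "\<exists>g. range g \<subseteq> span (model S) \<and> linear g \<and> (\<forall>w\<in>span (model M). ?P (g w) = w)"
      by (rule linear_surj_right_inverse[OF linP]) (simp add: sS sM sur)
    then obtain g where g: "range g \<subseteq> model S" "linear g" "\<forall>w\<in>model M. ?P (g w) = w"
      unfolding sS sM by (elim exE conjE)
    have gS: "g w \<in> model S" for w using g(1) by blast
    have lin: "linear (\<lambda>w. \<nu> \<bullet> g w)"
      using linear_compose[OF g(2) bounded_linear.linear[OF bounded_linear_inner_right[of \<nu>]]] by (simp add: comp_def)
    let ?\<xi> = "\<Sum>i<mdim M. (\<nu> \<bullet> g (coord_vec i)) *\<^sub>R coord_vec i"
    have \<xi>: "?\<xi> \<bullet> w = \<nu> \<bullet> g w" if "w \<in> model M" for w by (rule sum_coord_vec_inner[OF M that lin])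
    have "?\<xi> \<in> annihilator M (p x) T"
      unfolding annihilator_alt
    proof (intro CollectI conjI ballI sum_coord_vec_in_model)
      fix t assume t: "t \<in> T"
      then have tM: "t \<in> model M" using T(2) by blast
      show "?\<xi> \<bullet> t = 0" unfolding \<xi>[OF tM] by (rule \<nu>(2)[OF gS]) (use g(3) tM t in simp)
    qed
    moreover have "\<nu> = cotangent_map S M p x ?\<xi>"
    proof (rule model_eqI[OF S \<nu>(1) cotangent_map_in_model])
      fix v assume v: "v \<in> model S"
      have Pv: "?P v \<in> model M" by (rule tangent_map_in_model[OF S M sm x v])
      have "?P (g (?P v) - v) = 0" using g(3) Pv by (simp add: linear_diff[OF linP])
      then have "\<nu> \<bullet> (g (?P v) - v) = 0"
        using \<nu>(2)[of "g (?P v) - v"] subspace_diff[OF subspace_model gS v] subspace_0[OF T(1)] by simp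
      then have "\<nu> \<bullet> v = ?\<xi> \<bullet> ?P v" using \<xi>[OF Pv] by (simp add: inner_diff_right)
      then show "v \<bullet> \<nu> = v \<bullet> cotangent_map S M p x ?\<xi>"
        using cotangent_map_inner[OF S M sm x v, of ?\<xi>] by (simp add: inner_commute)
    qed
    ultimately show "\<nu> \<in> cotangent_map S M p x ` annihilator M (p x) T" by (rule rev_image_eqI)
  qed
qed

lemma vertical_eq: "vertical S M p x = {v\<in>model S. tangent_map S M p x v \<in> {0}}"
  by (simp add: vertical_def tangent_space_def)

lemma annihilator_vertical:
  assumes S: "smooth_manifold S" and M: "smooth_manifold M" and p: "submersion S M p" and x: "x \<in> carrier S"
  shows "annihilator S x (vertical S M p x) = cotangent_map S M p x ` model M"
proof -
  have "annihilator M (p x) {0} = model M" by (simp add: annihilator_alt)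
  then show ?thesis
    unfolding vertical_eq using annihilator_preimage[OF S M p x, of "{0}"] subspace_0[OF subspace_model, of M]
    by (simp add: subspace_def)
qed

lemma poisson_submersionD:
  assumes "poisson_submersion S \<pi>S M \<pi>M p"
  shows "poisson_manifold S \<pi>S" "poisson_manifold M \<pi>M" "submersion S M p" 
    "x \<in> carrier S \<Longrightarrow> \<xi> \<in> model M \<Longrightarrow> \<eta> \<in> model M \<Longrightarrow>
      \<pi>S x (cotangent_map S M p x \<xi>) (cotangent_map S M p x \<eta>) = \<pi>M (p x) \<xi> \<eta>"
  using assms unfolding poisson_submersion_def poisson_map_def cotangent_space_def by auto

text \<open>Operator form of the Poisson condition: paired with a covector, both sides become values
  of the two bivectors. Hamiltonian vectors of pulled back covectors are thus projectable.\<close>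

lemma tangent_map_sharp_cotangent:
  assumes P: "poisson_submersion S \<pi>S M \<pi>M p" and x: "x \<in> carrier S" and \<xi>: "\<xi> \<in> model M"
  shows "tangent_map S M p x (sharp S \<pi>S x (cotangent_map S M p x \<xi>)) = sharp M \<pi>M (p x) \<xi>"
proof -
  note S = poisson_manifoldD(1)[OF poisson_submersionD(1)[OF P]] and M = poisson_manifoldD(1)[OF poisson_submersionD(2)[OF P]]
  note sm = submersionD(1)[OF poisson_submersionD(3)[OF P]]
  note aS = smooth_bivector_alternating[OF poisson_manifoldD(2)[OF poisson_submersionD(1)[OF P]] x]
  note aM = smooth_bivector_alternating[OF poisson_manifoldD(2)[OF poisson_submersionD(2)[OF P]] smooth_map_carrier[OF sm x]]
  let ?c = "cotangent_map S M p x"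
  show ?thesis
  proof (rule model_eqI[OF M tangent_map_in_model[OF S M sm x sharp_in_model] sharp_in_model])
    fix \<eta> assume \<eta>: "\<eta> \<in> model M"
    have "\<eta> \<bullet> tangent_map S M p x (sharp S \<pi>S x (?c \<xi>)) = ?c \<eta> \<bullet> sharp S \<pi>S x (?c \<xi>)"
      using cotangent_map_inner[OF S M sm x sharp_in_model, of \<eta>] by simp
    also have "\<dots> = \<pi>S x (?c \<xi>) (?c \<eta>)"
      by (rule sharp_inner[where \<pi>=\<pi>S and x=x, OF S aS cotangent_map_in_model cotangent_map_in_model])
    also have "\<dots> = \<pi>M (p x) \<xi> \<eta>" by (rule poisson_submersionD(4)[OF P x \<xi> \<eta>])
    also have "\<dots> = \<eta> \<bullet> sharp M \<pi>M (p x) \<xi>"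
      by (rule sharp_inner[where \<pi>=\<pi>M and x="p x", OF M aM \<xi> \<eta>, symmetric])
    finally show "\<eta> \<bullet> tangent_map S M p x (sharp S \<pi>S x (?c \<xi>)) = \<eta> \<bullet> sharp M \<pi>M (p x) \<xi>" .
  qed
qed

text \<open>Transversality makes the sum direct.\<close>

lemma dim_tangent_sharp_sum:
  assumes M: "smooth_manifold M" and b: "smooth_bivector M \<pi>" and X: "embedded_submanifold M X" and x: "x \<in> X"
    and tr: "sharp M \<pi> x ` conormal M X x \<inter> sub_tangent M X x = {0}"
  shows "dim (tangent_sharp_sum M \<pi> X x) = submfd_dim M X + dim (sharp M \<pi> x ` conormal M X x)"
proof -
  have a: "alternating_on (model M) (\<pi> x)" using smooth_bivector_alternating[OF b] embedded_subset[OF X] x by blast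
  have C: "subspace (sharp M \<pi> x ` conormal M X x)"
    unfolding conormal_eq
    by (rule subspace_sharp_image[where \<pi>=\<pi> and x=x, OF a subspace_annihilator(1) subspace_annihilator(2)])
  have "sub_tangent M X x \<inter> sharp M \<pi> x ` conormal M X x = {0}" using tr by (simp add: Int_commute)
  then show ?thesis
    using dim_sums_Int[OF subspace_sub_tangent(1)[OF M X x] C] subspace_sub_tangent(3)[OF M X x] by simp
qed

text \<open>A chart translated so that \<open>y\<close> becomes the origin yields a slice chart for
  the point. The tangent space is 0, so transversality is immediate, and a rank on a single point is
  constant.\<close>

lemma point_coregular:
  fixes M :: "('b, 'm::euclidean_space) mfd"
  assumes M: "smooth_manifold M" and b: "smooth_bivector M \<pi>" and y: "y \<in> carrier M"
  shows "coregular_poisson_dirac M \<pi> {y}"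
proof -
  obtain U \<phi> where U: "(U, \<phi>) \<in> atlas M" "(U, \<phi>) \<in> max_atlas M" "y \<in> U" using atlas_cover[OF M y] by metis
  note ch = max_atlas_chart[OF U(2)]
  let ?g = "\<lambda>z. z + - \<phi> y"
  have s: "smooth_on (model M) (\<phi> ` U) ?g"
    using smooth_on_add[OF smooth_on_linear[OF linear_id] smooth_on_const[of "model M" "\<phi> ` U" "- \<phi> y"]] by simp
  have my: "- \<phi> y \<in> model M" using chartD(5)[OF ch] U(3) by (intro subspace_neg subspace_model) auto
  have im: "?g ` \<phi> ` U \<subseteq> model M"
    using chartD(5)[OF ch] my by (intro image_subsetI subspace_add subspace_model) auto
  have "v = 0" if v: "v \<in> model M" and 0: "frechet_derivative ?g (at (\<phi> y) within \<phi> ` U) v = 0" for v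
  proof -
    have "frechet_derivative ?g (at (\<phi> y) within \<phi> ` U) v = v"
      by (rule has_derivative_unique_subspace[OF subspace_model chartD(4)[OF ch] imageI[OF U(3)]
          smooth_on_has_derivative[OF s imageI[OF U(3)]] _ v])
         (auto intro!: derivative_eq_intros)
    then show ?thesis using 0 by simp
  qed
  then obtain G where G: "openin (mtop M) G" "y \<in> G" "G \<subseteq> U" "(G, ?g \<circ> \<phi>) \<in> max_atlas M"
    using max_atlas_compose_local_diffeo[OF M U(2) chartD(1)[OF ch] order_refl U(3) s im] by blast
  have c0: "coord_space 0 = ({0} :: 'm set)" by (simp add: coord_space_def)
  have "(?g \<circ> \<phi>) ` (G \<inter> {y}) = (?g \<circ> \<phi>) ` G \<inter> coord_space 0"
    using G(2) by (auto simp: c0 image_iff intro!: bexI[of _ y])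
  then have "(G, ?g \<circ> \<phi>) \<in> slice_charts M {y} 0" unfolding slice_charts_def using G(4) by simp
  then have e: "embedded_of_dim M {y} 0"
    unfolding embedded_of_dim_def using y G(2) by (auto intro!: bexI[of _ "(G, ?g \<circ> \<phi>)"])
  then have X: "embedded_submanifold M {y}" unfolding embedded_submanifold_def by (rule exI)
  have d: "submfd_dim M {y} = 0" by (rule submfd_dim_eq[OF M e]) simp
  have "sub_tangent M {y} y = {0}"
    using subspace_sub_tangent[OF M X singletonI] d by (auto simp: dim_eq_0 subspace_0)
  moreover have "0 \<in> sharp M \<pi> y ` conormal M {y} y"
    unfolding conormal_eq
    by (rule subspace_0[OF subspace_sharp_image[where \<pi>=\<pi> and x=y, OF smooth_bivector_alternating[OF b y] subspace_annihilator(1) subspace_annihilator(2)]])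
  ultimately have tr: "\<forall>x\<in>{y}. sharp M \<pi> x ` conormal M {y} x \<inter> sub_tangent M {y} x = {0}" by auto
  show ?thesis by (rule coregularI[OF M b X tr]) simp
qed

section \<open>The preimage of a coregular submanifold and the restricted map\<close>

locale coregular_preimage =
  fixes S :: "('a, 's::euclidean_space) mfd" and \<pi>S :: "('a, 's) bivector_field"
    and M :: "('b, 'm::euclidean_space) mfd" and \<pi>M :: "('b, 'm) bivector_field"
    and p :: "'a \<Rightarrow> 'b" and Y :: "'b set"
  assumes P: "poisson_submersion S \<pi>S M \<pi>M p"
    and vert: "\<forall>x\<in>carrier S. sharp S \<pi>S x ` annihilator S x (vertical S M p x) \<inter> vertical S M p x = {0}"
    and co: "coregular_poisson_dirac M \<pi>M Y"
begin

abbreviation "X \<equiv> {x\<in>carrier S. p x \<in> Y}"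

lemmas PS = poisson_submersionD(1)[OF P] and PM = poisson_submersionD(2)[OF P] and sub = poisson_submersionD(3)[OF P]
lemmas S = poisson_manifoldD(1)[OF PS] and M = poisson_manifoldD(1)[OF PM]
lemmas bS = poisson_manifoldD(2)[OF PS] and bM = poisson_manifoldD(2)[OF PM]
lemmas sm = submersionD(1)[OF sub]
lemmas Y = coregularD(1)[OF co] and trY = coregularD(2)[OF co]
lemmas X = embedded_preimage(1)[OF S M sub Y]
lemmas NX = smooth_manifold_submfd[OF S X] and NY = smooth_manifold_submfd[OF M Y]

lemma smooth_map_X_M: "smooth_map (submfd S X) M p"
  using smooth_map_compose[OF NX S M smooth_map_incl[OF S X] sm] by (simp add: comp_def)

lemma smooth_map_X_Y: "smooth_map (submfd S X) (submfd M Y) p"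
  by (rule smooth_map_corestrict[OF NX M Y smooth_map_X_M]) auto

text \<open>The map from \<open>X\<close> to \<open>M\<close> factors in two ways, through
  \<open>S\<close> and through \<open>Y\<close>; the chain rule is applied to both.\<close>

lemma tangent_map_incl:
  assumes x: "x \<in> X" and u: "u \<in> model (submfd S X)"
  shows "tangent_map S M p x (incl_push S X x u) = incl_push M Y (p x) (tangent_map (submfd S X) (submfd M Y) p x u)"
proof -
  have xc: "x \<in> carrier (submfd S X)" using carrier_submfd[OF X] x by blast
  have "tangent_map (submfd S X) M (p \<circ> (\<lambda>x. x)) x u = tangent_map S M p x (incl_push S X x u)"
    by (rule tangent_map_compose[OF NX S M smooth_map_incl[OF S X] sm xc u])
  moreover have "tangent_map (submfd S X) M ((\<lambda>x. x) \<circ> p) x u =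
      incl_push M Y (p x) (tangent_map (submfd S X) (submfd M Y) p x u)"
    by (rule tangent_map_compose[OF NX NY M smooth_map_X_Y smooth_map_incl[OF M Y] xc u])
  ultimately show ?thesis by (simp add: comp_def)
qed

lemma dim_X: "x \<in> X \<Longrightarrow> submfd_dim S X = submfd_dim M Y + (mdim S - mdim M)"
  by (rule embedded_preimage(2)[OF S M sub Y]) auto

text \<open>Commutation of \<open>p\<close> with the two inclusions gives one containment;
  comparison of dimensions makes it an equality.\<close>

lemma sub_tangent_X:
  assumes x: "x \<in> X"
  shows "sub_tangent S X x = {v\<in>model S. tangent_map S M p x v \<in> sub_tangent M Y (p x)}"
proof -
  let ?P = "tangent_map S M p x" 
  have xS: "x \<in> carrier S" and pY: "p x \<in> Y" using x by auto
  have xc: "x \<in> carrier (submfd S X)" using carrier_submfd[OF X] x by blast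
  have linP: "linear ?P" by (rule tangent_map_linear[OF S M sm xS])
  note TY = subspace_sub_tangent[OF M Y pY] and TX = subspace_sub_tangent[OF S X x]
  let ?V = "{v\<in>model S. ?P v \<in> sub_tangent M Y (p x)}"
  have "?V = model S \<inter> {v. ?P v \<in> sub_tangent M Y (p x)}" by auto
  then have V: "subspace ?V"
    using subspace_inter[OF subspace_model linear_subspace_vimage[OF linP TY(1)], of S] by (simp add: vimage_def)
  have sub': "sub_tangent S X x \<subseteq> ?V"
  proof
    fix v assume v: "v \<in> sub_tangent S X x"
    then obtain u where u: "u \<in> model (submfd S X)" "v = incl_push S X x u" by (rule sub_tangentE)
    have "?P v \<in> sub_tangent M Y (p x)"
      unfolding u(2) tangent_map_incl[OF x u(1)]
      by (rule incl_push_sub_tangent[OF tangent_map_in_model[OF NX NY smooth_map_X_Y xc u(1)]])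
    then show "v \<in> ?V" using v TX(2) by blast
  qed
  have "dim ?V + dim (?P ` model S) = dim (model S) + dim (sub_tangent M Y (p x))"
    by (rule dim_linear_preimage[OF linP subspace_model TY(1)]) (use TY(2) submersionD(2)[OF sub xS] in simp)
  moreover have "dim (model M) = mdim M" "dim (model S) = mdim S"
    using mdim_le[OF M] mdim_le[OF S] by (simp_all add: model_def dim_coord_space)
  ultimately have "dim ?V = dim (sub_tangent S X x)"
    using TY(3) TX(3) dim_X[OF x] submersion_dim_le[OF S M sub xS] submersionD(2)[OF sub xS] by simp
  then show ?thesis using subspace_dim_equal[OF TX(1) V sub'] by simp
qed

lemma conormal_X:
  assumes x: "x \<in> X"
  shows "conormal S X x = cotangent_map S M p x ` conormal M Y (p x)"
proof -
  have xS: "x \<in> carrier S" and pY: "p x \<in> Y" using x by auto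
  show ?thesis
    unfolding conormal_eq sub_tangent_X[OF x]
    by (rule annihilator_preimage[OF S M sub xS subspace_sub_tangent(1,2)[OF M Y pY]])
qed

text \<open>The form in which the assumption on the vertical bundle enters the later arguments: a
  pulled back covector annihilates the vertical space, so if the tangent map kills its Hamiltonian
  vector, that vector lies in the zero intersection.\<close>

lemma vert_eq_0:
  assumes "x \<in> carrier S" "\<xi> \<in> model M"
    and "tangent_map S M p x (sharp S \<pi>S x (cotangent_map S M p x \<xi>)) = 0"
  shows "sharp S \<pi>S x (cotangent_map S M p x \<xi>) = 0"
proof -
  have "sharp S \<pi>S x (cotangent_map S M p x \<xi>) \<in> sharp S \<pi>S x ` annihilator S x (vertical S M p x)"
    unfolding annihilator_vertical[OF S M sub assms(1)] using assms(2) by simp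
  moreover have "sharp S \<pi>S x (cotangent_map S M p x \<xi>) \<in> vertical S M p x"
    unfolding vertical_def tangent_space_def using assms(3) sharp_in_model by simp
  ultimately show ?thesis using vert assms(1) by blast
qed

lemma sharp_cotangent_tangent:
  assumes x: "x \<in> X" and \<xi>: "\<xi> \<in> model M" "sharp M \<pi>M (p x) \<xi> \<in> sub_tangent M Y (p x)"
  shows "sharp S \<pi>S x (cotangent_map S M p x \<xi>) \<in> sub_tangent S X x"
proof -
  have xS: "x \<in> carrier S" using x by simp
  show ?thesis
    unfolding sub_tangent_X[OF x] using tangent_map_sharp_cotangent[OF P xS \<xi>(1)] \<xi>(2) sharp_in_model by simp
qed

lemma conormal_modelD: "\<xi> \<in> conormal M Y z \<Longrightarrow> \<xi> \<in> model M"
  by (simp add: conormal_eq annihilator_alt)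

text \<open>A common vector projects both into sharp(N*Y) and into TY, hence to 0, and
  \<open>vert_eq_0\<close> shows that it was already 0 in \<open>S\<close>.\<close>

lemma transverse_X:
  assumes x: "x \<in> X" shows "sharp S \<pi>S x ` conormal S X x \<inter> sub_tangent S X x = {0}"
proof -
  have xS: "x \<in> carrier S" and pY: "p x \<in> Y" using x by auto
  note a = smooth_bivector_alternating[OF bS xS]
  have "v = 0" if v: "v \<in> sharp S \<pi>S x ` conormal S X x" "v \<in> sub_tangent S X x" for v
  proof -
    obtain \<xi> where \<xi>: "\<xi> \<in> conormal M Y (p x)" "v = sharp S \<pi>S x (cotangent_map S M p x \<xi>)"
      using v(1) unfolding conormal_X[OF x] by blast
    have \<xi>M: "\<xi> \<in> model M" using \<xi>(1) by (rule conormal_modelD)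
    have "tangent_map S M p x v = sharp M \<pi>M (p x) \<xi>"
      unfolding \<xi>(2) by (rule tangent_map_sharp_cotangent[OF P xS \<xi>M])
    moreover have "tangent_map S M p x v \<in> sub_tangent M Y (p x)" using v(2) unfolding sub_tangent_X[OF x] by simp
    ultimately have "tangent_map S M p x v \<in> sharp M \<pi>M (p x) ` conormal M Y (p x) \<inter> sub_tangent M Y (p x)"
      using \<xi>(1) by simp
    then have "tangent_map S M p x v = 0" using bspec[OF trY pY] by simp
    then show "v = 0" using vert_eq_0[OF xS \<xi>M] \<xi>(2) by simp
  qed
  moreover have "0 \<in> sharp S \<pi>S x ` conormal S X x"
    unfolding conormal_eq
    by (rule subspace_0[OF subspace_sharp_image[where \<pi>=\<pi>S and x=x, OF a subspace_annihilator(1) subspace_annihilator(2)]])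
  moreover have "0 \<in> sub_tangent S X x" by (rule subspace_0[OF subspace_sub_tangent(1)[OF S X x]])
  ultimately show ?thesis by blast
qed

text \<open>The tangent map of \<open>p\<close> takes the first space onto the second by
  \<open>tangent_map_sharp_cotangent\<close> and is injective on it by
  \<open>vert_eq_0\<close>.\<close>

lemma dim_sharp_conormal:
  assumes x: "x \<in> X"
  shows "dim (sharp S \<pi>S x ` conormal S X x) = dim (sharp M \<pi>M (p x) ` conormal M Y (p x))"
proof -
  have xS: "x \<in> carrier S" and pY: "p x \<in> Y" using x by auto
  let ?P = "tangent_map S M p x" and ?C = "sharp S \<pi>S x ` conormal S X x"
  have linP: "linear ?P" by (rule tangent_map_linear[OF S M sm xS])
  have C: "subspace ?C"
    unfolding conormal_eq
    by (rule subspace_sharp_image[where \<pi>=\<pi>S and x=x, OF smooth_bivector_alternating[OF bS xS] subspace_annihilator(1) subspace_annihilator(2)])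
  have "?P ` ?C = sharp M \<pi>M (p x) ` conormal M Y (p x)"
    unfolding conormal_X[OF x] image_image
    by (rule image_cong[OF refl tangent_map_sharp_cotangent[OF P xS conormal_modelD]])
  moreover have "dim (?P ` ?C) = dim ?C"
  proof (rule dim_image_inj_subspace[OF linP C])
    fix v assume v: "v \<in> ?C" "?P v = 0"
    then obtain \<xi> where \<xi>: "\<xi> \<in> conormal M Y (p x)" "v = sharp S \<pi>S x (cotangent_map S M p x \<xi>)"
      unfolding conormal_X[OF x] by blast
    show "v = 0" unfolding \<xi>(2) by (rule vert_eq_0[OF xS conormal_modelD[OF \<xi>(1)]]) (use v(2) \<xi>(2) in simp)
  qed
  ultimately show ?thesis by simp
qed

text \<open>The dimension splits into that of \<open>X\<close>, which exceeds that of
  \<open>Y\<close> by \<open>mdim S - mdim M\<close>, and that of sharp(N*X), which equals its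
  counterpart at \<open>p x\<close>. Constancy is thus inherited from \<open>Y\<close>.\<close>

lemma coregular_X: "coregular_poisson_dirac S \<pi>S X"
proof -
  obtain r where r: "\<forall>y\<in>Y. dim (tangent_sharp_sum M \<pi>M Y y) = r" using coregularD(3)[OF co] ..
  have "dim (tangent_sharp_sum S \<pi>S X x) = r + (mdim S - mdim M)" if x: "x \<in> X" for x
  proof -
    have pY: "p x \<in> Y" using x by simp
    show ?thesis
      using dim_tangent_sharp_sum[OF S bS X x transverse_X[OF x]] dim_sharp_conormal[OF x] dim_X[OF x]
        dim_tangent_sharp_sum[OF M bM Y pY bspec[OF trY pY]] bspec[OF r pY] by simp
  qed
  then show ?thesis using transverse_X by (intro coregularI[OF S bS X]) blast+
qed

text \<open>The tangent space of \<open>X\<close> is the full preimage of that of \<open>Y\<close>,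
  so a vector of \<open>S\<close> lying over a vector tangent to \<open>Y\<close> is automatically
  tangent to \<open>X\<close>.\<close>

lemma submersion_X: "submersion (submfd S X) (submfd M Y) p"
  unfolding submersion_def tangent_space_def
proof (intro conjI ballI smooth_map_X_Y)
  fix x assume xc: "x \<in> carrier (submfd S X)"
  then have x: "x \<in> X" using carrier_submfd[OF X] by blast
  then have xS: "x \<in> carrier S" and pY: "p x \<in> Y" by auto
  let ?q = "tangent_map (submfd S X) (submfd M Y) p x"
  show "?q ` model (submfd S X) = model (submfd M Y)"
  proof
    show "?q ` model (submfd S X) \<subseteq> model (submfd M Y)"
      by (rule image_subsetI) (rule tangent_map_in_model[OF NX NY smooth_map_X_Y xc])
    show "model (submfd M Y) \<subseteq> ?q ` model (submfd S X)"
    proof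
      fix w assume w: "w \<in> model (submfd M Y)"
      have iw: "incl_push M Y (p x) w \<in> sub_tangent M Y (p x)" by (rule incl_push_sub_tangent[OF w])
      have "incl_push M Y (p x) w \<in> tangent_map S M p x ` model S"
        unfolding submersionD(2)[OF sub xS] by (rule incl_push_model[OF M Y pY w])
      then obtain v where v: "v \<in> model S" "tangent_map S M p x v = incl_push M Y (p x) w" by auto
      have "v \<in> sub_tangent S X x" unfolding sub_tangent_X[OF x] using v iw by simp
      then obtain u where u: "u \<in> model (submfd S X)" "v = incl_push S X x u" by (rule sub_tangentE)
      have qu: "?q u \<in> model (submfd M Y)" by (rule tangent_map_in_model[OF NX NY smooth_map_X_Y xc u(1)])
      have "incl_push M Y (p x) (?q u - w) = 0"
        using tangent_map_incl[OF x u(1)] v(2) u(2) by (simp add: linear_diff[OF incl_push_linear[OF M Y pY]])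
      then have "?q u = w"
        using incl_push_eq_0[OF M Y pY subspace_diff[OF subspace_model qu w]] by simp
      then show "w \<in> ?q ` model (submfd S X)" using u(1) by blast
    qed
  qed
qed

text \<open>The transpose of \<open>tangent_map_incl\<close>.\<close>

lemma incl_pull_cotangent:
  assumes x: "x \<in> X"
  shows "incl_pull S X x (cotangent_map S M p x \<xi>) = cotangent_map (submfd S X) (submfd M Y) p x (incl_pull M Y (p x) \<xi>)"
proof (rule model_eqI[OF NX incl_pull_model cotangent_map_in_model])
  have xS: "x \<in> carrier S" and pY: "p x \<in> Y" using x by auto
  have xc: "x \<in> carrier (submfd S X)" using carrier_submfd[OF X] x by blast
  fix u assume u: "u \<in> model (submfd S X)"
  note qu = tangent_map_in_model[OF NX NY smooth_map_X_Y xc u]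
  have "incl_pull S X x (cotangent_map S M p x \<xi>) \<bullet> u = \<xi> \<bullet> tangent_map S M p x (incl_push S X x u)"
    unfolding incl_pull_inner[OF S X x u] by (rule cotangent_map_inner[OF S M sm xS incl_push_model[OF S X x u]])
  also have "\<dots> = cotangent_map (submfd S X) (submfd M Y) p x (incl_pull M Y (p x) \<xi>) \<bullet> u"
    unfolding cotangent_map_inner[OF NX NY smooth_map_X_Y xc u] tangent_map_incl[OF x u]
    by (rule incl_pull_inner[OF M Y pY qu, symmetric])
  finally show "u \<bullet> incl_pull S X x (cotangent_map S M p x \<xi>) =
    u \<bullet> cotangent_map (submfd S X) (submfd M Y) p x (incl_pull M Y (p x) \<xi>)" by (simp add: inner_commute)
qed

text \<open>If \<xi> lifts a covector \<zeta> of \<open>Y\<close> and has tangent Hamiltonian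
  vector, then its pullback by \<open>p\<close> lifts the pullback of \<zeta> to \<open>X\<close> in
  the same sense. Both claims are thereby transported to \<open>S\<close> and \<open>M\<close>. The
  second one is the condition on the vertical bundle for the restricted map, so that the result on
  fibres can be applied to it.\<close>

lemma induced_submersion:
  assumes indX: "induced_poisson S \<pi>S X \<pi>X" and indY: "induced_poisson M \<pi>M Y \<pi>Y"
  shows "poisson_submersion (submfd S X) \<pi>X (submfd M Y) \<pi>Y p"
    and "\<forall>x\<in>carrier (submfd S X). sharp (submfd S X) \<pi>X x ` annihilator (submfd S X) x (vertical (submfd S X) (submfd M Y) p x)
      \<inter> vertical (submfd S X) (submfd M Y) p x = {0}"
proof -
  have PX: "poisson_manifold (submfd S X) \<pi>X" by (rule coregular_induced_poisson_manifold[OF PS coregular_X indX])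
  have PY: "poisson_manifold (submfd M Y) \<pi>Y" by (rule coregular_induced_poisson_manifold[OF PM co indY])
  have gX: "x \<in> X \<Longrightarrow> pullback_graph S \<pi>S X x = bivector_graph (submfd S X) \<pi>X x" for x
    using indX unfolding induced_poisson_def by blast
  have gY: "y \<in> Y \<Longrightarrow> pullback_graph M \<pi>M Y y = bivector_graph (submfd M Y) \<pi>Y y" for y
    using indY unfolding induced_poisson_def by blast
  let ?q = "\<lambda>x. cotangent_map (submfd S X) (submfd M Y) p x"
  have lift: "\<exists>\<xi>\<in>model M. sharp M \<pi>M (p x) \<xi> \<in> sub_tangent M Y (p x) \<and> incl_pull M Y (p x) \<xi> = \<zeta>"
    if x: "x \<in> X" and \<zeta>: "\<zeta> \<in> model (submfd M Y)" for x \<zeta>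
  proof -
    have xS: "x \<in> carrier S" and pY: "p x \<in> Y" using x by auto
    show ?thesis
      by (rule covector_tangent_lift[where \<pi>=\<pi>M and x="p x", OF M Y pY
        smooth_bivector_alternating[OF bM smooth_map_carrier[OF sm xS]] bspec[OF trY pY] \<zeta>])
  qed
  show "poisson_submersion (submfd S X) \<pi>X (submfd M Y) \<pi>Y p"
    unfolding poisson_submersion_def poisson_map_def cotangent_space_def
  proof (intro conjI ballI PX PY submersion_X smooth_map_X_Y)
    fix x \<zeta> \<theta> assume xc: "x \<in> carrier (submfd S X)" and \<zeta>: "\<zeta> \<in> model (submfd M Y)" and \<theta>: "\<theta> \<in> model (submfd M Y)"
    have x: "x \<in> X" using xc carrier_submfd[OF X] by blast
    then have xS: "x \<in> carrier S" and pY: "p x \<in> Y" by auto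
    have pc: "p x \<in> carrier (submfd M Y)" using pY carrier_submfd[OF Y] by blast
    obtain \<xi> where \<xi>: "\<xi> \<in> model M" "sharp M \<pi>M (p x) \<xi> \<in> sub_tangent M Y (p x)" "incl_pull M Y (p x) \<xi> = \<zeta>"
      using lift[OF x \<zeta>] by (elim bexE conjE)
    obtain \<eta> where \<eta>: "\<eta> \<in> model M" "sharp M \<pi>M (p x) \<eta> \<in> sub_tangent M Y (p x)" "incl_pull M Y (p x) \<eta> = \<theta>"
      using lift[OF x \<theta>] by (elim bexE conjE)
    have "\<pi>X x (?q x \<zeta>) (?q x \<theta>) = \<pi>X x (incl_pull S X x (cotangent_map S M p x \<xi>)) (incl_pull S X x (cotangent_map S M p x \<eta>))"
      by (simp only: incl_pull_cotangent[OF x] \<xi>(3) \<eta>(3))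
    also have "\<dots> = \<pi>S x (cotangent_map S M p x \<xi>) (cotangent_map S M p x \<eta>)"
      by (rule induced_apply[where \<pi>=\<pi>S and \<rho>=\<pi>X, OF S X x gX[OF x] smooth_bivector_alternating[OF bS xS]
        smooth_bivector_alternating[OF poisson_manifoldD(2)[OF PX] xc] cotangent_map_in_model
        sharp_cotangent_tangent[OF x \<xi>(1,2)] cotangent_map_in_model])
    also have "\<dots> = \<pi>M (p x) \<xi> \<eta>" by (rule poisson_submersionD(4)[OF P xS \<xi>(1) \<eta>(1)])
    also have "\<dots> = \<pi>Y (p x) (incl_pull M Y (p x) \<xi>) (incl_pull M Y (p x) \<eta>)"
      by (rule induced_apply[where \<pi>=\<pi>M and \<rho>=\<pi>Y, OF M Y pY gY[OF pY] smooth_bivector_alternating[OF bM smooth_map_carrier[OF sm xS]]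
        smooth_bivector_alternating[OF poisson_manifoldD(2)[OF PY] pc] \<xi>(1,2) \<eta>(1), symmetric])
    finally show "\<pi>X x (?q x \<zeta>) (?q x \<theta>) = \<pi>Y (p x) \<zeta> \<theta>" by (simp only: \<xi>(3) \<eta>(3))
  qed
  show "\<forall>x\<in>carrier (submfd S X). sharp (submfd S X) \<pi>X x ` annihilator (submfd S X) x (vertical (submfd S X) (submfd M Y) p x)
      \<inter> vertical (submfd S X) (submfd M Y) p x = {0}"
  proof
    fix x assume xc: "x \<in> carrier (submfd S X)"
    have x: "x \<in> X" using xc carrier_submfd[OF X] by blast
    then have xS: "x \<in> carrier S" and pY: "p x \<in> Y" by auto
    let ?V = "vertical (submfd S X) (submfd M Y) p x"
    note a = smooth_bivector_alternating[OF poisson_manifoldD(2)[OF PX] xc]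
    have "u = 0" if u: "u \<in> sharp (submfd S X) \<pi>X x ` annihilator (submfd S X) x ?V" "u \<in> ?V" for u
    proof -
      obtain \<zeta> where \<zeta>: "\<zeta> \<in> model (submfd M Y)" "u = sharp (submfd S X) \<pi>X x (?q x \<zeta>)"
        using u(1) unfolding annihilator_vertical[OF NX NY submersion_X xc] by blast
      obtain \<xi> where \<xi>: "\<xi> \<in> model M" "sharp M \<pi>M (p x) \<xi> \<in> sub_tangent M Y (p x)" "incl_pull M Y (p x) \<xi> = \<zeta>"
        using lift[OF x \<zeta>(1)] by (elim bexE conjE)
      have uN: "u \<in> model (submfd S X)" unfolding \<zeta>(2) by (rule sharp_in_model)
      \<comment> \<open>Pushed into \<open>S\<close>, the vector becomes the Hamiltonian vector of a
        covector pulled back from \<open>M\<close>. Verticality in \<open>X\<close> makes it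
        vertical in \<open>S\<close>, where \<open>vert_eq_0\<close> applies.\<close>
      have "incl_push S X x u = incl_push S X x (sharp (submfd S X) \<pi>X x (incl_pull S X x (cotangent_map S M p x \<xi>)))"
        by (simp only: \<zeta>(2) incl_pull_cotangent[OF x] \<xi>(3))
      also have "\<dots> = sharp S \<pi>S x (cotangent_map S M p x \<xi>)"
        by (rule induced_sharp[where \<pi>=\<pi>S and \<rho>=\<pi>X, OF S X x gX[OF x] cotangent_map_in_model sharp_cotangent_tangent[OF x \<xi>(1,2)]])
      finally have iu: "incl_push S X x u = sharp S \<pi>S x (cotangent_map S M p x \<xi>)" .
      have "tangent_map (submfd S X) (submfd M Y) p x u = 0" using u(2) by (simp add: vertical_def)
      then have "tangent_map S M p x (incl_push S X x u) = 0"
        using tangent_map_incl[OF x uN] linear_0[OF incl_push_linear[OF M Y pY]] by simp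
      then have "incl_push S X x u = 0" using vert_eq_0[OF xS \<xi>(1)] iu by simp
      then show "u = 0" by (rule incl_push_eq_0[OF S X x uN])
    qed
    moreover have "0 \<in> sharp (submfd S X) \<pi>X x ` annihilator (submfd S X) x ?V"
      by (rule subspace_0[OF subspace_sharp_image[where \<pi>=\<pi>X and x=x, OF a subspace_annihilator(1) subspace_annihilator(2)]])
    moreover have "0 \<in> ?V"
      unfolding vertical_def tangent_space_def
      using linear_0[OF tangent_map_linear[OF NX NY smooth_map_X_Y xc]] subspace_0[OF subspace_model[of "submfd S X"]] by blast
    ultimately show "sharp (submfd S X) \<pi>X x ` annihilator (submfd S X) x ?V \<inter> ?V = {0}" by blast
  qed
qed
end

lemma fibre_coregular:
  assumes P: "poisson_submersion S \<pi>S M \<pi>M p"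
    and vert: "\<forall>x\<in>carrier S. sharp S \<pi>S x ` annihilator S x (vertical S M p x) \<inter> vertical S M p x = {0}"
    and y: "y \<in> carrier M"
  shows "coregular_poisson_dirac S \<pi>S (fibre S p y)"
proof -
  note PM = poisson_submersionD(2)[OF P]
  interpret coregular_preimage S \<pi>S M \<pi>M p "{y}"
    by unfold_locales (rule P vert point_coregular[OF poisson_manifoldD(1)[OF PM] poisson_manifoldD(2)[OF PM] y])+
  show ?thesis using coregular_X by (simp add: fibre_def)
qed

theorem theorem3p6:
  fixes S :: "('a, 's::euclidean_space) mfd" and \<pi>S :: "('a, 's) bivector_field"
    and M :: "('b, 'm::euclidean_space) mfd" and \<pi>M :: "('b, 'm) bivector_field"
    and p :: "'a \<Rightarrow> 'b"
  assumes "poisson_submersion S \<pi>S M \<pi>M p"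
    and "\<forall>x\<in>carrier S. sharp S \<pi>S x ` annihilator S x (vertical S M p x) \<inter> vertical S M p x = {0}"
  shows "(\<forall>y\<in>carrier M. coregular_poisson_dirac S \<pi>S (fibre S p y)) \<and>
    (\<forall>Y. coregular_poisson_dirac M \<pi>M Y \<longrightarrow>
      (let X = {x\<in>carrier S. p x \<in> Y} in
        (coregular_poisson_dirac S \<pi>S X \<and> (\<exists>\<pi>X. induced_poisson S \<pi>S X \<pi>X)) \<and>
        (\<forall>\<pi>X \<pi>Y. induced_poisson S \<pi>S X \<pi>X \<and> induced_poisson M \<pi>M Y \<pi>Y \<longrightarrow>
          poisson_submersion (submfd S X) \<pi>X (submfd M Y) \<pi>Y p \<and>
          poisson_fibres (submfd S X) \<pi>X (submfd M Y) p)))"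
proof (intro conjI ballI allI impI)
  show "coregular_poisson_dirac S \<pi>S (fibre S p y)" if "y \<in> carrier M" for y
    by (rule fibre_coregular[OF assms that])
  fix Y assume co: "coregular_poisson_dirac M \<pi>M Y"
  interpret coregular_preimage S \<pi>S M \<pi>M p Y by unfold_locales (rule assms co)+
  have fib: "poisson_fibres (submfd S X) \<pi>X (submfd M Y) p"
    if ind: "induced_poisson S \<pi>S X \<pi>X" "induced_poisson M \<pi>M Y \<pi>Y" for \<pi>X \<pi>Y
    unfolding poisson_fibres_def
  proof (intro conjI ballI)
    note P' = induced_submersion(1)[OF ind]
    show PX: "poisson_manifold (submfd S X) \<pi>X" by (rule poisson_submersionD(1)[OF P'])
    show "submersion (submfd S X) (submfd M Y) p" by (rule submersion_X)
    fix y assume "y \<in> carrier (submfd M Y)"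
    from fibre_coregular[OF P' induced_submersion(2)[OF ind] this]
    have c: "coregular_poisson_dirac (submfd S X) \<pi>X (fibre (submfd S X) p y)" .
    show "poisson_dirac (submfd S X) \<pi>X (fibre (submfd S X) p y)"
      unfolding poisson_dirac_def
      using coregularD(1)[OF c] coregular_induced_exists[OF poisson_manifoldD(1,2)[OF PX] c] by (rule conjI)
  qed
  show "let X = {x\<in>carrier S. p x \<in> Y} in
        (coregular_poisson_dirac S \<pi>S X \<and> (\<exists>\<pi>X. induced_poisson S \<pi>S X \<pi>X)) \<and>
        (\<forall>\<pi>X \<pi>Y. induced_poisson S \<pi>S X \<pi>X \<and> induced_poisson M \<pi>M Y \<pi>Y \<longrightarrow>
          poisson_submersion (submfd S X) \<pi>X (submfd M Y) \<pi>Y p \<and>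
          poisson_fibres (submfd S X) \<pi>X (submfd M Y) p)"
    unfolding Let_def
    using coregular_X coregular_induced_exists[OF S bS coregular_X] induced_submersion(1) fib
    by (intro conjI allI impI; (elim conjE)?; assumption?) blast+
qed

end
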